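(* Let $\nu$ be a probability measure on the state space $E$. Assume that $P_t^*\nu$ (the law of $X_t$ when $X_0\sim\nu$) is absolutely continuous with respect to $\mu$ for some $t>0$, that $E$ is locally compact and that $f$ is continuous. If assumption (A) or assumption (B) of the context is satisfied, then the FCLT holds under $\mathbb P_\nu$ as soon as it holds under $\mathbb P_\mu$.
   Context: $(X_t)_{t\ge0}$ is a diffusion process on $E=\mathbb R^d$ with generator $L=\frac12\sum_{i,j}A_{ij}(x)\partial^2_{i,j}+\sum_iB_i(x)\partial_i$, where $A$ is a smooth field of symmetric positive semidefinite matrices and $B$ a smooth vector field; it is strong Markov, non explosive, irreducible, positive recurrent, with continuous paths and unique invariant probability measure $\mu$. $\mathbb P_\nu$ is the law of the process with $X_0\sim\nu$; $P_t$ is its semigroup; $\Gamma(g,g)=L(g^2)-2gLg$. $f\in L^2(\mu)$, $f\ne0$, $\int f\,d\mu=0$, and $S_t=\int_0^tf(X_s)\,ds$. The FCLT holds under $\mathbb P_\nu$ with normalization $s_t$ (a deterministic positive function) if for every $0<t_1\le\cdots\le t_n<\infty$ the vector $(S_{t_1/\varepsilon}/s_{1/\varepsilon},\ldots,S_{t_n/\varepsilon}/s_{1/\varepsilon})$ converges in law under $\mathbb P_\nu$, as $\varepsilon\to0$, to $(B_{t_1},\ldots,B_{t_n})$, $(B_t)$ being a standard Brownian motion on $\mathbb R$. The same $s_t$ is used under $\mathbb P_\mu$ and $\mathbb P_\nu$. Assumption (A) (Lyapunov): there exist a smooth increasing concave function $\varphi:[1,\infty)\to(0,\infty)$, with either $\lim_{u\to\infty}\varphi'(u)=0$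 or $\varphi$ linear, and a $\varphi$-Lyapunov function $V$ in the domain of $L$, i.e. $V\ge1$ and $LV\le-\varphi(V)+\kappa\mathbf 1_C$ for a constant $\kappa$ and a compact petite set $C$, with $\int V\,d\mu<\infty$; and $V\in L^1(\nu)$. (A set $C$ is petite if there are a probability measure $p(dt)$ on $\mathbb R_+$ and a non trivial positive measure $m$ such that $\int_0^\infty P_t(x,\cdot)\,p(dt)\ge m$ for all $x\in C$.) Assumption (B): the diffusion matrix $A$ is uniformly elliptic and bounded; $\mu(dx)=e^{-W(x)}dx$ is reversible; there is $c<\infty$ such that $2\Gamma(W,W)(x)-LW(x)\ge-c$ for all $x$; the diffusion is uniformly ergodic, i.e. $\sup\{\|P_tg\|_{L^2(\mu)}:\|g\|_{L^\infty(\mu)}=1,\int g\,d\mu=0\}\to0$ as $t\to\infty$; and $e^W\in L^1(\nu)$. *)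

theory Defs
  imports "HOL-Probability.Probability"
begin

section \<open>Differential calculus on Euclidean space\<close>

fun C_k :: "nat \<Rightarrow> ('a::euclidean_space \<Rightarrow> real) \<Rightarrow> bool" where
  "C_k 0 g \<longleftrightarrow> continuous_on UNIV g"
| "C_k (Suc k) g \<longleftrightarrow> g differentiable_on UNIV \<and>
     (\<forall>b\<in>Basis. C_k k (\<lambda>x. frechet_derivative g (at x) b))"

definition smooth :: "('a::euclidean_space \<Rightarrow> real) \<Rightarrow> bool" where
  "smooth g \<longleftrightarrow> (\<forall>k. C_k k g)"

text \<open>Smoothness on the closed half-line \<open>[1,\<infinity>)\<close>, with one-sided derivatives at the end point.\<close>

definition smooth_from_1 :: "(real \<Rightarrow> real) \<Rightarrow> bool" where
  "smooth_from_1 \<phi> \<longleftrightarrow> (\<exists>D :: nat \<Rightarrow> real \<Rightarrow> real. (\<forall>u\<ge>1. D 0 u = \<phi> u) \<and>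
     (\<forall>k. \<forall>u\<ge>1. (D k has_real_derivative D (Suc k) u) (at u within {1..})))"

definition partial :: "'d \<Rightarrow> (real^'d \<Rightarrow> real) \<Rightarrow> real^'d \<Rightarrow> real" where
  "partial i g x = frechet_derivative g (at x) (axis i 1)"

definition diff_op ::
  "(real^'d \<Rightarrow> real^'d^'d) \<Rightarrow> (real^'d \<Rightarrow> real^'d) \<Rightarrow> (real^'d \<Rightarrow> real) \<Rightarrow> real^'d \<Rightarrow> real" where
  "diff_op A B g x =
     (1/2) * (\<Sum>i\<in>UNIV. \<Sum>j\<in>UNIV. A x $ i $ j * partial i (partial j g) x)
     + (\<Sum>i\<in>UNIV. B x $ i * partial i g x)"

definition carre_du_champ ::
  "(real^'d \<Rightarrow> real^'d^'d) \<Rightarrow> (real^'d \<Rightarrow> real^'d) \<Rightarrow> (real^'d \<Rightarrow> real) \<Rightarrow> real^'d \<Rightarrow> real" where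
  "carre_du_champ A B g x = diff_op A B (\<lambda>y. (g y)^2) x - 2 * g x * diff_op A B g x"

section \<open>Path space and martingales\<close>

text \<open>Continuous paths \<open>[0,\<infinity>) \<rightarrow> E\<close> (hence no explosion), represented as functions on
  \<open>real\<close> that are \<open>undefined\<close> at negative times.\<close>

definition path_space :: "(real \<Rightarrow> 'a::topological_space) measure" where
  "path_space = restrict_space (Pi\<^sub>M {0..} (\<lambda>_. borel)) {\<omega>. continuous_on {0..} \<omega>}"

text \<open>Time is indexed by \<open>ennreal\<close> so that stopping times may take the value \<open>\<infinity>\<close>.\<close>

definition path_filtration :: "ennreal \<Rightarrow> (real \<Rightarrow> 'a::topological_space) measure" where
  "path_filtration t = sigma (space path_space)
     {{\<omega>\<in>space path_space. \<omega> s \<in> S} | s S. 0 \<le> s \<and> ennreal s \<le> t \<and> S \<in> sets borel}"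

lemma filtration_path_filtration: "filtration (space path_space) path_filtration"
proof
  show sp: "space (path_filtration i) = space path_space" for i
    unfolding path_filtration_def by (rule space_measure_of) auto
  show "sets (path_filtration i) \<le> sets (path_filtration j)" if "i \<le> j" for i j :: ennreal
    unfolding path_filtration_def using that
    by (subst (1 2) sets_measure_of; (intro sigma_sets_mono')?) (auto intro: order_trans)
qed

definition shift :: "real \<Rightarrow> (real \<Rightarrow> 'a) \<Rightarrow> (real \<Rightarrow> 'a)" where
  "shift s \<omega> = (\<lambda>t\<in>{0..}. \<omega> (s + t))"

definition martingale ::
  "'w measure \<Rightarrow> (ennreal \<Rightarrow> 'w measure) \<Rightarrow> (real \<Rightarrow> 'w \<Rightarrow> real) \<Rightarrow> bool" where
  "martingale P F M \<longleftrightarrow>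
     (\<forall>t\<ge>0. M t \<in> borel_measurable (F (ennreal t)) \<and> integrable P (M t)) \<and>
     (\<forall>s t. 0 \<le> s \<and> s \<le> t \<longrightarrow> (\<forall>S\<in>sets (F (ennreal s)).
        (LINT \<omega>:S|P. M t \<omega>) = (LINT \<omega>:S|P. M s \<omega>)))"

definition local_martingale ::
  "'w measure \<Rightarrow> (ennreal \<Rightarrow> 'w measure) \<Rightarrow> (real \<Rightarrow> 'w \<Rightarrow> real) \<Rightarrow> bool" where
  "local_martingale P F M \<longleftrightarrow> (\<exists>\<tau> :: nat \<Rightarrow> 'w \<Rightarrow> ennreal.
     (\<forall>n. stopping_time F (\<tau> n)) \<and>
     (AE \<omega> in P. incseq (\<lambda>n. \<tau> n \<omega>) \<and> (\<lambda>n. \<tau> n \<omega>) \<longlonglongrightarrow> \<infinity>) \<and>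
     (\<forall>n. martingale P F (\<lambda>t \<omega>. M (enn2real (min (ennreal t) (\<tau> n \<omega>))) \<omega>)))"

text \<open>\<open>M\<^sup>g\<^sub>t = g(X\<^sub>t) - g(X\<^sub>0) - \<integral>\<^sub>0\<^sup>t h(X\<^sub>s) ds\<close>\<close>

definition dynkin :: "('a \<Rightarrow> real) \<Rightarrow> ('a \<Rightarrow> real) \<Rightarrow> real \<Rightarrow> (real \<Rightarrow> 'a) \<Rightarrow> real" where
  "dynkin g h t \<omega> = g (\<omega> t) - g (\<omega> 0) - (LINT s:{0..t}|lborel. h (\<omega> s))"

section \<open>Markov families on path space\<close>

text \<open>A process is given by the family \<open>Q x = \<P>\<^sub>x\<close> of its laws on path space.\<close>

definition law_from ::
  "('a::topological_space \<Rightarrow> (real \<Rightarrow> 'a) measure) \<Rightarrow> 'a measure \<Rightarrow> (real \<Rightarrow> 'a) measure" where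
  "law_from Q \<nu> = \<nu> \<bind> Q"

definition transition ::
  "('a::topological_space \<Rightarrow> (real \<Rightarrow> 'a) measure) \<Rightarrow> real \<Rightarrow> 'a \<Rightarrow> 'a measure" where
  "transition Q t x = distr (Q x) borel (\<lambda>\<omega>. \<omega> t)"

definition semigroup_op ::
  "('a::topological_space \<Rightarrow> (real \<Rightarrow> 'a) measure) \<Rightarrow> real \<Rightarrow> ('a \<Rightarrow> real) \<Rightarrow> 'a \<Rightarrow> real" where
  "semigroup_op Q t g x = (LINT y|transition Q t x. g y)"

definition dual_semigroup ::
  "('a::topological_space \<Rightarrow> (real \<Rightarrow> 'a) measure) \<Rightarrow> real \<Rightarrow> 'a measure \<Rightarrow> 'a measure" where
  "dual_semigroup Q t \<nu> = distr (law_from Q \<nu>) borel (\<lambda>\<omega>. \<omega> t)"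

definition strong_markov ::
  "('a::topological_space \<Rightarrow> (real \<Rightarrow> 'a) measure) \<Rightarrow> bool" where
  "strong_markov Q \<longleftrightarrow> (\<forall>x T. stopping_time path_filtration T \<longrightarrow>
     (\<forall>S\<in>sets (filtration.pre_sigma (space path_space) path_filtration T).
      \<forall>G\<in>sets path_space.
        emeasure (Q x) {\<omega>\<in>S. T \<omega> < \<infinity> \<and> shift (enn2real (T \<omega>)) \<omega> \<in> G} =
        (\<integral>\<^sup>+\<omega>\<in>{\<omega>\<in>S. T \<omega> < \<infinity>}. emeasure (Q (\<omega> (enn2real (T \<omega>)))) G \<partial>Q x)))"

definition invariant_prob ::
  "('a::topological_space \<Rightarrow> (real \<Rightarrow> 'a) measure) \<Rightarrow> 'a measure \<Rightarrow> bool" where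
  "invariant_prob Q \<mu> \<longleftrightarrow> prob_space \<mu> \<and> sets \<mu> = sets borel \<and>
     (\<forall>t\<ge>0. dual_semigroup Q t \<mu> = \<mu>)"

text \<open>Expected total time spent in \<open>S\<close> by the process started from \<open>x\<close>.\<close>

definition occupation ::
  "('a::topological_space \<Rightarrow> (real \<Rightarrow> 'a) measure) \<Rightarrow> 'a \<Rightarrow> 'a set \<Rightarrow> ennreal" where
  "occupation Q x S = (\<integral>\<^sup>+\<omega>. (\<integral>\<^sup>+t\<in>{0..}. indicator S (\<omega> t) \<partial>lborel) \<partial>Q x)"

text \<open>Irreducibility and recurrence in the sense of Meyn and Tweedie, relative to some
  nontrivial \<open>\<sigma>\<close>-finite measure.  A recurrent process is positive recurrent if it has an
  invariant probability measure.\<close>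

definition reference_measure :: "'a::topological_space measure \<Rightarrow> bool" where
  "reference_measure \<psi> \<longleftrightarrow>
     sets \<psi> = sets borel \<and> sigma_finite_measure \<psi> \<and> emeasure \<psi> UNIV \<noteq> 0"

definition irreducible_process ::
  "('a::topological_space \<Rightarrow> (real \<Rightarrow> 'a) measure) \<Rightarrow> bool" where
  "irreducible_process Q \<longleftrightarrow> (\<exists>\<psi>. reference_measure \<psi> \<and>
     (\<forall>x. \<forall>S\<in>sets borel. emeasure \<psi> S > 0 \<longrightarrow> occupation Q x S > 0))"

definition recurrent_process ::
  "('a::topological_space \<Rightarrow> (real \<Rightarrow> 'a) measure) \<Rightarrow> bool" where
  "recurrent_process Q \<longleftrightarrow> (\<exists>\<psi>. reference_measure \<psi> \<and>
     (\<forall>x. \<forall>S\<in>sets borel. emeasure \<psi> S > 0 \<longrightarrow> occupation Q x S = \<infinity>))"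

definition positive_recurrent ::
  "('a::topological_space \<Rightarrow> (real \<Rightarrow> 'a) measure) \<Rightarrow> bool" where
  "positive_recurrent Q \<longleftrightarrow> recurrent_process Q \<and> (\<exists>\<mu>. invariant_prob Q \<mu>)"

definition petite ::
  "('a::topological_space \<Rightarrow> (real \<Rightarrow> 'a) measure) \<Rightarrow> 'a set \<Rightarrow> bool" where
  "petite Q C \<longleftrightarrow> (\<exists>(p :: real measure) m.
     prob_space p \<and> sets p = sets borel \<and> (AE t in p. 0 \<le> t) \<and>
     sets m = sets borel \<and> emeasure m UNIV \<noteq> 0 \<and>
     (\<forall>x\<in>C. \<forall>S\<in>sets borel. emeasure m S \<le> (\<integral>\<^sup>+t. emeasure (transition Q t x) S \<partial>p)))"

text \<open>\<open>g\<close> belongs to the domain of the extended generator, with image \<open>h\<close>.\<close>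

definition extended_generator ::
  "('a::topological_space \<Rightarrow> (real \<Rightarrow> 'a) measure) \<Rightarrow> ('a \<Rightarrow> real) \<Rightarrow> ('a \<Rightarrow> real) \<Rightarrow> bool" where
  "extended_generator Q g h \<longleftrightarrow> g \<in> borel_measurable borel \<and> h \<in> borel_measurable borel \<and>
     (\<forall>x. (AE \<omega> in Q x. \<forall>t\<ge>0. set_integrable lborel {0..t} (\<lambda>s. h (\<omega> s))) \<and>
          local_martingale (Q x) path_filtration (dynkin g h))"

section \<open>The diffusion\<close>

text \<open>That the process has generator \<open>diff_op A B\<close> is expressed by the martingale problem
  for smooth compactly supported test functions.\<close>

locale ergodic_diffusion =
  fixes A :: "real^'d \<Rightarrow> real^'d^'d"
    and B :: "real^'d \<Rightarrow> real^'d"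
    and Q :: "real^'d \<Rightarrow> (real \<Rightarrow> real^'d) measure"
    and \<mu> :: "(real^'d) measure"
  assumes A_smooth: "smooth (\<lambda>x. A x $ i $ j)"
    and A_symmetric: "transpose (A x) = A x"
    and A_psd: "v \<bullet> (A x *v v) \<ge> 0"
    and B_smooth: "smooth (\<lambda>x. B x $ i)"
    and Q_kernel: "Q \<in> borel \<rightarrow>\<^sub>M prob_algebra path_space"
    and Q_start: "AE \<omega> in Q x. \<omega> 0 = x"
    and Q_strong_markov: "strong_markov Q"
    and Q_generator: "smooth g \<Longrightarrow> compact (closure {x. g x \<noteq> 0}) \<Longrightarrow>
          martingale (Q x) path_filtration (dynkin g (diff_op A B g))"
    and Q_irreducible: "irreducible_process Q"
    and Q_positive_recurrent: "positive_recurrent Q"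
    and \<mu>_invariant: "invariant_prob Q \<mu>"
    and \<mu>_unique: "invariant_prob Q \<eta> \<Longrightarrow> \<eta> = \<mu>"

section \<open>The two alternative assumptions\<close>

definition lyapunov_assumption ::
  "(real^'d \<Rightarrow> (real \<Rightarrow> real^'d) measure) \<Rightarrow> (real^'d) measure \<Rightarrow> (real^'d) measure \<Rightarrow> bool" where
  "lyapunov_assumption Q \<mu> \<nu> \<longleftrightarrow> (\<exists>\<phi> V LV \<kappa> C.
     smooth_from_1 \<phi> \<and> mono_on {1..} \<phi> \<and> concave_on {1..} \<phi> \<and> (\<forall>u\<ge>1. \<phi> u > 0) \<and>
     ((deriv \<phi> \<longlongrightarrow> 0) at_top \<or> (\<exists>a. \<forall>u\<ge>1. \<phi> u = a * u)) \<and>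
     extended_generator Q V LV \<and> (\<forall>x. V x \<ge> 1) \<and>
     compact C \<and> petite Q C \<and>
     (\<forall>x. LV x \<le> - \<phi> (V x) + \<kappa> * indicator C x) \<and>
     integrable \<mu> V \<and> integrable \<nu> V)"

definition reversible ::
  "('a::topological_space \<Rightarrow> (real \<Rightarrow> 'a) measure) \<Rightarrow> 'a measure \<Rightarrow> bool" where
  "reversible Q \<mu> \<longleftrightarrow> (\<forall>t\<ge>0. \<forall>g\<in>borel_measurable borel. \<forall>h\<in>borel_measurable borel.
     bounded (range g) \<longrightarrow> bounded (range h) \<longrightarrow>
     (LINT x|\<mu>. g x * semigroup_op Q t h x) = (LINT x|\<mu>. h x * semigroup_op Q t g x))"

definition L2_norm :: "'a measure \<Rightarrow> ('a \<Rightarrow> real) \<Rightarrow> real" where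
  "L2_norm \<mu> g = sqrt (LINT x|\<mu>. (g x)^2)"

definition uniformly_ergodic ::
  "('a::topological_space \<Rightarrow> (real \<Rightarrow> 'a) measure) \<Rightarrow> 'a measure \<Rightarrow> bool" where
  "uniformly_ergodic Q \<mu> \<longleftrightarrow>
     ((\<lambda>t. SUP g\<in>{g\<in>borel_measurable borel.
               esssup \<mu> (\<lambda>x. ereal \<bar>g x\<bar>) = 1 \<and> (LINT x|\<mu>. g x) = 0}.
            ereal (L2_norm \<mu> (semigroup_op Q t g))) \<longlongrightarrow> 0) at_top"

definition reversible_assumption ::
  "(real^'d \<Rightarrow> real^'d^'d) \<Rightarrow> (real^'d \<Rightarrow> real^'d) \<Rightarrow>
   (real^'d \<Rightarrow> (real \<Rightarrow> real^'d) measure) \<Rightarrow> (real^'d) measure \<Rightarrow> (real^'d) measure \<Rightarrow> bool" where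
  "reversible_assumption A B Q \<mu> \<nu> \<longleftrightarrow>
     (\<exists>a>0. \<forall>x v. v \<bullet> (A x *v v) \<ge> a * (norm v)^2) \<and> bounded (range A) \<and>
     reversible Q \<mu> \<and> uniformly_ergodic Q \<mu> \<and>
     (\<exists>W c. C_k 2 W \<and> \<mu> = density lborel (\<lambda>x. ennreal (exp (- W x))) \<and>
        (\<forall>x. 2 * carre_du_champ A B W x - diff_op A B W x \<ge> - c) \<and>
        integrable \<nu> (\<lambda>x. exp (W x)))"

section \<open>Functional central limit theorem\<close>

definition standard_brownian_motion :: "'b measure \<Rightarrow> (real \<Rightarrow> 'b \<Rightarrow> real) \<Rightarrow> bool" where
  "standard_brownian_motion N BM \<longleftrightarrow>
     prob_space N \<and> (\<forall>t\<ge>0. BM t \<in> borel_measurable N) \<and>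
     (AE \<omega> in N. BM 0 \<omega> = 0) \<and>
     (AE \<omega> in N. continuous_on {0..} (\<lambda>t. BM t \<omega>)) \<and>
     (\<forall>s t. 0 \<le> s \<and> s < t \<longrightarrow>
        distributed N lborel (\<lambda>\<omega>. BM t \<omega> - BM s \<omega>) (normal_density 0 (sqrt (t - s)))) \<and>
     (\<forall>n. \<forall>t :: nat \<Rightarrow> real. mono t \<and> 0 \<le> t 0 \<longrightarrow>
        prob_space.indep_vars N (\<lambda>_. borel) (\<lambda>i \<omega>. BM (t (Suc i)) \<omega> - BM (t i) \<omega>) {..<n})"

definition additive_functional :: "('a \<Rightarrow> real) \<Rightarrow> real \<Rightarrow> (real \<Rightarrow> 'a) \<Rightarrow> real" where
  "additive_functional f t \<omega> = (LINT r:{0..t}|lborel. f (\<omega> r))"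

text \<open>The vector \<open>(v\<^sub>0, \<dots>, v\<^sub>n\<^sub>-\<^sub>1)\<close> as a point of \<^const>\<open>Euclidean_space\<close> \<open>n\<close>, whose
  points are padded with zeros.\<close>

definition tuple :: "nat \<Rightarrow> (nat \<Rightarrow> real) \<Rightarrow> nat \<Rightarrow> real" where
  "tuple n v = (\<lambda>i. if i < n then v i else 0)"

definition converges_in_law ::
  "nat \<Rightarrow> 'w measure \<Rightarrow> ('e \<Rightarrow> 'w \<Rightarrow> nat \<Rightarrow> real) \<Rightarrow> 'e filter \<Rightarrow>
   'b measure \<Rightarrow> ('b \<Rightarrow> nat \<Rightarrow> real) \<Rightarrow> bool" where
  "converges_in_law n M Y F N Z \<longleftrightarrow>
     (\<forall>h. continuous_map (Euclidean_space n) euclideanreal h \<and>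
          bounded (h ` topspace (Euclidean_space n)) \<longrightarrow>
        ((\<lambda>e. LINT \<omega>|M. h (tuple n (Y e \<omega>))) \<longlongrightarrow> (LINT \<omega>|N. h (tuple n (Z \<omega>)))) F)"

definition FCLT ::
  "(real \<Rightarrow> 'a) measure \<Rightarrow> ('a \<Rightarrow> real) \<Rightarrow> (real \<Rightarrow> real) \<Rightarrow>
   'b measure \<Rightarrow> (real \<Rightarrow> 'b \<Rightarrow> real) \<Rightarrow> bool" where
  "FCLT P f s N BM \<longleftrightarrow>
     (\<forall>n. \<forall>t :: nat \<Rightarrow> real. (\<forall>i<n. 0 < t i) \<and> (\<forall>i j. i \<le> j \<and> j < n \<longrightarrow> t i \<le> t j) \<longrightarrow>
        converges_in_law n P
          (\<lambda>\<epsilon> \<omega> i. additive_functional f (t i / \<epsilon>) \<omega> / s (1 / \<epsilon>)) (at_right 0)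
          N (\<lambda>\<omega> i. BM (t i) \<omega>))"

end

theory Submission
  imports Defs
begin

text \<open>
  In the limit theorem of an ergodic process the limit law does not remember the initial law.
  Fix a bounded test function \<open>g\<close> and let \<open>u\<^sub>T(x)\<close> be the expectation under \<open>P\<^sub>x\<close> of
  \<open>g (S(t\<^sub>1 T) / s(T), \<dots>, S(t\<^sub>n T) / s(T))\<close>, where \<open>S(t)\<close> is the integral of \<open>f\<close> along the path up
  to time \<open>t\<close>.  Deleting the first stretch of length \<open>r\<close> of the path changes \<open>S(t)\<close> by the
  difference of two integrals of \<open>f\<close> over windows of length \<open>r\<close>, one at time \<open>t\<close> and one at
  time \<open>0\<close>.  If such windows are negligible compared with \<open>s(T)\<close>, then \<open>P\<^sub>r u\<^sub>T - u\<^sub>T\<close> tends to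
  \<open>0\<close> in \<open>L\<^sup>1(\<mu>)\<close> for every \<open>r\<close>.  The integral of \<open>u\<^sub>T\<close> against a density is therefore
  asymptotically unchanged when dual operators \<open>P\<^sub>r\<^sup>*\<close> are applied to the density and midpoints
  are taken (\<open>asymptotically_invariant_hull\<close>).  Among the densities obtained from one density in
  this way, those of almost minimal \<open>L\<^sup>2(\<mu>)\<close> norm converge to an invariant density, which
  is constant because the invariant probability measure is unique (\<open>ex_hull_approximates_mean\<close>;
  this is von Neumann's mean ergodic theorem in the form of F. Riesz).  Hence the integrals of
  \<open>u\<^sub>T\<close> against \<open>\<mu>\<close> and against any probability measure \<open>\<eta>\<close> absolutely continuous
  with respect to \<open>\<mu>\<close> become equal in the limit
  (\<open>asymptotically_invariant_mixing\<close>).  This is applied to the law \<open>\<eta>\<close> at a time \<open>t\<^sub>0\<close> of the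
  process started from \<open>\<nu>\<close>; the stretch before \<open>t\<^sub>0\<close> is again removed at the price of two windows.

  That windows are negligible is extracted from the limit theorem under \<open>\<mu>\<close> itself.  By
  stationarity, a window \<open>S(u)\<close> is the difference of \<open>S(v T + u)\<close> and a copy in law of \<open>S(v T)\<close>.
  After division by \<open>s(T)\<close> both terms are close in law to a Brownian motion at the small time \<open>v\<close>,
  hence small; since convergence is known only for each fixed \<open>v\<close>, one averages over \<open>v\<close>
  (\<open>scaled_subadditive_tendsto_0\<close>).  Under \<open>\<nu>\<close> one moreover needs \<open>s(T) \<longlonglongrightarrow> \<infinity>\<close>: if \<open>s\<close> stayed
  bounded along a sequence, \<open>S(u) / s(T)\<close> could only be negligible for \<open>S(u) = 0\<close> almost surely,
  for every \<open>u\<close>, against the nondegeneracy of Brownian motion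
  (\<open>normalization_tendsto_infinity\<close>).

  All this requires uniformly continuous test functions, and a cutoff argument shows that these
  determine convergence in law (\<open>converges_in_lawI\<close>).
\<close>

section \<open>Mean ergodic theorem for a family of Markov kernels\<close>

definition kernel_op :: "('a \<Rightarrow> 'b measure) \<Rightarrow> ('b \<Rightarrow> real) \<Rightarrow> 'a \<Rightarrow> real" where
  "kernel_op k \<phi> x = (LINT y|k x. \<phi> y)"

text \<open>Densities are kept in the interval \<open>[0,1]\<close> of functions: this set is stable under dual kernels and
midpoints, makes all products integrable, and spans the bounded densities.\<close>

definition unit_fun :: "'a measure \<Rightarrow> ('a \<Rightarrow> real) \<Rightarrow> bool" where
  "unit_fun M a \<longleftrightarrow> a \<in> borel_measurable M \<and> (\<forall>x\<in>space M. 0 \<le> a x \<and> a x \<le> 1)"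

text \<open>\<open>a'\<close> is a version of \<open>k\<^sup>* a\<close>, where \<open>k\<^sup>*\<close> is the adjoint of the kernel operator in \<open>L\<^sup>2(M)\<close>.  As a
relation it avoids choosing a version.\<close>

definition dual_density :: "'a measure \<Rightarrow> ('a \<Rightarrow> 'a measure) \<Rightarrow> ('a \<Rightarrow> real) \<Rightarrow> ('a \<Rightarrow> real) \<Rightarrow> bool" where
  "dual_density M k a a' \<longleftrightarrow> unit_fun M a' \<and>
     (\<forall>\<phi>\<in>borel_measurable M. bounded (\<phi> ` space M) \<longrightarrow>
        (LINT x|M. \<phi> x * a' x) = (LINT x|M. kernel_op k \<phi> x * a x))"

lemma bounded_imageI:
  fixes v :: "'a \<Rightarrow> real"
  assumes "\<And>x. x \<in> S \<Longrightarrow> \<bar>v x\<bar> \<le> c"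
  shows "bounded (v ` S)"
  using assms unfolding bounded_iff by auto

lemma bounded_mult_image:
  fixes u v :: "'a \<Rightarrow> real"
  assumes "bounded (u ` S)" "bounded (v ` S)"
  shows "bounded ((\<lambda>x. u x * v x) ` S)"
proof -
  obtain b c where "\<And>x. x\<in>S \<Longrightarrow> \<bar>u x\<bar> \<le> b" "\<And>x. x\<in>S \<Longrightarrow> \<bar>v x\<bar> \<le> c"
    using assms unfolding bounded_iff by auto
  then have "\<And>x. x\<in>S \<Longrightarrow> \<bar>u x * v x\<bar> \<le> b * c"
    unfolding abs_mult by (meson abs_ge_zero mult_mono order_trans)
  then show ?thesis unfolding bounded_iff by auto
qed

text \<open>Midpoints suffice for the parallelogram identity, so general convex combinations are not generated.\<close>

inductive_set dual_hull :: "'a measure \<Rightarrow> ('a \<Rightarrow> 'a measure) set \<Rightarrow> ('a \<Rightarrow> real) \<Rightarrow> ('a \<Rightarrow> real) set"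
  for M K g where
  base: "g \<in> dual_hull M K g"
| midpoint: "a \<in> dual_hull M K g \<Longrightarrow> b \<in> dual_hull M K g \<Longrightarrow> (\<lambda>x. (a x + b x) / 2) \<in> dual_hull M K g"
| dual: "a \<in> dual_hull M K g \<Longrightarrow> k \<in> K \<Longrightarrow> dual_density M k a a' \<Longrightarrow> a' \<in> dual_hull M K g"

text \<open>Uniqueness among the invariant probability measures that are absolutely continuous with respect to
\<open>M\<close> is ergodicity of \<open>M\<close>.\<close>

locale ergodic_kernels = prob_space M for M :: "'a measure" +
  fixes K :: "('a \<Rightarrow> 'a measure) set"
  assumes kernel: "k \<in> K \<Longrightarrow> k \<in> M \<rightarrow>\<^sub>M prob_algebra M"
    and invariant: "k \<in> K \<Longrightarrow> M \<bind> k = M"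
    and unique: "prob_space \<eta> \<Longrightarrow> sets \<eta> = sets M \<Longrightarrow> absolutely_continuous M \<eta> \<Longrightarrow>
          (\<And>k. k \<in> K \<Longrightarrow> \<eta> \<bind> k = \<eta>) \<Longrightarrow> \<eta> = M"
begin

lemma kernel_prob: "k \<in> K \<Longrightarrow> x \<in> space M \<Longrightarrow> prob_space (k x) \<and> sets (k x) = sets M"
  using measurable_space[OF kernel] by (auto simp: space_prob_algebra)

lemma integrable_bounded:
  fixes \<phi> :: "'a \<Rightarrow> real"
  assumes "\<phi> \<in> borel_measurable M" "bounded (\<phi> ` space M)"
  shows "integrable M \<phi>"
proof -
  obtain b where "\<And>x. x \<in> space M \<Longrightarrow> \<bar>\<phi> x\<bar> \<le> b"
    using assms(2) unfolding bounded_iff by auto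
  then show ?thesis
    by (intro integrable_const_bound[of _ b]) (auto simp: assms)
qed

lemma kernel_op_bounds:
  assumes k: "k \<in> K" and m: "\<phi> \<in> borel_measurable M" and b: "\<And>x. x \<in> space M \<Longrightarrow> \<bar>\<phi> x\<bar> \<le> b" and x: "x \<in> space M"
  shows "integrable (k x) \<phi>" "\<bar>kernel_op k \<phi> x\<bar> \<le> b" "(kernel_op k \<phi> x)\<^sup>2 \<le> kernel_op k (\<lambda>y. (\<phi> y)\<^sup>2) x"
proof -
  interpret k: prob_space "k x" using kernel_prob[OF k x] by simp
  have sk: "sets (k x) = sets M" "space (k x) = space M"
    using kernel_prob[OF k x] sets_eq_imp_space_eq by auto
  have m': "\<phi> \<in> borel_measurable (k x)" using m sk by (simp cong: measurable_cong_sets)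
  show i: "integrable (k x) \<phi>"
    by (rule k.integrable_const_bound[of _ b]) (use b sk m' in auto)
  have "\<bar>kernel_op k \<phi> x\<bar> \<le> (\<integral>y. \<bar>\<phi> y\<bar> \<partial>k x)"
    unfolding kernel_op_def by (rule integral_abs_bound)
  also have "\<dots> \<le> (\<integral>y. b \<partial>k x)"
    by (intro integral_mono) (use i b sk in auto)
  finally show "\<bar>kernel_op k \<phi> x\<bar> \<le> b" by (simp add: k.prob_space)
  have i2: "integrable (k x) (\<lambda>y. (\<phi> y)\<^sup>2)"
  proof (rule k.integrable_const_bound[of _ "b\<^sup>2"])
    show "AE y in k x. norm ((\<phi> y)\<^sup>2) \<le> b\<^sup>2"
      using power_mono[OF b abs_ge_zero, of _ 2] sk by (intro AE_I2) simp
  qed (use m' in auto)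
  show "(kernel_op k \<phi> x)\<^sup>2 \<le> kernel_op k (\<lambda>y. (\<phi> y)\<^sup>2) x"
    using k.variance_eq[OF i i2] k.variance_positive[of \<phi>] unfolding kernel_op_def by linarith
qed

lemma kernel_op_measurable:
  assumes "k \<in> K" "\<phi> \<in> borel_measurable M"
  shows "kernel_op k \<phi> \<in> borel_measurable M"
  unfolding kernel_op_def
  by (rule measurable_compose[OF measurable_prob_algebraD[OF kernel[OF assms(1)]]
        integral_measurable_subprob_algebra[OF assms(2)]])

lemma kernel_op_bounded:
  assumes k: "k \<in> K" and m: "\<phi> \<in> borel_measurable M" and b: "bounded (\<phi> ` space M)"
  shows "bounded (kernel_op k \<phi> ` space M)"
proof -
  obtain c where c: "\<And>x. x \<in> space M \<Longrightarrow> \<bar>\<phi> x\<bar> \<le> c"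
    using b unfolding bounded_iff by auto
  show ?thesis
    unfolding bounded_iff by (auto intro!: exI[of _ c] kernel_op_bounds[OF k m c])
qed

lemma integral_bind_kernel:
  assumes k: "k \<in> K" and m: "\<phi> \<in> borel_measurable M" and b: "bounded (\<phi> ` space M)"
    and \<eta>: "finite_measure \<eta>" "sets \<eta> = sets M"
  shows "(LINT x|(\<eta> \<bind> k). \<phi> x) = (LINT x|\<eta>. kernel_op k \<phi> x)"
proof -
  obtain c where c: "\<And>x. x \<in> space M \<Longrightarrow> \<bar>\<phi> x\<bar> \<le> c"
    using b unfolding bounded_iff by auto
  show ?thesis unfolding kernel_op_def
  proof (rule integral_bind[where K=M and B=c and B'=1])
    show "k \<in> \<eta> \<rightarrow>\<^sub>M subprob_algebra M"
      using measurable_prob_algebraD[OF kernel[OF k]] \<eta>(2) by (simp cong: measurable_cong_sets)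
    show "AE x in \<eta>. emeasure (k x) (space (k x)) \<le> ennreal 1"
      using kernel_prob[OF k] sets_eq_imp_space_eq[OF \<eta>(2)]
      by (auto intro!: AE_I2 simp: prob_space.emeasure_space_1)
  qed (use c m \<eta> in auto)
qed

lemma integral_kernel_op:
  assumes "k \<in> K" "\<phi> \<in> borel_measurable M" "bounded (\<phi> ` space M)"
  shows "(LINT x|M. kernel_op k \<phi> x) = (LINT x|M. \<phi> x)"
  using integral_bind_kernel[OF assms finite_measure_axioms refl] invariant[OF assms(1)] by simp

lemma unit_fun_bounded: "unit_fun M a \<Longrightarrow> bounded (a ` space M)"
  unfolding unit_fun_def bounded_iff by (auto intro!: exI[of _ 1])

lemma unit_fun_integrable: "unit_fun M a \<Longrightarrow> integrable M a"
  by (rule integrable_bounded) (auto simp: unit_fun_bounded, auto simp: unit_fun_def)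

text \<open>The measure obtained by applying \<open>k\<close> to the measure with density \<open>a\<close> is dominated by \<open>M\<close>, because
\<open>a \<le> 1\<close> and \<open>M\<close> is invariant; its Radon-Nikodym density is the dual density.\<close>

lemma ex_dual_density:
  assumes k: "k \<in> K" and a: "unit_fun M a"
  shows "\<exists>a'. dual_density M k a a'"
proof -
  have [measurable]: "a \<in> borel_measurable M" and a01: "\<And>x. x \<in> space M \<Longrightarrow> 0 \<le> a x" "\<And>x. x \<in> space M \<Longrightarrow> a x \<le> 1"
    using a by (auto simp: unit_fun_def)
  note [measurable] = measurable_prob_algebraD[OF kernel[OF k]]
  define \<eta> where "\<eta> = density M (\<lambda>x. ennreal (a x))"
  have s\<eta>: "sets \<eta> = sets M" "space \<eta> = space M" by (auto simp: \<eta>_def)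
  have k': "k \<in> \<eta> \<rightarrow>\<^sub>M subprob_algebra M"
    by (simp add: \<eta>_def)
  have "emeasure \<eta> (space \<eta>) \<le> emeasure M (space M)"
  proof -
    have "emeasure \<eta> (space \<eta>) = (\<integral>\<^sup>+x. ennreal (a x) \<partial>M)"
      by (simp add: s\<eta>(2)) (simp add: \<eta>_def emeasure_density cong: nn_integral_cong)
    also have "\<dots> \<le> (\<integral>\<^sup>+x. 1 \<partial>M)"
      by (intro nn_integral_mono) (simp add: a01 ennreal_le_1)
    finally show ?thesis by simp
  qed
  then have fin: "finite_measure \<eta>"
    by (intro finite_measureI) (auto simp: emeasure_space_1 top_unique)
  define \<xi> where "\<xi> = \<eta> \<bind> k"
  have s\<xi>: "sets \<xi> = sets M" unfolding \<xi>_def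
    by (rule sets_bind) (use kernel_prob[OF k] s\<eta> not_empty in auto)
  have e\<xi>: "emeasure \<xi> S = (\<integral>\<^sup>+x. ennreal (a x) * emeasure (k x) S \<partial>M)" if [measurable]: "S \<in> sets M" for S
    unfolding \<xi>_def by (subst emeasure_bind[OF _ k']) (auto simp: s\<eta> not_empty \<eta>_def nn_integral_density)
  have le\<xi>: "emeasure \<xi> S \<le> emeasure M S" if S[measurable]: "S \<in> sets M" for S
  proof -
    have "emeasure \<xi> S \<le> (\<integral>\<^sup>+x. emeasure (k x) S \<partial>M)"
      unfolding e\<xi>[OF S] using a01 mult_right_mono[of "ennreal (a _)" 1] by (intro nn_integral_mono) (simp add: ennreal_le_1)
    also have "\<dots> = emeasure (M \<bind> k) S"
      by (rule emeasure_bind[where N=M, symmetric]) (auto simp: not_empty)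
    finally show ?thesis using invariant[OF k] by simp
  qed
  have ac: "absolutely_continuous M \<xi>"
    unfolding absolutely_continuous_def
  proof
    fix S assume "S \<in> null_sets M"
    then have "S \<in> sets M" "emeasure M S = 0" by auto
    with le\<xi>[of S] s\<xi> show "S \<in> null_sets \<xi>" by (intro null_setsI) auto
  qed
  have "emeasure \<xi> (space \<xi>) \<le> emeasure M (space M)"
    using le\<xi>[of "space M"] sets_eq_imp_space_eq[OF s\<xi>] by simp
  then have fin\<xi>: "finite_measure \<xi>"
    by (intro finite_measureI) (auto simp: emeasure_space_1 top_unique)
  obtain D where [measurable]: "D \<in> borel_measurable M"
    and RD: "AE x in M. RN_deriv M \<xi> x = ennreal (D x)" and D0: "\<And>x. 0 \<le> D x"
    by (rule real_RN_deriv[OF fin\<xi> ac s\<xi>]) auto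
  have \<xi>D: "\<xi> = density M (\<lambda>x. ennreal (D x))"
    using density_RN_deriv[OF ac s\<xi>] density_cong[OF _ _ RD] by simp
  interpret \<xi>: finite_measure \<xi> by fact
  have intD: "integrable M D"
  proof (rule integrableI_nonneg)
    have "(\<integral>\<^sup>+x. ennreal (D x) \<partial>M) = emeasure \<xi> (space M)"
      by (simp add: \<xi>D emeasure_density cong: nn_integral_cong)
    then show "(\<integral>\<^sup>+x. ennreal (D x) \<partial>M) < \<infinity>"
      using \<xi>.emeasure_finite[of "space M"] by (simp add: less_top[symmetric])
  qed (use D0 in auto)
  have D1: "AE x in M. D x \<le> 1"
  proof -
    define S where "S = {x\<in>space M. D x > 1}"
    have S[measurable]: "S \<in> sets M" by (simp add: S_def)
    have *: "(LINT x|M. D x * indicator S x) \<le> (LINT x|M. indicator S x)"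
    proof -
      have "ennreal (LINT x|M. D x * indicator S x) = (\<integral>\<^sup>+x. ennreal (D x) * indicator S x \<partial>M)"
        using D0 by (subst nn_integral_eq_integral[symmetric])
          (auto intro!: nn_integral_cong integrable_real_mult_indicator intD simp: ennreal_mult split: split_indicator)
      also have "\<dots> = emeasure \<xi> S" by (simp add: \<xi>D emeasure_density)
      also have "\<dots> \<le> emeasure M S" by (rule le\<xi>[OF S])
      also have "\<dots> = ennreal (LINT x|M. indicator S x)" by (simp add: emeasure_eq_measure)
      finally show ?thesis by (subst (asm) ennreal_le_iff) auto
    qed
    have i: "integrable M (\<lambda>x. D x * indicator S x)" "integrable M (indicator S :: 'a \<Rightarrow> real)"
      using intD by (auto intro!: integrable_real_mult_indicator simp: emeasure_eq_measure)
    have "(LINT x|M. D x * indicator S x - indicator S x) = 0"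
    proof (rule antisym)
      show "(LINT x|M. D x * indicator S x - indicator S x) \<le> 0" using * i by simp
      show "0 \<le> (LINT x|M. D x * indicator S x - indicator S x)"
        by (rule integral_nonneg_AE) (auto simp: S_def split: split_indicator)
    qed
    then have "AE x in M. D x * indicator S x - indicator S x = 0"
      using i by (subst (asm) integral_nonneg_eq_0_iff_AE) (auto simp: S_def split: split_indicator)
    then show ?thesis
      using AE_space by eventually_elim (auto simp: S_def split: split_indicator_asm)
  qed
  define a' where "a' x = min (D x) 1" for x
  have [measurable]: "a' \<in> borel_measurable M" by (simp add: a'_def[abs_def])
  have "dual_density M k a a'" unfolding dual_density_def
  proof (intro conjI ballI impI)
    show "unit_fun M a'" using D0 by (auto simp: unit_fun_def a'_def)
    fix \<phi> :: "'a \<Rightarrow> real" assume m[measurable]: "\<phi> \<in> borel_measurable M" and b: "bounded (\<phi> ` space M)"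
    note [measurable] = kernel_op_measurable[OF k m]
    have "(LINT x|M. \<phi> x * a' x) = (LINT x|M. D x * \<phi> x)"
      by (rule integral_cong_AE, measurable) (use D1 in eventually_elim, auto simp: a'_def)
    also have "\<dots> = (LINT x|\<xi>. \<phi> x)"
      unfolding \<xi>D using D0 by (subst integral_density) auto
    also have "\<dots> = (LINT x|\<eta>. kernel_op k \<phi> x)"
      unfolding \<xi>_def by (rule integral_bind_kernel[OF k m b fin s\<eta>(1)])
    also have "\<dots> = (LINT x|M. a x * kernel_op k \<phi> x)"
      unfolding \<eta>_def using a01 by (subst integral_density) auto
    finally show "(LINT x|M. \<phi> x * a' x) = (LINT x|M. kernel_op k \<phi> x * a x)"
      by (simp add: mult.commute)
  qed
  then show ?thesis by blast
qed

lemma dual_hull_unit_fun: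
  assumes "a \<in> dual_hull M K g" "unit_fun M g"
  shows "unit_fun M a"
  using assms
proof induction
  case (midpoint a b)
  then have "unit_fun M a" "unit_fun M b" by auto
  then show ?case by (force simp: unit_fun_def)
qed (auto simp: dual_density_def)

lemma dual_hull_integral:
  assumes "a \<in> dual_hull M K g" "unit_fun M g"
  shows "(LINT x|M. a x) = (LINT x|M. g x)"
  using assms
proof induction
  case (midpoint a b)
  then show ?case
    using unit_fun_integrable[OF dual_hull_unit_fun] by simp
next
  case (dual a k a')
  have "kernel_op k (\<lambda>_. 1) x = 1" if "x \<in> space M" for x
    unfolding kernel_op_def using kernel_prob[OF dual.hyps(2) that] by (simp add: prob_space.prob_space)
  then have "(LINT x|M. kernel_op k (\<lambda>_. 1) x * a x) = (LINT x|M. a x)"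
    by (intro Bochner_Integration.integral_cong) auto
  moreover have "bounded ((\<lambda>_. 1::real) ` space M)" by (rule bounded_imageI) auto
  ultimately show ?case
    using dual unfolding dual_density_def by (auto dest!: bspec[of _ _ "\<lambda>_. 1"])
qed auto

text \<open>With \<open>P\<close> the operator of \<open>k\<close>, expand \<open>0 \<le> \<parallel>P a' - a\<parallel>\<^sup>2\<close>: the cross term is \<open>\<parallel>a'\<parallel>\<^sup>2\<close> by duality,
and \<open>\<parallel>P a'\<parallel>\<^sup>2 \<le> \<parallel>a'\<parallel>\<^sup>2\<close> by Jensen's inequality and invariance.\<close>

lemma dual_density_contraction:
  assumes k: "k \<in> K" and a: "unit_fun M a" and d: "dual_density M k a a'"
  shows "(LINT x|M. (a' x)\<^sup>2) \<le> (LINT x|M. (a x)\<^sup>2)"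
proof -
  have a': "unit_fun M a'" using d by (simp add: dual_density_def)
  have [measurable]: "a \<in> borel_measurable M" "a' \<in> borel_measurable M"
    using a a' by (auto simp: unit_fun_def)
  note m = kernel_op_measurable[OF k]
  note [measurable] = m[of a']
  note bb = unit_fun_bounded[OF a] unit_fun_bounded[OF a'] kernel_op_bounded[OF k _ unit_fun_bounded[OF a']]
  have ba'2: "bounded ((\<lambda>x. (a' x)\<^sup>2) ` space M)"
    unfolding power2_eq_square by (intro bounded_mult_image bb)
  have i: "integrable M (\<lambda>x. (a x)\<^sup>2)" "integrable M (\<lambda>x. (kernel_op k a' x)\<^sup>2)"
     "integrable M (\<lambda>x. kernel_op k a' x * a x)" "integrable M (\<lambda>x. (a' x)\<^sup>2)"
     "integrable M (kernel_op k (\<lambda>x. (a' x)\<^sup>2))"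
    using bb ba'2
    by (auto intro!: integrable_bounded bounded_mult_image kernel_op_bounded[OF k] m simp: power2_eq_square)
  have "0 \<le> (LINT x|M. (kernel_op k a' x - a x)\<^sup>2)" by simp
  also have "\<dots> = (LINT x|M. (kernel_op k a' x)\<^sup>2 - 2 * (kernel_op k a' x * a x) + (a x)\<^sup>2)"
    by (simp add: power2_diff algebra_simps)
  also have "\<dots> = (LINT x|M. (kernel_op k a' x)\<^sup>2) - 2 * (LINT x|M. kernel_op k a' x * a x) + (LINT x|M. (a x)\<^sup>2)"
    using i by simp
  also have "(LINT x|M. kernel_op k a' x * a x) = (LINT x|M. (a' x)\<^sup>2)"
    using d bb(2) by (auto simp: dual_density_def power2_eq_square)
  also have "(LINT x|M. (kernel_op k a' x)\<^sup>2) \<le> (LINT x|M. kernel_op k (\<lambda>x. (a' x)\<^sup>2) x)"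
    using i by (intro integral_mono kernel_op_bounds(3)[OF k _ , where b=1])
      (use a' in \<open>auto simp: unit_fun_def\<close>)
  also have "\<dots> = (LINT x|M. (a' x)\<^sup>2)"
    by (rule integral_kernel_op[OF k _ ba'2]) simp
  finally show ?thesis by simp
qed

lemma L1_le_sqrt_L2:
  assumes [measurable]: "v \<in> borel_measurable M" and b: "bounded (v ` space M)"
  shows "(LINT x|M. \<bar>v x\<bar>) \<le> sqrt (LINT x|M. (v x)\<^sup>2)"
proof -
  have b2: "bounded ((\<lambda>x. (v x)\<^sup>2) ` space M)"
    unfolding power2_eq_square by (intro bounded_mult_image b)
  have i: "integrable M (\<lambda>x. \<bar>v x\<bar>)" "integrable M (\<lambda>x. (\<bar>v x\<bar>)\<^sup>2)"
    using integrable_bounded[OF _ b] integrable_bounded[OF _ b2] by auto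
  have "(LINT x|M. \<bar>v x\<bar>)\<^sup>2 \<le> (LINT x|M. \<bar>v x\<bar>\<^sup>2)"
    using variance_eq[OF i] variance_positive[of "\<lambda>x. \<bar>v x\<bar>"] by linarith
  then show ?thesis by (intro real_le_rsqrt) simp
qed

text \<open>Parallelogram identity: two functions of almost minimal norm whose midpoint does not go below
the minimum \<open>d\<close> are close to each other.\<close>

lemma L1_dist_le:
  assumes a: "unit_fun M a" and b: "unit_fun M b"
    and d: "d \<le> (LINT x|M. ((a x + b x) / 2)\<^sup>2)"
    and ad: "(LINT x|M. (a x)\<^sup>2) \<le> d + e" and bd: "(LINT x|M. (b x)\<^sup>2) \<le> d + e"
  shows "(LINT x|M. \<bar>a x - b x\<bar>) \<le> sqrt (4 * e)"
proof -
  have [measurable]: "a \<in> borel_measurable M" "b \<in> borel_measurable M"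
    using a b by (auto simp: unit_fun_def)
  note bb = unit_fun_bounded[OF a] unit_fun_bounded[OF b]
  have i: "integrable M (\<lambda>x. (a x)\<^sup>2)" "integrable M (\<lambda>x. (b x)\<^sup>2)" "integrable M (\<lambda>x. a x * b x)"
    using bb by (auto intro!: integrable_bounded bounded_mult_image simp: power2_eq_square)
  have "\<bar>(a x + b x) / 2\<bar> \<le> 1" if "x \<in> space M" for x
    using a b that by (force simp: unit_fun_def abs_le_iff)
  then have hb: "bounded ((\<lambda>x. (a x + b x) / 2) ` space M)"
    by (rule bounded_imageI)
  have i3: "integrable M (\<lambda>x. ((a x + b x) / 2)\<^sup>2)"
    unfolding power2_eq_square
    by (intro integrable_bounded bounded_mult_image hb) measurable
  have "(LINT x|M. (a x - b x)\<^sup>2) = (LINT x|M. 2 * (a x)\<^sup>2 + 2 * (b x)\<^sup>2 - 4 * ((a x + b x) / 2)\<^sup>2)"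
    by (rule Bochner_Integration.integral_cong) (auto simp: power2_eq_square algebra_simps)
  also have "\<dots> = 2 * (LINT x|M. (a x)\<^sup>2) + 2 * (LINT x|M. (b x)\<^sup>2) - 4 * (LINT x|M. ((a x + b x) / 2)\<^sup>2)"
    using i i3 by simp
  also have "\<dots> \<le> 4 * e" using ad bd d by simp
  finally have "sqrt (LINT x|M. (a x - b x)\<^sup>2) \<le> sqrt (4 * e)" by simp
  moreover have "\<bar>a x - b x\<bar> \<le> 1" if "x \<in> space M" for x
    using a b that by (force simp: unit_fun_def abs_le_iff)
  then have "bounded ((\<lambda>x. a x - b x) ` space M)"
    by (rule bounded_imageI)
  then have "(LINT x|M. \<bar>a x - b x\<bar>) \<le> sqrt (LINT x|M. (a x - b x)\<^sup>2)"
    by (intro L1_le_sqrt_L2) auto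
  ultimately show ?thesis by (rule order_trans[rotated])
qed

text \<open>Normalized to mass one, a nonzero invariant density defines an invariant probability measure, and
this is \<open>M\<close>.\<close>

lemma invariant_density_const:
  assumes w: "unit_fun M w"
    and inv: "\<And>k \<phi>. k \<in> K \<Longrightarrow> \<phi> \<in> borel_measurable M \<Longrightarrow> bounded (\<phi> ` space M) \<Longrightarrow>
        (LINT x|M. kernel_op k \<phi> x * w x) = (LINT x|M. \<phi> x * w x)"
  shows "AE x in M. w x = (LINT x|M. w x)"
proof (cases "(LINT x|M. w x) = 0")
  case True
  then show ?thesis
    using integral_nonneg_eq_0_iff_AE[OF unit_fun_integrable[OF w]] w by (auto simp: unit_fun_def)
next
  case False
  define m where "m = (LINT x|M. w x)"
  have [measurable]: "w \<in> borel_measurable M" and w0: "\<And>x. x \<in> space M \<Longrightarrow> 0 \<le> w x"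
    using w by (auto simp: unit_fun_def)
  have m: "m > 0"
    using False w0 Bochner_Integration.integral_nonneg[of M w] unfolding m_def by fastforce
  define \<eta> where "\<eta> = density M (\<lambda>x. ennreal (w x / m))"
  have s\<eta>: "sets \<eta> = sets M" "space \<eta> = space M" by (auto simp: \<eta>_def)
  have "emeasure \<eta> (space \<eta>) = (\<integral>\<^sup>+x. ennreal (w x / m) \<partial>M)"
    by (simp add: s\<eta>(2)) (simp add: \<eta>_def emeasure_density cong: nn_integral_cong)
  also have "\<dots> = ennreal (LINT x|M. w x / m)"
    using unit_fun_integrable[OF w] w0 m by (intro nn_integral_eq_integral) auto
  also have "\<dots> = 1" using m by (simp add: m_def[symmetric])
  finally have \<eta>: "prob_space \<eta>" by (rule prob_spaceI)
  then interpret \<eta>: prob_space \<eta> .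
  have \<eta>_int: "(LINT x|\<eta>. \<phi> x) = (LINT x|M. \<phi> x * w x) / m" if "\<phi> \<in> borel_measurable M" for \<phi> :: "'a \<Rightarrow> real"
    unfolding \<eta>_def using w0 m that by (subst integral_density) (auto simp: mult.commute)
  have "\<eta> = M"
  proof (rule unique[OF \<eta> s\<eta>(1)])
    show "absolutely_continuous M \<eta>"
      unfolding \<eta>_def by (intro absolutely_continuousI_density) simp
    fix k assume k: "k \<in> K"
    have k': "k \<in> \<eta> \<rightarrow>\<^sub>M prob_algebra M"
      using kernel[OF k] s\<eta> by (simp cong: measurable_cong_sets)
    have \<eta>s: "\<eta> \<in> space (prob_algebra \<eta>)" using \<eta> by (simp add: space_prob_algebra)
    have pk: "prob_space (\<eta> \<bind> k)" by (rule prob_space_bind'[OF \<eta>s k'])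
    then interpret \<eta>k: prob_space "\<eta> \<bind> k" .
    have sk: "sets (\<eta> \<bind> k) = sets M" by (rule sets_bind'[OF \<eta>s k'])
    show "\<eta> \<bind> k = \<eta>"
    proof (rule measure_eqI)
      fix S assume "S \<in> sets (\<eta> \<bind> k)"
      then have S[measurable]: "S \<in> sets M" using sk by simp
      have b: "bounded ((indicator S :: 'a \<Rightarrow> real) ` space M)"
        by (rule bounded_imageI[of _ _ 1]) (auto split: split_indicator)
      have "measure (\<eta> \<bind> k) S = (LINT x|(\<eta> \<bind> k). indicator S x)"
        using S sk by simp
      also have "\<dots> = (LINT x|\<eta>. kernel_op k (indicator S) x)"
        by (rule integral_bind_kernel[OF k _ b \<eta>.finite_measure_axioms s\<eta>(1)]) simp
      also have "\<dots> = (LINT x|\<eta>. indicator S x)"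
        using inv[OF k _ b] kernel_op_measurable[OF k, of "indicator S"]
        by (subst (1 2) \<eta>_int) auto
      also have "\<dots> = measure \<eta> S" using S s\<eta> by simp
      finally show "emeasure (\<eta> \<bind> k) S = emeasure \<eta> S"
        by (simp add: \<eta>k.emeasure_eq_measure \<eta>.emeasure_eq_measure)
    qed (simp add: sk s\<eta>)
  qed
  then have "density M (\<lambda>x. ennreal (w x / m)) = density M (\<lambda>_. 1)"
    by (simp add: \<eta>_def density_1)
  then have "AE x in M. ennreal (w x / m) = 1"
    by (subst (asm) density_unique_iff) auto
  then show ?thesis
    unfolding m_def[symmetric] by eventually_elim (use m in \<open>simp add: field_simps\<close>)
qed

text \<open>A sequence of almost minimal \<open>L\<^sup>2\<close> norm in the hull is Cauchy.  Applying a dual kernel to it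
keeps it almost minimal, hence close to itself, so that its limit is invariant and thus constant.\<close>

lemma ex_hull_approximates_mean:
  assumes g: "unit_fun M g" and \<epsilon>: "\<epsilon> > 0"
  shows "\<exists>a\<in>dual_hull M K g. (LINT x|M. \<bar>a x - (LINT y|M. g y)\<bar>) < \<epsilon>"
proof -
  define N where "N a = (LINT x|M. (a x)\<^sup>2)" for a :: "'a \<Rightarrow> real"
  define d where "d = Inf (N ` dual_hull M K g)"
  have bdd: "bdd_below (N ` dual_hull M K g)"
    by (auto simp: N_def bdd_below_def intro!: exI[of _ 0])
  have d: "d \<le> N a" if "a \<in> dual_hull M K g" for a
    unfolding d_def using that by (intro cInf_lower bdd) auto
  note unit = dual_hull_unit_fun[OF _ g]
  have "\<exists>a\<in>dual_hull M K g. N a < d + 1 / (real n + 1)" for n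
    using cInf_lessD[of "N ` dual_hull M K g" "d + 1 / (real n + 1)"] dual_hull.base[of g M K]
    by (auto simp: d_def[symmetric])
  then obtain c where cH: "\<And>n. c n \<in> dual_hull M K g" and cN: "\<And>n. N (c n) < d + 1 / (real n + 1)"
    by metis
  have near: "(LINT x|M. \<bar>a x - b x\<bar>) \<le> sqrt (4 * (1 / (real n + 1)))"
    if "a \<in> dual_hull M K g" "b \<in> dual_hull M K g" "N a \<le> d + 1 / (real n + 1)" "N b \<le> d + 1 / (real n + 1)" for a b n
    using d[OF dual_hull.midpoint[OF that(1,2)]] that
    by (intro L1_dist_le[of a b d] unit) (auto simp: N_def)
  have rate: "(\<lambda>n. sqrt (4 * (1 / (real n + 1)))) \<longlonglongrightarrow> 0"
    using tendsto_real_sqrt[OF tendsto_mult_right_zero[OF LIMSEQ_Suc[OF lim_1_over_n]], of 4]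
    by (simp add: add.commute)
  obtain r where r: "strict_mono r" and cau: "AE x in M. Cauchy (\<lambda>i. c (r i) x)"
  proof (rule cauchy_L1_AE_cauchy_subseq[of M c])
    show "integrable M (c n)" for n by (rule unit_fun_integrable[OF unit[OF cH]])
    fix e :: real assume "e > 0"
    with rate obtain L where L: "sqrt (4 * (1 / (real L + 1))) < e"
      using order_tendstoD(2)[OF rate \<open>e > 0\<close>] by (auto simp: eventually_sequentially)
    have cL: "N (c i) \<le> d + 1 / (real L + 1)" if "i \<ge> L" for i
    proof -
      have "1 / (real i + 1) \<le> 1 / (real L + 1)" using that by (intro divide_left_mono) auto
      with cN[of i] show ?thesis by linarith
    qed
    show "\<exists>N. \<forall>i\<ge>N. \<forall>j\<ge>N. (LINT x|M. norm (c i x - c j x)) < e"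
    proof (intro exI allI impI)
      fix i j assume "L \<le> i" "L \<le> j"
      from near[OF cH cH cL[OF this(1)] cL[OF this(2)]] L
      show "(LINT x|M. norm (c i x - c j x)) < e" by simp
    qed
  qed
  define b where "b n = c (r n)" for n
  have bH: "b n \<in> dual_hull M K g" for n by (simp add: b_def cH)
  have bN: "N (b n) \<le> d + 1 / (real n + 1)" for n
  proof -
    have "1 / (real (r n) + 1) \<le> 1 / (real n + 1)"
      using seq_suble[OF r, of n] by (intro divide_left_mono) auto
    with cN[of "r n"] show ?thesis unfolding b_def by linarith
  qed
  have [measurable]: "b n \<in> borel_measurable M" for n using unit[OF bH] by (simp add: unit_fun_def)
  \<comment> \<open>Clipping makes the limit a unit function also where the sequence does not converge.\<close>
  define w where "w x = max 0 (min 1 (lim (\<lambda>n. b n x)))" for x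
  have w: "unit_fun M w" by (auto simp: unit_fun_def w_def[abs_def])
  then have [measurable]: "w \<in> borel_measurable M" by (simp add: unit_fun_def)
  have conv: "AE x in M. (\<lambda>n. b n x) \<longlonglongrightarrow> w x"
    using cau AE_space
  proof eventually_elim
    case (elim x)
    then have l: "(\<lambda>n. b n x) \<longlonglongrightarrow> lim (\<lambda>n. b n x)"
      by (simp add: b_def Cauchy_convergent_iff convergent_LIMSEQ_iff)
    moreover have "0 \<le> b n x" "b n x \<le> 1" for n using unit[OF bH[of n]] elim by (auto simp: unit_fun_def)
    ultimately have "0 \<le> lim (\<lambda>n. b n x)" "lim (\<lambda>n. b n x) \<le> 1"
      by (auto intro: LIMSEQ_le_const LIMSEQ_le_const2)
    with l show ?case by (simp add: w_def)
  qed
  have conv_int: "(\<lambda>n. LINT x|M. \<phi> x * b n x) \<longlonglongrightarrow> (LINT x|M. \<phi> x * w x)"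
    if m[measurable]: "\<phi> \<in> borel_measurable M" and bd: "bounded (\<phi> ` space M)" for \<phi>
  proof (rule integral_dominated_convergence[where w="\<lambda>x. \<bar>\<phi> x\<bar>"])
    show "integrable M (\<lambda>x. \<bar>\<phi> x\<bar>)" using integrable_bounded[OF m bd] by simp
    show "AE x in M. (\<lambda>n. \<phi> x * b n x) \<longlonglongrightarrow> \<phi> x * w x"
      using conv by eventually_elim (intro tendsto_intros)
    show "AE x in M. norm (\<phi> x * b n x) \<le> \<bar>\<phi> x\<bar>" for n
      using unit[OF bH[of n]] by (intro AE_I2) (auto simp: unit_fun_def abs_mult mult_left_le)
  qed auto
  have "AE x in M. w x = (LINT x|M. w x)"
  proof (rule invariant_density_const[OF w])
    fix k and \<phi> :: "'a \<Rightarrow> real"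
    assume k: "k \<in> K" and m[measurable]: "\<phi> \<in> borel_measurable M" and bd: "bounded (\<phi> ` space M)"
    obtain C where C: "\<And>x. x \<in> space M \<Longrightarrow> \<bar>\<phi> x\<bar> \<le> C" using bd by (auto simp: bounded_iff)
    have C0: "0 \<le> C" using C not_empty by force
    note m' = kernel_op_measurable[OF k m] and bd' = kernel_op_bounded[OF k m bd]
    obtain b' where b': "\<And>n. dual_density M k (b n) (b' n)"
      using ex_dual_density[OF k unit[OF bH]] by metis
    have b'H: "b' n \<in> dual_hull M K g" for n by (rule dual_hull.dual[OF bH k b'])
    have [measurable]: "b' n \<in> borel_measurable M" for n using unit[OF b'H] by (simp add: unit_fun_def)
    have "N (b' n) \<le> N (b n)" for n
      unfolding N_def by (rule dual_density_contraction[OF k unit[OF bH] b'])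
    then have close: "(LINT x|M. \<bar>b' n x - b n x\<bar>) \<le> sqrt (4 * (1 / (real n + 1)))" for n
      using bN[of n] by (intro near bH b'H) (auto intro: order_trans)
    have "(\<lambda>n. (LINT x|M. \<phi> x * b' n x) - (LINT x|M. \<phi> x * b n x)) \<longlonglongrightarrow> 0"
    proof (rule Lim_null_comparison[OF always_eventually])
      show "\<forall>n. norm ((LINT x|M. \<phi> x * b' n x) - (LINT x|M. \<phi> x * b n x)) \<le> C * sqrt (4 * (1 / (real n + 1)))"
      proof
        fix n
        note ib = unit_fun_bounded[OF unit[OF bH[of n]]] unit_fun_bounded[OF unit[OF b'H[of n]]]
        have i: "integrable M (\<lambda>x. \<phi> x * b' n x)" "integrable M (\<lambda>x. \<phi> x * b n x)"
          by (auto intro!: integrable_bounded bounded_mult_image bd ib)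
        have i': "integrable M (b n)" "integrable M (b' n)"
          by (auto intro!: unit_fun_integrable unit bH b'H)
        have "norm ((LINT x|M. \<phi> x * b' n x) - (LINT x|M. \<phi> x * b n x)) = \<bar>LINT x|M. \<phi> x * (b' n x - b n x)\<bar>"
          using i by (simp add: right_diff_distrib)
        also have "\<dots> \<le> (LINT x|M. \<bar>\<phi> x * (b' n x - b n x)\<bar>)" by (rule integral_abs_bound)
        also have "\<dots> \<le> (LINT x|M. C * \<bar>b' n x - b n x\<bar>)"
        proof (rule integral_mono)
          show "integrable M (\<lambda>x. \<bar>\<phi> x * (b' n x - b n x)\<bar>)"
            using i by (auto simp: right_diff_distrib)
          show "\<bar>\<phi> x * (b' n x - b n x)\<bar> \<le> C * \<bar>b' n x - b n x\<bar>" if "x \<in> space M" for x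
            using C[OF that] by (simp add: abs_mult mult_right_mono)
        qed (use i' in auto)
        also have "\<dots> \<le> C * sqrt (4 * (1 / (real n + 1)))"
          using close[of n] C0 by (simp add: mult_left_mono)
        finally show "norm ((LINT x|M. \<phi> x * b' n x) - (LINT x|M. \<phi> x * b n x)) \<le> C * sqrt (4 * (1 / (real n + 1)))" .
      qed
      show "(\<lambda>n. C * sqrt (4 * (1 / (real n + 1)))) \<longlonglongrightarrow> 0"
        using tendsto_mult[OF tendsto_const rate, of C] by simp
    qed
    moreover have "(LINT x|M. \<phi> x * b' n x) = (LINT x|M. kernel_op k \<phi> x * b n x)" for n
      using b'[of n] m bd by (auto simp: dual_density_def)
    then have "(\<lambda>n. (LINT x|M. \<phi> x * b' n x) - (LINT x|M. \<phi> x * b n x)) \<longlonglongrightarrow>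
        (LINT x|M. kernel_op k \<phi> x * w x) - (LINT x|M. \<phi> x * w x)"
      using tendsto_diff[OF conv_int[OF m' bd'] conv_int[OF m bd]] by simp
    ultimately show "(LINT x|M. kernel_op k \<phi> x * w x) = (LINT x|M. \<phi> x * w x)"
      using LIMSEQ_unique by fastforce
  qed
  moreover have "(LINT x|M. w x) = (LINT x|M. g x)"
  proof -
    have "bounded ((\<lambda>_. 1::real) ` space M)" by (rule bounded_imageI) auto
    from conv_int[OF _ this] show ?thesis
      using dual_hull_integral[OF bH g] by (auto simp: LIMSEQ_const_iff)
  qed
  ultimately have wm: "AE x in M. w x = (LINT x|M. g x)" by simp
  have "(\<lambda>n. LINT x|M. \<bar>b n x - (LINT y|M. g y)\<bar>) \<longlonglongrightarrow> (LINT x|M. 0)"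
  proof (rule integral_dominated_convergence[where w="\<lambda>x. 1 + \<bar>LINT y|M. g y\<bar>"])
    show "AE x in M. (\<lambda>n. \<bar>b n x - (LINT y|M. g y)\<bar>) \<longlonglongrightarrow> 0"
      using conv wm by eventually_elim (auto intro!: tendsto_eq_intros)
    show "AE x in M. norm \<bar>b n x - (LINT y|M. g y)\<bar> \<le> 1 + \<bar>LINT y|M. g y\<bar>" for n
      using unit[OF bH[of n]] by (intro AE_I2) (fastforce simp: unit_fun_def)
  qed auto
  then have "\<exists>n. (LINT x|M. \<bar>b n x - (LINT y|M. g y)\<bar>) < \<epsilon>"
    using order_tendstoD(2)[of _ "0::real" sequentially \<epsilon>] \<epsilon> eventually_happens'[OF sequentially_bot] by auto
  then show ?thesis using bH by blast
qed

lemma mult_bounded_integral_le: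
  fixes \<phi> v :: "'a \<Rightarrow> real"
  assumes [measurable]: "\<phi> \<in> borel_measurable M" and C: "\<And>x. x \<in> space M \<Longrightarrow> \<bar>\<phi> x\<bar> \<le> C"
    and v: "integrable M v"
  shows "integrable M (\<lambda>x. \<phi> x * v x)" "\<bar>LINT x|M. \<phi> x * v x\<bar> \<le> C * (LINT x|M. \<bar>v x\<bar>)"
proof -
  have le: "\<bar>\<phi> x * v x\<bar> \<le> C * \<bar>v x\<bar>" if "x \<in> space M" for x
    using C[OF that] by (simp add: abs_mult mult_right_mono)
  show i: "integrable M (\<lambda>x. \<phi> x * v x)"
    by (rule Bochner_Integration.integrable_bound[of M "\<lambda>x. C * \<bar>v x\<bar>"]) (use v le in \<open>auto intro!: AE_I2 intro: order_trans[OF _ abs_ge_self]\<close>)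
  have "\<bar>LINT x|M. \<phi> x * v x\<bar> \<le> (LINT x|M. \<bar>\<phi> x * v x\<bar>)" by (rule integral_abs_bound)
  also have "\<dots> \<le> (LINT x|M. C * \<bar>v x\<bar>)"
    using i v le by (intro integral_mono) auto
  finally show "\<bar>LINT x|M. \<phi> x * v x\<bar> \<le> C * (LINT x|M. \<bar>v x\<bar>)" by simp
qed

definition asymptotically_invariant :: "('e \<Rightarrow> 'a \<Rightarrow> real) \<Rightarrow> 'e filter \<Rightarrow> bool" where
  "asymptotically_invariant u F \<longleftrightarrow>
     (\<forall>e. u e \<in> borel_measurable M) \<and> (\<exists>C. \<forall>e. \<forall>x\<in>space M. \<bar>u e x\<bar> \<le> C) \<and>
     (\<forall>k\<in>K. ((\<lambda>e. LINT x|M. \<bar>kernel_op k (u e) x - u e x\<bar>) \<longlongrightarrow> 0) F)"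

lemma asymptotically_invariantD:
  assumes "asymptotically_invariant u F"
  obtains C where "C > 0" "\<And>e x. x \<in> space M \<Longrightarrow> \<bar>u e x\<bar> \<le> C" "\<And>e. u e \<in> borel_measurable M"
    "\<And>k. k \<in> K \<Longrightarrow> ((\<lambda>e. LINT x|M. \<bar>kernel_op k (u e) x - u e x\<bar>) \<longlongrightarrow> 0) F"
proof -
  obtain C where C: "\<And>e x. x \<in> space M \<Longrightarrow> \<bar>u e x\<bar> \<le> C"
    using assms unfolding asymptotically_invariant_def by blast
  then have "\<And>e x. x \<in> space M \<Longrightarrow> \<bar>u e x\<bar> \<le> max C 1" by (simp add: le_max_iff_disj)
  with assms show ?thesis
    by (intro that[of "max C 1"]) (auto simp: asymptotically_invariant_def)
qed

lemma asymptotically_invariant_hull: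
  assumes u: "asymptotically_invariant u F" and g: "unit_fun M g" and a: "a \<in> dual_hull M K g"
  shows "((\<lambda>e. (LINT x|M. u e x * a x) - (LINT x|M. u e x * g x)) \<longlongrightarrow> 0) F"
  using a
proof induction
  case (midpoint a b)
  obtain C where C: "\<And>e x. x \<in> space M \<Longrightarrow> \<bar>u e x\<bar> \<le> C" and [measurable]: "\<And>e. u e \<in> borel_measurable M"
    by (rule asymptotically_invariantD[OF u]) blast
  have i: "integrable M (\<lambda>x. u e x * a x)" "integrable M (\<lambda>x. u e x * b x)" for e
    using midpoint.hyps[THEN dual_hull_unit_fun, OF g, THEN unit_fun_integrable]
    by (auto intro: mult_bounded_integral_le(1)[OF _ C])
  have "(LINT x|M. u e x * ((a x + b x) / 2)) = ((LINT x|M. u e x * a x) + (LINT x|M. u e x * b x)) / 2" for e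
    using i by (simp add: distrib_left add_divide_distrib)
  then have eq: "(LINT x|M. u e x * ((a x + b x) / 2)) - (LINT x|M. u e x * g x) =
      (((LINT x|M. u e x * a x) - (LINT x|M. u e x * g x)) + ((LINT x|M. u e x * b x) - (LINT x|M. u e x * g x))) / 2" for e
    by (simp add: field_simps)
  show ?case
    using tendsto_divide[OF tendsto_add[OF midpoint.IH] tendsto_const, of 2] unfolding eq by simp
next
  case (dual a k a')
  obtain C where C: "\<And>e x. x \<in> space M \<Longrightarrow> \<bar>u e x\<bar> \<le> C" and m[measurable]: "\<And>e. u e \<in> borel_measurable M"
    and lim: "((\<lambda>e. LINT x|M. \<bar>kernel_op k (u e) x - u e x\<bar>) \<longlongrightarrow> 0) F"
    by (rule asymptotically_invariantD[OF u]) (use dual.hyps(2) in blast)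
  have bd: "bounded (u e ` space M)" for e by (rule bounded_imageI[OF C])
  note k = \<open>k \<in> K\<close>
  note m'[measurable] = kernel_op_measurable[OF k m]
  have a: "unit_fun M a" by (rule dual_hull_unit_fun[OF dual.hyps(1) g])
  then have [measurable]: "a \<in> borel_measurable M" and a1: "\<And>x. x \<in> space M \<Longrightarrow> \<bar>a x\<bar> \<le> 1"
    by (auto simp: unit_fun_def)
  have "((\<lambda>e. (LINT x|M. u e x * a' x) - (LINT x|M. u e x * a x)) \<longlongrightarrow> 0) F"
  proof (rule Lim_null_comparison[OF always_eventually lim], rule allI)
    fix e
    have i: "integrable M (kernel_op k (u e))" "integrable M (u e)"
      by (auto intro!: integrable_bounded kernel_op_bounded[OF k] bd)
    have j: "integrable M (\<lambda>x. kernel_op k (u e) x * a x)" "integrable M (\<lambda>x. u e x * a x)"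
      by (auto intro!: integrable_bounded kernel_op_bounded[OF k] bounded_mult_image bd unit_fun_bounded[OF a])
    have "(LINT x|M. u e x * a' x) = (LINT x|M. kernel_op k (u e) x * a x)"
      using dual.hyps(3) bd[of e] by (auto simp: dual_density_def)
    then have "norm ((LINT x|M. u e x * a' x) - (LINT x|M. u e x * a x)) = \<bar>LINT x|M. a x * (kernel_op k (u e) x - u e x)\<bar>"
      using j by (simp add: algebra_simps)
    also have "\<dots> \<le> 1 * (LINT x|M. \<bar>kernel_op k (u e) x - u e x\<bar>)"
      by (rule mult_bounded_integral_le[OF _ a1]) (use i in auto)
    finally show "norm ((LINT x|M. u e x * a' x) - (LINT x|M. u e x * a x)) \<le> (LINT x|M. \<bar>kernel_op k (u e) x - u e x\<bar>)"
      by simp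
  qed
  from tendsto_add[OF this dual.IH] show ?case by simp
qed simp

text \<open>The hull of \<open>g\<close> contains functions close to the constant mean of \<open>g\<close>, and the pairing with \<open>u e\<close> is
asymptotically the same on the whole hull.\<close>

lemma asymptotically_invariant_unit_fun:
  assumes u: "asymptotically_invariant u F" and g: "unit_fun M g"
  shows "((\<lambda>e. (LINT x|M. u e x * g x) - (LINT x|M. g x) * (LINT x|M. u e x)) \<longlongrightarrow> 0) F"
proof (rule tendstoI)
  fix \<epsilon> :: real assume \<epsilon>: "\<epsilon> > 0"
  obtain C where Cpos: "C > 0" and C: "\<And>e x. x \<in> space M \<Longrightarrow> \<bar>u e x\<bar> \<le> C"
    and m[measurable]: "\<And>e. u e \<in> borel_measurable M"
    by (rule asymptotically_invariantD[OF u]) blast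
  define m where "m = (LINT x|M. g x)"
  obtain a where a: "a \<in> dual_hull M K g" and am: "(LINT x|M. \<bar>a x - m\<bar>) < \<epsilon> / 2 / C"
    using ex_hull_approximates_mean[OF g, of "\<epsilon> / 2 / C"] \<epsilon> Cpos by (auto simp: m_def)
  have ia: "integrable M a" by (rule unit_fun_integrable[OF dual_hull_unit_fun[OF a g]])
  have bound: "\<bar>(LINT x|M. u e x * a x) - m * (LINT x|M. u e x)\<bar> < \<epsilon> / 2" for e
  proof -
    have i: "integrable M (\<lambda>x. u e x * a x)" "integrable M (u e)"
      using mult_bounded_integral_le(1)[OF m C ia] integrable_bounded[OF m bounded_imageI[OF C]] by auto
    have "(LINT x|M. u e x * a x) - m * (LINT x|M. u e x) = (LINT x|M. u e x * (a x - m))"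
      using i by (simp add: right_diff_distrib)
    also have "\<bar>\<dots>\<bar> \<le> C * (LINT x|M. \<bar>a x - m\<bar>)"
      by (rule mult_bounded_integral_le[OF m C]) (use ia in auto)
    also have "\<dots> < C * (\<epsilon> / 2 / C)" using am Cpos by (intro mult_strict_left_mono)
    finally show ?thesis using Cpos by simp
  qed
  have "\<forall>\<^sub>F e in F. \<bar>(LINT x|M. u e x * a x) - (LINT x|M. u e x * g x)\<bar> < \<epsilon> / 2"
    using tendstoD[OF asymptotically_invariant_hull[OF u g a], of "\<epsilon> / 2"] \<epsilon> by (simp add: dist_real_def)
  then show "\<forall>\<^sub>F e in F. dist ((LINT x|M. u e x * g x) - (LINT x|M. g x) * (LINT x|M. u e x)) 0 < \<epsilon>"
  proof eventually_elim
    case (elim e)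
    with bound[of e] show ?case unfolding dist_real_def m_def[symmetric] diff_0_right by linarith
  qed
qed

text \<open>Truncating the density of \<open>\<eta>\<close> at a level \<open>n\<close> and dividing by \<open>n\<close> reduces this to unit functions.\<close>

theorem asymptotically_invariant_mixing:
  assumes u: "asymptotically_invariant u F"
    and \<eta>: "prob_space \<eta>" "sets \<eta> = sets M" "absolutely_continuous M \<eta>"
  shows "((\<lambda>e. (LINT x|\<eta>. u e x) - (LINT x|M. u e x)) \<longlongrightarrow> 0) F"
proof (rule tendstoI)
  fix \<epsilon> :: real assume \<epsilon>: "\<epsilon> > 0"
  interpret \<eta>: prob_space \<eta> by fact
  obtain C where Cpos: "C > 0" and C: "\<And>e x. x \<in> space M \<Longrightarrow> \<bar>u e x\<bar> \<le> C"
    and m[measurable]: "\<And>e. u e \<in> borel_measurable M"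
    by (rule asymptotically_invariantD[OF u]) blast
  obtain D where [measurable]: "D \<in> borel_measurable M"
    and RD: "AE x in M. RN_deriv M \<eta> x = ennreal (D x)" and D0: "\<And>x. 0 \<le> D x"
    by (rule real_RN_deriv[OF \<eta>.finite_measure_axioms \<eta>(3,2)]) auto
  have \<eta>D: "\<eta> = density M (\<lambda>x. ennreal (D x))"
    using density_RN_deriv[OF \<eta>(3,2)] density_cong[OF _ _ RD] by simp
  have nD: "(\<integral>\<^sup>+x. ennreal (D x) \<partial>M) = 1"
  proof -
    have "(\<integral>\<^sup>+x. ennreal (D x) \<partial>M) = emeasure \<eta> (space M)"
      by (simp add: \<eta>D emeasure_density cong: nn_integral_cong)
    then show ?thesis using \<eta>.emeasure_space_1 sets_eq_imp_space_eq[OF \<eta>(2)] by simp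
  qed
  have iD: "integrable M D" using nD D0 by (intro integrableI_nonneg) auto
  have D1: "(LINT x|M. D x) = 1"
    using nD nn_integral_eq_integral[OF iD] D0 by (simp add: ennreal_eq_1)
  define g where "g n x = min (D x) (real n)" for n x
  have [measurable]: "g n \<in> borel_measurable M" for n by (simp add: g_def[abs_def])
  have "(\<lambda>n. LINT x|M. \<bar>D x - g n x\<bar>) \<longlonglongrightarrow> (LINT x|M. 0)"
  proof (rule integral_dominated_convergence[where w=D])
    show "AE x in M. (\<lambda>n. \<bar>D x - g n x\<bar>) \<longlonglongrightarrow> 0"
    proof (rule AE_I2)
      fix x
      obtain n0 where "D x \<le> real n0" using real_arch_simple by blast
      then have "\<forall>\<^sub>F n in sequentially. \<bar>D x - g n x\<bar> = 0"
        unfolding eventually_sequentially by (intro exI[of _ n0]) (auto simp: g_def)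
      then show "(\<lambda>n. \<bar>D x - g n x\<bar>) \<longlonglongrightarrow> 0" by (rule tendsto_eventually)
    qed
    show "AE x in M. norm \<bar>D x - g n x\<bar> \<le> D x" for n
      using D0 by (intro AE_I2) (auto simp: g_def min_def)
  qed (use iD in auto)
  then have "\<forall>\<^sub>F n in sequentially. (LINT x|M. \<bar>D x - g n x\<bar>) < \<epsilon> / 4 / C"
    using \<epsilon> Cpos by (intro order_tendstoD(2)) auto
  from eventually_conj[OF this eventually_gt_at_top[of 0]]
  obtain n where n: "(LINT x|M. \<bar>D x - g n x\<bar>) < \<epsilon> / 4 / C" "n > 0"
    by (auto dest: eventually_happens)
  define h where "h x = g n x / real n" for x
  have h: "unit_fun M h" using D0 n by (auto simp: unit_fun_def h_def[abs_def] g_def)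
  have ig: "integrable M (g n)"
    by (rule Bochner_Integration.integrable_bound[OF iD]) (use D0 in \<open>auto simp: g_def\<close>)
  have gm: "\<bar>(LINT x|M. g n x) - 1\<bar> < \<epsilon> / 4 / C"
  proof -
    have "(LINT x|M. g n x) - 1 = - (LINT x|M. D x - g n x)" using ig iD D1 by simp
    also have "\<bar>\<dots>\<bar> \<le> (LINT x|M. \<bar>D x - g n x\<bar>)" using integral_abs_bound[of M "\<lambda>x. D x - g n x"] by simp
    finally show ?thesis using n by simp
  qed
  have "((\<lambda>e. real n * ((LINT x|M. u e x * h x) - (LINT x|M. h x) * (LINT x|M. u e x))) \<longlongrightarrow> real n * 0) F"
    by (intro tendsto_mult tendsto_const asymptotically_invariant_unit_fun[OF u h])
  moreover have "real n * ((LINT x|M. u e x * h x) - (LINT x|M. h x) * (LINT x|M. u e x)) =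
      (LINT x|M. u e x * g n x) - (LINT x|M. g n x) * (LINT x|M. u e x)" for e
    using n by (simp add: h_def right_diff_distrib)
  ultimately have "((\<lambda>e. (LINT x|M. u e x * g n x) - (LINT x|M. g n x) * (LINT x|M. u e x)) \<longlongrightarrow> 0) F"
    by simp
  then have "\<forall>\<^sub>F e in F. \<bar>(LINT x|M. u e x * g n x) - (LINT x|M. g n x) * (LINT x|M. u e x)\<bar> < \<epsilon> / 2"
    using \<epsilon> by (auto dest!: tendstoD[of _ _ _ "\<epsilon>/2"] simp: dist_real_def)
  then show "\<forall>\<^sub>F e in F. dist ((LINT x|\<eta>. u e x) - (LINT x|M. u e x)) 0 < \<epsilon>"
  proof eventually_elim
    case (elim e)
    have iu: "integrable M (u e)" by (rule integrable_bounded[OF m bounded_imageI[OF C]])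
    have "(LINT x|\<eta>. u e x) = (LINT x|M. u e x * D x)"
      unfolding \<eta>D using D0 by (subst integral_density) (auto simp: mult.commute)
    also have "\<dots> - (LINT x|M. u e x * g n x) = (LINT x|M. u e x * (D x - g n x))"
      using mult_bounded_integral_le(1)[OF m C iD] mult_bounded_integral_le(1)[OF m C ig]
      by (simp add: right_diff_distrib)
    finally have 1: "\<bar>(LINT x|\<eta>. u e x) - (LINT x|M. u e x * g n x)\<bar> \<le> C * (LINT x|M. \<bar>D x - g n x\<bar>)"
      using mult_bounded_integral_le(2)[OF m C, of "\<lambda>x. D x - g n x"] iD ig by simp
    have 2: "\<bar>LINT x|M. u e x\<bar> \<le> C"
      using mult_bounded_integral_le(2)[OF m C, of "\<lambda>_. 1"] by (simp add: prob_space)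
    have "\<bar>((LINT x|M. g n x) - 1) * (LINT x|M. u e x)\<bar> \<le> (\<epsilon> / 4 / C) * C"
      unfolding abs_mult using gm 2 by (intro mult_mono) auto
    moreover have "C * (LINT x|M. \<bar>D x - g n x\<bar>) < C * (\<epsilon> / 4 / C)"
      using n Cpos by (intro mult_strict_left_mono)
    moreover have "\<epsilon> / 4 / C * C = \<epsilon> / 4" "C * (\<epsilon> / 4 / C) = \<epsilon> / 4" using Cpos by auto
    ultimately show ?case
      using elim 1 unfolding dist_real_def diff_0_right left_diff_distrib mult_1 by linarith
  qed
qed

end

section \<open>Truncation and a subadditivity argument\<close>

text \<open>Convergence in probability to \<open>0\<close> is convergence to \<open>0\<close> of the mean of this function, which is
subadditive in its argument.\<close>

definition trunc_abs :: "real \<Rightarrow> real" where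
  "trunc_abs x = min 1 \<bar>x\<bar>"

lemma trunc_abs_bounds: "0 \<le> trunc_abs x" "trunc_abs x \<le> 1" "\<bar>trunc_abs x\<bar> \<le> 1"
  by (auto simp: trunc_abs_def)

lemma trunc_abs_eq_0_iff: "trunc_abs x = 0 \<longleftrightarrow> x = 0"
  by (auto simp: trunc_abs_def)

lemma trunc_abs_diff_le: "trunc_abs (x - y) \<le> trunc_abs x + trunc_abs y"
  by (auto simp: trunc_abs_def)

lemma continuous_on_trunc_abs [continuous_intros]: "continuous_on S g \<Longrightarrow> continuous_on S (\<lambda>x. trunc_abs (g x))"
  unfolding trunc_abs_def by (intro continuous_intros)

lemma borel_measurable_trunc_abs [measurable]: "trunc_abs \<in> borel_measurable borel"
  by (intro borel_measurable_continuous_onI continuous_intros)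

lemma tendsto_trunc_abs_zero: "(u \<longlongrightarrow> 0) F \<Longrightarrow> ((\<lambda>x. trunc_abs (u x)) \<longlongrightarrow> 0) F"
  by (rule Lim_null_comparison[where g="\<lambda>x. \<bar>u x\<bar>"]) (auto simp: trunc_abs_def intro: tendsto_rabs_zero)

lemma trunc_abs_divide_mono:
  assumes "0 < a" "a \<le> b"
  shows "trunc_abs (x / b) \<le> trunc_abs (x / a)"
  unfolding trunc_abs_def using assms by (intro min.mono) (auto intro: divide_left_mono)

lemma trunc_abs_divide_lower:
  assumes "0 < a" "0 < b"
  shows "min 1 (a / b) * trunc_abs (x / a) \<le> trunc_abs (x / b)"
proof -
  have "min 1 (a / b) * trunc_abs (x / a) \<le> 1 * 1"
    using assms by (intro mult_mono) (auto simp: trunc_abs_def)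
  moreover have "min 1 (a / b) * trunc_abs (x / a) \<le> (a / b) * \<bar>x / a\<bar>"
    using assms by (intro mult_mono) (auto simp: trunc_abs_def)
  ultimately show ?thesis using assms by (auto simp: trunc_abs_def)
qed

text \<open>For every \<open>v\<close>, the value \<open>\<psi> T u\<close> is at most \<open>\<psi> T (v T + u) + \<psi> T (v T)\<close>, and both terms should be
about \<open>\<phi> v\<close>, which is small for small \<open>v\<close>.  The first one, however, lies at the moving point \<open>v + u / T\<close>
in the scaled variable, where pointwise convergence says nothing.  Averaging over \<open>v\<close> in
\<open>[\<delta>, 2 \<delta>]\<close> and translating bounds both terms by the integral of \<open>\<psi> T (v T)\<close> over \<open>[\<delta>, 3 \<delta>]\<close>, to
which dominated convergence applies.\<close>

lemma scaled_subadditive_tendsto_0: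
  fixes \<psi> :: "real \<Rightarrow> real \<Rightarrow> real" and \<phi> :: "real \<Rightarrow> real"
  assumes m[measurable]: "\<And>T. \<psi> T \<in> borel_measurable borel"
    and b: "\<And>T w. 0 \<le> \<psi> T w" "\<And>T w. \<psi> T w \<le> 1"
    and sub: "\<And>T w u. 0 \<le> w \<Longrightarrow> 0 \<le> u \<Longrightarrow> \<psi> T u \<le> \<psi> T (w + u) + \<psi> T w"
    and lim: "\<And>v. v > 0 \<Longrightarrow> ((\<lambda>T. \<psi> T (v * T)) \<longlongrightarrow> \<phi> v) at_top"
    and \<phi>: "(\<phi> \<longlongrightarrow> 0) (at_right 0)"
    and u: "0 \<le> u"
  shows "((\<lambda>T. \<psi> T u) \<longlongrightarrow> 0) at_top"
proof (rule tendstoI)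
  fix \<epsilon> :: real assume \<epsilon>: "\<epsilon> > 0"
  obtain b0 where b0: "b0 > 0" "\<And>v. 0 < v \<Longrightarrow> v < b0 \<Longrightarrow> \<phi> v < \<epsilon> / 8"
    using order_tendstoD(2)[OF \<phi>, of "\<epsilon> / 8"] \<epsilon> unfolding eventually_at_right_field by auto
  define \<delta> where "\<delta> = b0 / 4"
  have \<delta>: "\<delta> > 0" "3 * \<delta> < b0" using b0 by (auto simp: \<delta>_def)
  define J where "J T v = indicator {\<delta>..3*\<delta>} v * \<psi> T (v * T)" for T v
  have [measurable]: "J T \<in> borel_measurable borel" for T unfolding J_def by measurable
  have Jlim: "((\<lambda>T. J T v) \<longlongrightarrow> indicator {\<delta>..3*\<delta>} v * \<phi> v) at_top" for v
    using lim[of v] \<delta> by (cases "v \<in> {\<delta>..3*\<delta>}") (auto simp: J_def)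
  have Jm: "(\<lambda>v. indicator {\<delta>..3*\<delta>} v * \<phi> v) \<in> borel_measurable borel"
  proof (rule borel_measurable_LIMSEQ_metric)
    show "(\<lambda>v. J (real n) v) \<in> borel_measurable borel" for n by measurable
    show "(\<lambda>n. J (real n) v) \<longlonglongrightarrow> indicator {\<delta>..3*\<delta>} v * \<phi> v" for v
      by (rule filterlim_compose[OF Jlim filterlim_real_sequentially])
  qed
  have i\<delta>: "integrable lborel (indicator {\<delta>..3*\<delta>} :: real \<Rightarrow> real)"
    by (simp add: emeasure_lborel_Icc_eq)
  have Jle: "0 \<le> J T v" "J T v \<le> indicator {\<delta>..3*\<delta>} v" for T v
    using b by (auto simp: J_def split: split_indicator)
  have iJ: "integrable lborel (J T)" for T
    by (rule Bochner_Integration.integrable_bound[OF i\<delta>]) (use Jle in auto)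
  have "((\<lambda>T. LINT v|lborel. J T v) \<longlongrightarrow> (LINT v|lborel. indicator {\<delta>..3*\<delta>} v * \<phi> v)) at_top"
    by (rule integral_dominated_convergence_at_top[where w="indicator {\<delta>..3*\<delta>}"])
       (use Jm Jlim Jle i\<delta> in \<open>auto intro!: always_eventually\<close>)
  moreover have "(LINT v|lborel. indicator {\<delta>..3*\<delta>} v * \<phi> v) < \<delta> * \<epsilon> / 2"
  proof -
    have "(LINT v|lborel. indicator {\<delta>..3*\<delta>} v * \<phi> v) \<le> (LINT v|lborel. indicator {\<delta>..3*\<delta>} v * (\<epsilon> / 8))"
    proof (rule integral_mono)
      have \<phi>1: "0 \<le> \<phi> v" "\<phi> v \<le> 1" if "v > 0" for v
        using tendsto_lowerbound[OF lim[OF that]] tendsto_upperbound[OF lim[OF that]] b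
        by (auto simp: trivial_limit_at_top_linorder)
      show "integrable lborel (\<lambda>v. indicator {\<delta>..3*\<delta>} v * \<phi> v)"
        by (rule Bochner_Integration.integrable_bound[OF i\<delta>])
           (use Jm \<phi>1 \<delta> in \<open>auto split: split_indicator\<close>)
      show "indicator {\<delta>..3*\<delta>} v * \<phi> v \<le> indicator {\<delta>..3*\<delta>} v * (\<epsilon> / 8)" for v
        using b0(2)[of v] \<delta> by (auto split: split_indicator)
    qed (use i\<delta> in auto)
    also have "\<dots> = \<delta> * \<epsilon> / 4" using \<delta> by simp
    also have "\<dots> < \<delta> * \<epsilon> / 2" using \<delta> \<epsilon> by simp
    finally show ?thesis .
  qed
  ultimately have "\<forall>\<^sub>F T in at_top. (LINT v|lborel. J T v) < \<delta> * \<epsilon> / 2"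
    by (rule order_tendstoD(2))
  moreover have "\<forall>\<^sub>F T in at_top. T > 0 \<and> u / T \<le> \<delta>"
  proof -
    have "\<forall>\<^sub>F T in at_top. T > 0 \<and> u / \<delta> \<le> T"
      by (intro eventually_conj eventually_gt_at_top eventually_ge_at_top)
    then show ?thesis by eventually_elim (use \<delta> in \<open>auto simp: field_simps\<close>)
  qed
  ultimately show "\<forall>\<^sub>F T in at_top. dist (\<psi> T u) 0 < \<epsilon>"
  proof eventually_elim
    case (elim T)
    define a where "a = u / T"
    have a: "0 \<le> a" "a \<le> \<delta>" using elim u by (auto simp: a_def)
    have i2: "integrable lborel (indicator {\<delta>..2*\<delta>} :: real \<Rightarrow> real)"
      by (simp add: emeasure_lborel_Icc_eq)
    have iA: "integrable lborel (\<lambda>v. indicator {\<delta>..2*\<delta>} v * \<psi> T ((a + 1 * v) * T))"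
      by (rule Bochner_Integration.integrable_bound[OF i2]) (use b in \<open>auto split: split_indicator\<close>)
    have iB: "integrable lborel (\<lambda>v. indicator {\<delta>..2*\<delta>} v * \<psi> T (v * T))"
      by (rule Bochner_Integration.integrable_bound[OF i2]) (use b in \<open>auto split: split_indicator\<close>)
    have "\<delta> * \<psi> T u = (LINT v|lborel. indicator {\<delta>..2*\<delta>} v * \<psi> T u)" using \<delta> by simp
    also have "\<dots> \<le> (LINT v|lborel. indicator {\<delta>..2*\<delta>} v * \<psi> T ((a + 1 * v) * T) + indicator {\<delta>..2*\<delta>} v * \<psi> T (v * T))"
    proof (rule integral_mono)
      fix v :: real
      have "\<psi> T u \<le> \<psi> T (v * T + u) + \<psi> T (v * T)" if "\<delta> \<le> v"
        using that \<delta> elim u by (intro sub) auto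
      moreover have "v * T + u = (a + 1 * v) * T" using elim by (simp add: a_def algebra_simps)
      ultimately show "indicator {\<delta>..2*\<delta>} v * \<psi> T u \<le>
          indicator {\<delta>..2*\<delta>} v * \<psi> T ((a + 1 * v) * T) + indicator {\<delta>..2*\<delta>} v * \<psi> T (v * T)"
        by (auto split: split_indicator)
    qed (use iA iB i2 in auto)
    also have "\<dots> = (LINT v|lborel. indicator {\<delta>..2*\<delta>} v * \<psi> T ((a + 1 * v) * T)) + (LINT v|lborel. indicator {\<delta>..2*\<delta>} v * \<psi> T (v * T))"
      using iA iB by simp
    also have "(LINT v|lborel. indicator {\<delta>..2*\<delta>} v * \<psi> T ((a + 1 * v) * T)) \<le> (LINT v|lborel. J T (a + 1 * v))"
    proof (rule integral_mono[OF iA])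
      show "integrable lborel (\<lambda>v. J T (a + 1 * v))"
        by (rule lborel_integrable_real_affine[OF iJ]) simp
      show "indicator {\<delta>..2*\<delta>} v * \<psi> T ((a + 1 * v) * T) \<le> J T (a + 1 * v)" for v
        using a b by (auto simp: J_def split: split_indicator)
    qed
    also have "(LINT v|lborel. J T (a + 1 * v)) = (LINT v|lborel. J T v)"
      using lborel_integral_real_affine[of 1 "J T" a] by simp
    also have "(LINT v|lborel. indicator {\<delta>..2*\<delta>} v * \<psi> T (v * T)) \<le> (LINT v|lborel. J T v)"
      using \<delta> b by (intro integral_mono[OF iB iJ]) (auto simp: J_def split: split_indicator)
    finally have "\<delta> * \<psi> T u \<le> 2 * (LINT v|lborel. J T v)" by simp
    also have "\<dots> < \<delta> * \<epsilon>" using elim by simp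
    finally show ?case using \<delta> b by (simp add: dist_real_def)
  qed
qed

section \<open>Test functions and convergence in law\<close>

text \<open>Test functions on the first \<open>n\<close> coordinates are represented as functions of whole sequences, so
that continuity and measurability refer to the product topology.\<close>

definition depends_on_first :: "nat \<Rightarrow> ((nat \<Rightarrow> real) \<Rightarrow> real) \<Rightarrow> bool" where
  "depends_on_first n g \<longleftrightarrow> (\<forall>x. g (tuple n x) = g x)"

definition uniformly_continuous_first :: "nat \<Rightarrow> ((nat \<Rightarrow> real) \<Rightarrow> real) \<Rightarrow> bool" where
  "uniformly_continuous_first n g \<longleftrightarrow>
     (\<forall>e>0. \<exists>d>0. \<forall>x y. (\<forall>i<n. \<bar>x i - y i\<bar> < d) \<longrightarrow> \<bar>g x - g y\<bar> < e)"

lemma continuous_on_tuple: "continuous_on UNIV (tuple n)"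
proof (rule continuous_on_coordinatewise_then_product)
  show "continuous_on UNIV (\<lambda>x. tuple n x i)" for i
    by (cases "i < n") (auto simp: tuple_def)
qed

lemma continuous_map_Euclidean_space_iff:
  "continuous_map (Euclidean_space n) euclideanreal h \<longleftrightarrow> continuous_on {x. \<forall>i\<ge>n. x i = 0} h"
  unfolding Euclidean_space_def euclidean_product_topology by simp

lemma tendsto_coordinatewise:
  fixes x :: "nat \<Rightarrow> nat \<Rightarrow> real"
  assumes "\<And>i. (\<lambda>k. x k i) \<longlonglongrightarrow> l i"
  shows "x \<longlonglongrightarrow> l"
proof -
  have "limitin (product_topology (\<lambda>_. euclideanreal) UNIV) x l sequentially"
    using assms by (simp add: limitin_componentwise)
  then show ?thesis by (simp add: euclidean_product_topology)
qed

text \<open>A failure of uniform continuity gives two sequences of points in a compact box that approach each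
other; a common cluster point contradicts continuity.\<close>

lemma compact_support_uniformly_continuous:
  assumes g: "continuous_on UNIV g" and dep: "depends_on_first n g"
    and supp: "\<And>x i. i < n \<Longrightarrow> \<bar>x i\<bar> > R \<Longrightarrow> g x = 0"
  shows "uniformly_continuous_first n g"
proof (rule ccontr)
  assume "\<not> ?thesis"
  then obtain e where e: "e > 0" and
    far: "\<forall>d>0. \<exists>x y. (\<forall>i<n. \<bar>x i - y i\<bar> < d) \<and> \<not> \<bar>g x - g y\<bar> < e"
    unfolding uniformly_continuous_first_def by auto
  have "\<exists>x y. (\<forall>i<n. \<bar>x i - y i\<bar> < 1 / real (Suc k)) \<and> \<not> \<bar>g x - g y\<bar> < e" for k
    using far[rule_format, of "1 / real (Suc k)"] by simp
  then have "\<exists>p. (\<forall>i<n. \<bar>fst p i - snd p i\<bar> < 1 / real (Suc k)) \<and> \<not> \<bar>g (fst p) - g (snd p)\<bar> < e" for k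
    by simp
  then obtain p where
    p: "\<And>k. (\<forall>i<n. \<bar>fst (p k) i - snd (p k) i\<bar> < 1 / real (Suc k)) \<and> \<not> \<bar>g (fst (p k)) - g (snd (p k))\<bar> < e"
    by metis
  define x0 y0 where "x0 k = fst (p k)" and "y0 k = snd (p k)" for k
  have xy0: "\<And>k i. i < n \<Longrightarrow> \<bar>x0 k i - y0 k i\<bar> < 1 / real (Suc k)" "\<And>k. \<not> \<bar>g (x0 k) - g (y0 k)\<bar> < e"
    using p by (auto simp: x0_def y0_def)
  define x y where "x k = tuple n (x0 k)" and "y k = tuple n (y0 k)" for k
  have xy: "\<bar>x k i - y k i\<bar> \<le> 1 / real (Suc k)" for k i
    using xy0(1)[of i k] by (cases "i < n") (auto simp: x_def y_def tuple_def less_imp_le)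
  have xy': "\<not> \<bar>g (x k) - g (y k)\<bar> < e" for k
    using xy0(2)[of k] dep by (simp add: x_def y_def depends_on_first_def)
  define B where "B i = (if i < n then {-(R+1)..R+1} else {0::real})" for i
  have "compactin (product_topology (\<lambda>_. euclideanreal) UNIV) (PiE UNIV B)"
    by (subst compactin_PiE) (auto simp: B_def)
  then have cpt: "compact (PiE UNIV B)"
    by (simp add: euclidean_product_topology)
  have "x k \<in> PiE UNIV B" for k
  proof -
    have "\<bar>x k i\<bar> \<le> R + 1" if "i < n" for i
    proof (rule ccontr)
      assume *: "\<not> \<bar>x k i\<bar> \<le> R + 1"
      \<comment> \<open>The two points are within distance one, so if \<open>x k\<close> leaves the enlarged box,
        both points leave the support.\<close>
      have "1 / real (Suc k) \<le> 1" by simp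
      with xy[of k i] * have "\<bar>x k i\<bar> > R" "\<bar>y k i\<bar> > R" by linarith+
      with supp[OF that] have "g (x k) = 0" "g (y k) = 0" by blast+
      with xy'[of k] e show False by simp
    qed
    then show ?thesis by (force simp: B_def x_def tuple_def abs_le_iff)
  qed
  then obtain l r where r: "strict_mono r" and l: "(x \<circ> r) \<longlonglongrightarrow> l"
    using compact_imp_seq_compact[OF cpt] unfolding seq_compact_def by metis
  have l_i: "(\<lambda>k. x (r k) i) \<longlonglongrightarrow> l i" for i
    using continuous_on_tendsto_compose[OF continuous_on_product_coordinates[of i] l] by (simp add: o_def)
  have "(\<lambda>k. y (r k) i) \<longlonglongrightarrow> l i" for i
  proof -
    have "(\<lambda>k. x (r k) i - y (r k) i) \<longlonglongrightarrow> 0"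
    proof (rule Lim_null_comparison)
      show "\<forall>\<^sub>F k in sequentially. norm (x (r k) i - y (r k) i) \<le> 1 / real (Suc (r k))"
        using xy by simp
      show "(\<lambda>k. 1 / real (Suc (r k))) \<longlonglongrightarrow> 0"
        using LIMSEQ_subseq_LIMSEQ[OF LIMSEQ_Suc[OF lim_1_over_n] r] by (simp add: o_def)
    qed
    from tendsto_diff[OF l_i[of i] this] show ?thesis by simp
  qed
  then have ly: "(\<lambda>k. y (r k)) \<longlonglongrightarrow> l" by (rule tendsto_coordinatewise)
  have "(\<lambda>k. g (x (r k)) - g (y (r k))) \<longlonglongrightarrow> g l - g l"
    using continuous_on_tendsto_compose[OF g l] continuous_on_tendsto_compose[OF g ly]
    by (intro tendsto_diff) (auto simp: o_def)
  then have "\<forall>\<^sub>F k in sequentially. \<bar>g (x (r k)) - g (y (r k))\<bar> < e"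
    using e by (auto dest!: tendstoD[of _ _ _ e] simp: dist_real_def)
  with xy' show False by simp
qed

text \<open>Either all coordinates differ by less than the modulus of continuity \<open>d\<close>, or one truncated
difference is at least \<open>d\<close>, and then the last term exceeds the trivial bound \<open>2 C\<close>.\<close>

lemma uniformly_continuous_first_bound:
  assumes u: "uniformly_continuous_first n g" and C: "\<And>x. \<bar>g x\<bar> \<le> C" and e: "e > 0"
  shows "\<exists>K. \<forall>x y. \<bar>g x - g y\<bar> \<le> e + K * (\<Sum>i<n. trunc_abs (x i - y i))"
proof -
  obtain d0 where d0: "d0 > 0" "\<And>x y. (\<forall>i<n. \<bar>x i - y i\<bar> < d0) \<Longrightarrow> \<bar>g x - g y\<bar> < e"
    using u e unfolding uniformly_continuous_first_def by blast
  define d where "d = min d0 1"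
  have d: "0 < d" "d \<le> 1" "d \<le> d0" using d0 by (auto simp: d_def)
  have C0: "0 \<le> C" using C[of undefined] by linarith
  have "\<bar>g x - g y\<bar> \<le> e + 2 * C / d * (\<Sum>i<n. trunc_abs (x i - y i))" for x y
  proof (cases "\<forall>i<n. \<bar>x i - y i\<bar> < d")
    case True
    then have "\<bar>g x - g y\<bar> < e" using d by (intro d0) auto
    moreover have "0 \<le> 2 * C / d * (\<Sum>i<n. trunc_abs (x i - y i))"
      using C0 d by (intro mult_nonneg_nonneg sum_nonneg trunc_abs_bounds) auto
    ultimately show ?thesis by linarith
  next
    case False
    then obtain i where i: "i < n" "d \<le> \<bar>x i - y i\<bar>" by auto
    have "d \<le> trunc_abs (x i - y i)" using i d by (auto simp: trunc_abs_def)
    also have "\<dots> \<le> (\<Sum>i<n. trunc_abs (x i - y i))"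
      using i by (intro member_le_sum trunc_abs_bounds) auto
    finally have "2 * C / d * d \<le> 2 * C / d * (\<Sum>i<n. trunc_abs (x i - y i))"
      using C0 d by (intro mult_left_mono) auto
    moreover have "\<bar>g x - g y\<bar> \<le> 2 * C" using C[of x] C[of y] by linarith
    ultimately show ?thesis using e d by simp
  qed
  then show ?thesis by blast
qed

definition box_cutoff :: "nat \<Rightarrow> real \<Rightarrow> (nat \<Rightarrow> real) \<Rightarrow> real" where
  "box_cutoff n R x = (\<Prod>i<n. max 0 (min 1 (R + 1 - \<bar>x i\<bar>)))"

lemma box_cutoff_bounds: "0 \<le> box_cutoff n R x" "box_cutoff n R x \<le> 1"
  unfolding box_cutoff_def by (auto intro!: prod_nonneg prod_le_1)

lemma continuous_on_box_cutoff: "continuous_on UNIV (box_cutoff n R)"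
  unfolding box_cutoff_def
  by (intro continuous_intros continuous_on_product_coordinates)

lemma box_cutoff_outside: "i < n \<Longrightarrow> \<bar>x i\<bar> > R + 1 \<Longrightarrow> box_cutoff n R x = 0"
  unfolding box_cutoff_def by (rule prod_zero) (auto intro!: bexI[of _ i])

lemma depends_on_first_box_cutoff: "depends_on_first n (box_cutoff n R)"
  by (auto simp: depends_on_first_def box_cutoff_def tuple_def)

lemma box_cutoff_tendsto_1: "(\<lambda>R. box_cutoff n (real R) x) \<longlonglongrightarrow> 1"
proof (rule tendsto_eventually)
  obtain k where k: "(\<Sum>i<n. \<bar>x i\<bar>) \<le> real k" using real_arch_simple by blast
  show "\<forall>\<^sub>F R in sequentially. box_cutoff n (real R) x = 1"
    using eventually_ge_at_top[of k]
  proof eventually_elim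
    case (elim R)
    have "\<bar>x i\<bar> \<le> real R" if "i < n" for i
      using member_le_sum[of i "{..<n}" "\<lambda>i. \<bar>x i\<bar>"] that k elim by auto
    then show ?case unfolding box_cutoff_def by (intro prod.neutral) auto
  qed
qed

lemma measurable_test:
  assumes g: "continuous_on UNIV (g :: (nat \<Rightarrow> real) \<Rightarrow> real)"
    and Y: "\<And>i. (\<lambda>\<omega>. Y \<omega> i) \<in> borel_measurable P"
  shows "(\<lambda>\<omega>. g (Y \<omega>)) \<in> borel_measurable P"
  by (rule measurable_compose[OF measurable_coordinatewise_then_product[OF Y] borel_measurable_continuous_onI[OF g]])

lemma converges_in_law_test:
  assumes c: "converges_in_law n P Y F N Z"
    and g: "continuous_on UNIV g" "\<And>x. \<bar>g x\<bar> \<le> C" "depends_on_first n g"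
  shows "((\<lambda>e. LINT \<omega>|P. g (Y e \<omega>)) \<longlongrightarrow> (LINT \<omega>|N. g (Z \<omega>))) F"
proof -
  have "continuous_map (Euclidean_space n) euclideanreal g"
    unfolding continuous_map_Euclidean_space_iff by (rule continuous_on_subset[OF g(1)]) simp
  moreover have "bounded (g ` topspace (Euclidean_space n))"
    unfolding bounded_iff using g(2) by auto
  ultimately have "((\<lambda>e. LINT \<omega>|P. g (tuple n (Y e \<omega>))) \<longlongrightarrow> (LINT \<omega>|N. g (tuple n (Z \<omega>)))) F"
    using c unfolding converges_in_law_def by blast
  then show ?thesis using g(3) by (simp add: depends_on_first_def)
qed

text \<open>Write \<open>g = g \<chi> + g (1 - \<chi>)\<close> with a cutoff \<open>\<chi>\<close> to a large box.  The product \<open>g \<chi>\<close> is uniformly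
continuous.  The mean of \<open>1 - \<chi>\<close>, also uniformly continuous, converges to its mean under the limit
law, which is small; this takes the place of tightness.\<close>

lemma converges_in_lawI:
  assumes P: "prob_space P" and N: "prob_space N"
    and Y: "\<And>e i. (\<lambda>\<omega>. Y e \<omega> i) \<in> borel_measurable P" and Z: "\<And>i. i < n \<Longrightarrow> (\<lambda>\<omega>. Z \<omega> i) \<in> borel_measurable N"
    and lim: "\<And>g C. continuous_on UNIV g \<Longrightarrow> (\<And>x. \<bar>g x\<bar> \<le> C) \<Longrightarrow> depends_on_first n g \<Longrightarrow>
       uniformly_continuous_first n g \<Longrightarrow> ((\<lambda>e. LINT \<omega>|P. g (Y e \<omega>)) \<longlongrightarrow> (LINT \<omega>|N. g (Z \<omega>))) F"
  shows "converges_in_law n P Y F N Z"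
  unfolding converges_in_law_def
proof (intro allI impI, elim conjE)
  fix h assume hc: "continuous_map (Euclidean_space n) euclideanreal h" and hb: "bounded (h ` topspace (Euclidean_space n))"
  interpret P: prob_space P by fact
  interpret N: prob_space N by fact
  define g where "g x = h (tuple n x)" for x
  have tuple_in: "tuple n x \<in> {x. \<forall>i\<ge>n. x i = 0}" for x by (simp add: tuple_def)
  have g: "continuous_on UNIV g"
    unfolding g_def
    using hc[unfolded continuous_map_Euclidean_space_iff] tuple_in
    by (intro continuous_on_compose2[OF _ continuous_on_tuple]) auto
  have tt: "tuple n (tuple n x) = tuple n x" for x by (auto simp: tuple_def)
  have dep: "depends_on_first n g" by (simp add: depends_on_first_def g_def tt)
  obtain C0 where C0: "\<And>x. \<bar>g x\<bar> \<le> C0"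
    using hb tuple_in unfolding bounded_iff topspace_Euclidean_space g_def ball_simps real_norm_def
    by blast
  define C where "C = max C0 1"
  have C: "\<And>x. \<bar>g x\<bar> \<le> C" "C > 0" using C0 by (auto simp: C_def le_max_iff_disj)
  define Z' where "Z' \<omega> = tuple n (Z \<omega>)" for \<omega>
  have Z': "(\<lambda>\<omega>. Z' \<omega> i) \<in> borel_measurable N" for i
    using Z[of i] by (cases "i < n") (auto simp: Z'_def tuple_def)
  have gZ: "k (Z' \<omega>) = k (Z \<omega>)" if "depends_on_first n k" for k \<omega>
    using that by (simp add: Z'_def depends_on_first_def)
  let ?\<chi> = "\<lambda>R. box_cutoff n (real R)"
  have "((\<lambda>e. LINT \<omega>|P. g (Y e \<omega>)) \<longlongrightarrow> (LINT \<omega>|N. g (Z' \<omega>))) F"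
  proof (rule tendstoI)
    fix \<epsilon> :: real assume \<epsilon>: "\<epsilon> > 0"
    have "(\<lambda>R. LINT \<omega>|N. 1 - ?\<chi> R (Z' \<omega>)) \<longlonglongrightarrow> (LINT \<omega>|N. 0)"
    proof (rule integral_dominated_convergence[where w="\<lambda>_. 1"])
      show "AE \<omega> in N. (\<lambda>R. 1 - ?\<chi> R (Z' \<omega>)) \<longlonglongrightarrow> 0"
        using tendsto_diff[OF tendsto_const box_cutoff_tendsto_1, of 1 n] by auto
      show "AE \<omega> in N. norm (1 - ?\<chi> R (Z' \<omega>)) \<le> 1" for R using box_cutoff_bounds by auto
      show "(\<lambda>\<omega>. 1 - ?\<chi> R (Z' \<omega>)) \<in> borel_measurable N" for R
        using measurable_test[OF continuous_on_box_cutoff Z'] by auto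
    qed auto
    then have "\<forall>\<^sub>F R in sequentially. (LINT \<omega>|N. 1 - ?\<chi> R (Z' \<omega>)) < \<epsilon> / 4 / C"
      using \<epsilon> C by (intro order_tendstoD(2)) auto
    then obtain R where R: "(LINT \<omega>|N. 1 - ?\<chi> R (Z' \<omega>)) < \<epsilon> / 4 / C"
      by (auto dest: eventually_happens)
    define g1 g2 where "g1 x = g x * ?\<chi> R x" and "g2 x = 1 - ?\<chi> R x" for x
    have cont: "continuous_on UNIV g1" "continuous_on UNIV g2"
      unfolding g1_def g2_def by (intro continuous_intros g continuous_on_box_cutoff)+
    have dep12: "depends_on_first n g1" "depends_on_first n g2"
      using dep depends_on_first_box_cutoff[of n "real R"] by (auto simp: depends_on_first_def g1_def g2_def)
    have b1: "\<bar>g1 x\<bar> \<le> C" for x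
      using C(1)[of x] box_cutoff_bounds[of n "real R" x] mult_mono[of "\<bar>g x\<bar>" C "?\<chi> R x" 1] C
      by (auto simp: g1_def abs_mult)
    have b2: "\<bar>g2 x\<bar> \<le> 1" "0 \<le> g2 x" for x
      using box_cutoff_bounds[of n "real R" x] by (auto simp: g2_def)
    have u1: "uniformly_continuous_first n g1"
      by (rule compact_support_uniformly_continuous[OF cont(1) dep12(1), where R="real R + 1"])
         (simp add: g1_def box_cutoff_outside)
    have u\<chi>: "uniformly_continuous_first n (?\<chi> R)"
      by (rule compact_support_uniformly_continuous[OF continuous_on_box_cutoff depends_on_first_box_cutoff, where R="real R + 1"])
         (simp add: box_cutoff_outside)
    then have u2: "uniformly_continuous_first n g2"
      unfolding uniformly_continuous_first_def g2_def by (simp add: abs_minus_commute)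
    have close: "\<bar>(LINT \<omega>|S. g (V \<omega>)) - (LINT \<omega>|S. g1 (V \<omega>))\<bar> \<le> C * (LINT \<omega>|S. g2 (V \<omega>))"
      if "prob_space S" and V: "\<And>i. (\<lambda>\<omega>. V \<omega> i) \<in> borel_measurable S" for S and V :: "_ \<Rightarrow> nat \<Rightarrow> real"
    proof -
      interpret S: prob_space S by fact
      have i: "integrable S (\<lambda>\<omega>. g (V \<omega>))" "integrable S (\<lambda>\<omega>. g1 (V \<omega>))" "integrable S (\<lambda>\<omega>. g2 (V \<omega>))"
        by (rule S.integrable_const_bound[where B=C], use C b1 in simp, intro measurable_test[OF _ V] g cont)+
           (rule S.integrable_const_bound[where B=1], use b2 in simp, intro measurable_test[OF _ V] g cont)
      have "\<bar>(LINT \<omega>|S. g (V \<omega>)) - (LINT \<omega>|S. g1 (V \<omega>))\<bar> = \<bar>LINT \<omega>|S. g (V \<omega>) - g1 (V \<omega>)\<bar>"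
        using i by simp
      also have "\<dots> \<le> (LINT \<omega>|S. \<bar>g (V \<omega>) - g1 (V \<omega>)\<bar>)" by (rule integral_abs_bound)
      also have "\<dots> \<le> (LINT \<omega>|S. C * g2 (V \<omega>))"
      proof (rule integral_mono)
        show "\<bar>g (V \<omega>) - g1 (V \<omega>)\<bar> \<le> C * g2 (V \<omega>)" for \<omega>
        proof -
          have "g (V \<omega>) - g1 (V \<omega>) = g (V \<omega>) * g2 (V \<omega>)" by (simp add: g1_def g2_def algebra_simps)
          then show ?thesis using C b2 by (simp add: abs_mult mult_right_mono)
        qed
      qed (use i in auto)
      finally show ?thesis using i by simp
    qed
    have "\<forall>\<^sub>F e in F. \<bar>(LINT \<omega>|P. g1 (Y e \<omega>)) - (LINT \<omega>|N. g1 (Z' \<omega>))\<bar> < \<epsilon> / 4"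
      using tendstoD[OF lim[OF cont(1) b1 dep12(1) u1], of "\<epsilon> / 4"] \<epsilon> gZ[OF dep12(1)] by (simp add: dist_real_def)
    moreover have "\<forall>\<^sub>F e in F. (LINT \<omega>|P. g2 (Y e \<omega>)) < \<epsilon> / 4 / C"
      using R gZ[OF dep12(2)] by (intro order_tendstoD(2)[OF lim[OF cont(2) b2(1) dep12(2) u2]]) (simp add: g2_def)
    ultimately show "\<forall>\<^sub>F e in F. dist (LINT \<omega>|P. g (Y e \<omega>)) (LINT \<omega>|N. g (Z' \<omega>)) < \<epsilon>"
    proof eventually_elim
      case (elim e)
      have "C * (LINT \<omega>|P. g2 (Y e \<omega>)) < C * (\<epsilon> / 4 / C)" "C * (LINT \<omega>|N. g2 (Z' \<omega>)) < C * (\<epsilon> / 4 / C)"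
        using C R elim by (auto intro!: mult_strict_left_mono simp: g2_def simp del: times_divide_eq_right)
      moreover have "C * (\<epsilon> / 4 / C) = \<epsilon> / 4" using C by simp
      ultimately show ?case
        using elim close[of P "Y e", OF P Y] close[of N Z', OF N Z'] unfolding dist_real_def by linarith
    qed
  qed
  then show "((\<lambda>e. LINT \<omega>|P. h (tuple n (Y e \<omega>))) \<longlongrightarrow> (LINT \<omega>|N. h (tuple n (Z \<omega>)))) F"
    by (simp add: g_def Z'_def tt)
qed

section \<open>Shifts and additive functionals on path space\<close>

lemma space_path_space:
  "space path_space = {\<omega> \<in> extensional {0..}. continuous_on {0..} \<omega>}"
  by (auto simp: path_space_def space_restrict_space space_PiM PiE_def)

lemma measurable_path_eval [measurable (raw)]:
  assumes "0 \<le> t"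
  shows "(\<lambda>\<omega>. \<omega> t) \<in> path_space \<rightarrow>\<^sub>M borel"
  unfolding path_space_def using assms by (intro measurable_restrict_space1 measurable_component_singleton) auto

lemma shift_in_path_space:
  assumes "\<omega> \<in> space path_space" "0 \<le> r"
  shows "shift r \<omega> \<in> space path_space"
proof -
  have "continuous_on {0..} (\<lambda>t. \<omega> (r + t))"
  proof (rule continuous_on_compose2[of "{0..}" \<omega>])
    show "continuous_on {0..} (\<lambda>t. r + t)" by (intro continuous_intros)
  qed (use assms in \<open>auto simp: space_path_space\<close>)
  then have "continuous_on {0..} (shift r \<omega>)"
    by (rule continuous_on_cong[THEN iffD1, rotated -1]) (auto simp: shift_def)
  then show ?thesis by (simp add: space_path_space shift_def)
qed

lemma measurable_shift [measurable]:
  assumes "0 \<le> r"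
  shows "shift r \<in> path_space \<rightarrow>\<^sub>M path_space"
  unfolding path_space_def[where 'a='a] 
proof (rule measurable_restrict_space2)
  show "shift r \<in> space (restrict_space (Pi\<^sub>M {0..} (\<lambda>_. borel)) {\<omega>. continuous_on {0..} \<omega>}) \<rightarrow> {\<omega>. continuous_on {0..} \<omega>}"
    using shift_in_path_space[OF _ assms] unfolding path_space_def[symmetric] by (auto simp: space_path_space)
  show "shift r \<in> restrict_space (Pi\<^sub>M {0..} (\<lambda>_. borel)) {\<omega>. continuous_on {0..} \<omega>} \<rightarrow>\<^sub>M Pi\<^sub>M {0..} (\<lambda>_. borel)"
    unfolding path_space_def[symmetric] shift_def
    using assms by (intro measurable_restrict measurable_path_eval) auto
qed

lemma continuous_on_path_compose:
  assumes "continuous_on UNIV f" "\<omega> \<in> space path_space"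
  shows "continuous_on {0..} (\<lambda>r. f (\<omega> r))"
  using assms by (intro continuous_on_compose2[OF assms(1)]) (auto simp: space_path_space)

lemma additive_functional_integrable:
  fixes f :: "'a::topological_space \<Rightarrow> real"
  assumes f: "continuous_on UNIV f" and \<omega>: "\<omega> \<in> space path_space" and a: "0 \<le> a"
  shows "set_integrable lborel {a..b} (\<lambda>r. f (\<omega> r))"
  unfolding set_integrable_def
proof (rule borel_integrable_compact)
  show "continuous_on {a..b} (\<lambda>r. f (\<omega> r))"
    by (rule continuous_on_subset[OF continuous_on_path_compose[OF f \<omega>]]) (use a in auto)
qed simp

lemma additive_functional_add:
  fixes f :: "'a::topological_space \<Rightarrow> real"
  assumes f: "continuous_on UNIV f" and \<omega>: "\<omega> \<in> space path_space" and t: "0 \<le> r" "0 \<le> t"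
  shows "additive_functional f (r + t) \<omega> = additive_functional f r \<omega> + additive_functional f t (shift r \<omega>)"
proof -
  have "(LINT x:{0..t}|lborel. f (shift r \<omega> x)) = (LINT x:{0..t}|lborel. f (\<omega> (r + x)))"
    by (rule set_lebesgue_integral_cong) (auto simp: shift_def)
  also have "\<dots> = (LINT x|lborel. indicator {r..r+t} (r + 1 * x) *\<^sub>R f (\<omega> (r + 1 * x)))"
    unfolding set_lebesgue_integral_def
    by (intro Bochner_Integration.integral_cong) (auto split: split_indicator)
  also have "\<dots> = (LINT x:{r..r+t}|lborel. f (\<omega> x))"
    unfolding set_lebesgue_integral_def by (subst lborel_integral_real_affine[of 1 _ r]) auto
  finally have 1: "additive_functional f t (shift r \<omega>) = (LINT x:{r..r+t}|lborel. f (\<omega> x))"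
    by (simp add: additive_functional_def)
  have "(LINT x:{0..r+t}|lborel. f (\<omega> x)) = (LINT x:{0..r} \<union> {r..r+t}|lborel. f (\<omega> x))"
    using t by (intro arg_cong2[where f="set_lebesgue_integral lborel"]) auto
  also have "\<dots> = (LINT x:{0..r}|lborel. f (\<omega> x)) + (LINT x:{r..r+t}|lborel. f (\<omega> x))"
  proof (rule set_integral_Un_AE)
    show "AE x in lborel. \<not> (x \<in> {0..r} \<and> x \<in> {r..r+t})"
      using AE_lborel_singleton[of r] by eventually_elim auto
  qed (use additive_functional_integrable[OF f \<omega>] t in auto)
  finally show ?thesis unfolding 1 by (simp add: additive_functional_def)
qed

text \<open>By continuity of the path, evaluation at \<open>r\<close> is the limit of the evaluations at the grid times \<open>\<lfloor>n r\<rfloor> / n\<close>, which take countably many values.\<close>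

lemma measurable_joint_eval:
  fixes f :: "'a::topological_space \<Rightarrow> real"
  assumes f: "continuous_on UNIV f"
  shows "(\<lambda>(\<omega>, r). f (\<omega> (max 0 r))) \<in> path_space \<Otimes>\<^sub>M borel \<rightarrow>\<^sub>M borel"
proof (rule borel_measurable_LIMSEQ_metric)
  have [measurable]: "f \<in> borel_measurable borel" using f by (rule borel_measurable_continuous_onI)
  define q where "q n r = real (nat \<lfloor>real (Suc n) * r\<rfloor>) / real (Suc n)" for n r
  show "(\<lambda>(\<omega>, r). f (\<omega> (q n r))) \<in> path_space \<Otimes>\<^sub>M borel \<rightarrow>\<^sub>M borel" for n
  proof -
    have "(\<lambda>x. (\<lambda>k x. f (fst x (real k / real (Suc n)))) (nat \<lfloor>real (Suc n) * snd x\<rfloor>) x)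
        \<in> path_space \<Otimes>\<^sub>M borel \<rightarrow>\<^sub>M borel"
    proof (rule measurable_compose_countable[where f="\<lambda>k x. f (fst x (real k / real (Suc n)))"
            and g="\<lambda>x. nat \<lfloor>real (Suc n) * snd x\<rfloor>"])
      show "(\<lambda>x. nat \<lfloor>real (Suc n) * snd x\<rfloor>) \<in> (path_space :: (real \<Rightarrow> 'a) measure) \<Otimes>\<^sub>M borel \<rightarrow>\<^sub>M count_space UNIV"
        by measurable
      fix k :: nat
      have "(\<lambda>x. fst x (real k / real (Suc n))) \<in> (path_space :: (real \<Rightarrow> 'a) measure) \<Otimes>\<^sub>M (borel :: real measure) \<rightarrow>\<^sub>M borel"
        by (rule measurable_compose[OF measurable_fst measurable_path_eval]) simp
      then show "(\<lambda>x. f (fst x (real k / real (Suc n)))) \<in> (path_space :: (real \<Rightarrow> 'a) measure) \<Otimes>\<^sub>M (borel :: real measure) \<rightarrow>\<^sub>M borel"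
        by measurable
    qed
    then show ?thesis by (simp add: q_def case_prod_beta)
  qed
  fix x :: "(real \<Rightarrow> 'a) \<times> real" assume x: "x \<in> space (path_space \<Otimes>\<^sub>M borel)"
  obtain \<omega> r where xr: "x = (\<omega>, r)" by (cases x)
  have \<omega>: "\<omega> \<in> space path_space" using x xr by (auto simp: space_pair_measure)
  have q: "(\<lambda>n. q n r) \<longlonglongrightarrow> max 0 r"
  proof (cases "r \<ge> 0")
    case True
    have *: "(\<lambda>n. r - 1 / real (Suc n)) \<longlonglongrightarrow> max 0 r"
      using tendsto_diff[OF tendsto_const LIMSEQ_Suc[OF lim_1_over_n], of r] True by simp
    show ?thesis
    proof (rule tendsto_sandwich[OF _ _ *])
      show "(\<lambda>n. r) \<longlonglongrightarrow> max 0 r" using True by simp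
      have "real (nat \<lfloor>real (Suc n) * r\<rfloor>) = real_of_int \<lfloor>real (Suc n) * r\<rfloor>" for n
        using True by simp
      then have "real (Suc n) * r - 1 \<le> real (nat \<lfloor>real (Suc n) * r\<rfloor>)" "real (nat \<lfloor>real (Suc n) * r\<rfloor>) \<le> real (Suc n) * r" for n
        by (metis real_of_int_floor_gt_diff_one less_imp_le, metis of_int_floor_le)
      then show "\<forall>\<^sub>F n in sequentially. r - 1 / real (Suc n) \<le> q n r" "\<forall>\<^sub>F n in sequentially. q n r \<le> r"
        unfolding q_def by (auto simp: pos_le_divide_eq pos_divide_le_eq left_diff_distrib right_diff_distrib mult.commute simp del: of_nat_Suc)
    qed
  next
    case False
    then have le: "real (Suc n) * r \<le> 0" for n by (simp add: mult_le_0_iff)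
    have "\<lfloor>real (Suc n) * r\<rfloor> \<le> 0" for n using le[of n] by linarith
    then have "q n r = 0" for n unfolding q_def by simp
    then show ?thesis using False by simp
  qed
  have "continuous_on {0..} (\<lambda>r. f (\<omega> r))" by (rule continuous_on_path_compose[OF f \<omega>])
  then show "(\<lambda>n. case x of (\<omega>, r) \<Rightarrow> f (\<omega> (q n r))) \<longlonglongrightarrow> (case x of (\<omega>, r) \<Rightarrow> f (\<omega> (max 0 r)))"
    unfolding xr prod.case
    by (rule continuous_on_tendsto_compose[OF _ q]) (auto simp: q_def)
qed

lemma measurable_additive_functional_joint:
  fixes f :: "'a::topological_space \<Rightarrow> real"
  assumes f: "continuous_on UNIV f"
  shows "(\<lambda>(t, \<omega>). additive_functional f t \<omega>) \<in> borel \<Otimes>\<^sub>M path_space \<rightarrow>\<^sub>M borel"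
proof -
  let ?M = "((borel :: real measure) \<Otimes>\<^sub>M (path_space :: (real \<Rightarrow> 'a) measure)) \<Otimes>\<^sub>M (lborel :: real measure)"
  have snd: "snd \<in> ?M \<rightarrow>\<^sub>M borel"
    using measurable_snd[of "borel \<Otimes>\<^sub>M path_space" lborel] by simp
  have fst: "(\<lambda>x. fst (fst x)) \<in> ?M \<rightarrow>\<^sub>M borel"
    by (rule measurable_compose[OF measurable_fst measurable_fst])
  have "(\<lambda>x. (snd (fst x), snd x)) \<in> ?M \<rightarrow>\<^sub>M path_space \<Otimes>\<^sub>M borel"
    by (rule measurable_Pair[OF measurable_compose[OF measurable_fst measurable_snd] snd])
  from measurable_compose[OF this measurable_joint_eval[OF f]]
  have f': "(\<lambda>x. f (snd (fst x) (max 0 (snd x)))) \<in> ?M \<rightarrow>\<^sub>M borel" by simp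
  have ind: "(indicator {0..} :: real \<Rightarrow> real) \<in> borel \<rightarrow>\<^sub>M borel" by measurable
  have "(\<lambda>x. indicator {0..} (snd x) * indicator {0..} (fst (fst x) - snd x) * f (snd (fst x) (max 0 (snd x)))) \<in> ?M \<rightarrow>\<^sub>M borel"
    by (intro borel_measurable_times f' measurable_compose[OF snd ind]
        measurable_compose[OF borel_measurable_diff[OF fst snd] ind])
  then have "(\<lambda>x. LINT r|lborel. indicator {0..} r * indicator {0..} (fst x - r) * f (snd x (max 0 r))) \<in> borel \<Otimes>\<^sub>M path_space \<rightarrow>\<^sub>M borel"
    by (intro lborel.borel_measurable_lebesgue_integral) (simp add: case_prod_beta)
  moreover have "(LINT r|lborel. indicator {0..} r * indicator {0..} (t - r) * f (\<omega> (max 0 r))) = additive_functional f t \<omega>" for t \<omega>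
    unfolding additive_functional_def set_lebesgue_integral_def
    by (intro Bochner_Integration.integral_cong) (auto split: split_indicator simp: max_def)
  ultimately show ?thesis by (simp add: case_prod_beta)
qed

lemma measurable_additive_functional:
  fixes f :: "'a::topological_space \<Rightarrow> real"
  assumes f: "continuous_on UNIV f"
  shows "additive_functional f t \<in> borel_measurable path_space"
  using measurable_compose[OF measurable_Pair1' measurable_additive_functional_joint[OF f], of t] by simp
lemma shift_shift:
  assumes "0 \<le> a" "0 \<le> b"
  shows "shift a (shift b \<omega>) = shift (b + a) \<omega>"
  using assms by (auto simp: shift_def fun_eq_iff add.assoc)

text \<open>Both sides complete \<open>S(r + t)\<close>, cut at time \<open>r\<close> or at time \<open>t\<close>.\<close>

lemma additive_functional_shift_diff:
  fixes f :: "'a::topological_space \<Rightarrow> real"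
  assumes "continuous_on UNIV f" "\<omega> \<in> space path_space" "0 \<le> r" "0 \<le> t"
  shows "additive_functional f t (shift r \<omega>) - additive_functional f t \<omega> =
         additive_functional f r (shift t \<omega>) - additive_functional f r \<omega>"
  using additive_functional_add[OF assms] additive_functional_add[OF assms(1,2,4,3)]
  by (simp add: add.commute)

section \<open>The Markov property at fixed times\<close>

locale markov_paths =
  fixes Q :: "'a::topological_space \<Rightarrow> (real \<Rightarrow> 'a) measure"
  assumes Q_kernel: "Q \<in> borel \<rightarrow>\<^sub>M prob_algebra path_space"
    and Q_strong_markov: "strong_markov Q"
begin

lemma Q_prob: "prob_space (Q x)" and sets_Q: "sets (Q x) = sets path_space" and space_Q: "space (Q x) = space path_space"
  using measurable_space[OF Q_kernel, of x] sets_eq_imp_space_eq[of "Q x" path_space]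
  by (auto simp: space_prob_algebra)

lemma Q_kernel_law: "sets \<nu> = sets borel \<Longrightarrow> Q \<in> \<nu> \<rightarrow>\<^sub>M prob_algebra path_space"
  using Q_kernel by (simp cong: measurable_cong_sets)

lemma transition_kernel:
  assumes "0 \<le> t"
  shows "transition Q t \<in> borel \<rightarrow>\<^sub>M prob_algebra borel"
  unfolding transition_def
  using measurable_compose[OF Q_kernel measurable_distr_prob_space[OF measurable_path_eval[OF assms]]] .

lemma law_from_prob:
  assumes "prob_space \<nu>" "sets \<nu> = sets borel"
  shows "prob_space (law_from Q \<nu>)" "sets (law_from Q \<nu>) = sets path_space"
proof -
  have "\<nu> \<in> space (prob_algebra \<nu>)" using assms by (simp add: space_prob_algebra)
  with Q_kernel_law[OF assms(2)] show "prob_space (law_from Q \<nu>)" "sets (law_from Q \<nu>) = sets path_space"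
    unfolding law_from_def using prob_space_bind' sets_bind' by blast+
qed

lemma dual_semigroup_eq_bind:
  assumes t: "0 \<le> t" and \<nu>: "prob_space \<nu>" "sets \<nu> = sets borel"
  shows "dual_semigroup Q t \<nu> = \<nu> \<bind> transition Q t"
  unfolding dual_semigroup_def law_from_def transition_def
  by (rule distr_bind[OF measurable_prob_algebraD[OF Q_kernel_law[OF \<nu>(2)]] _ measurable_path_eval[OF t]])
     (simp add: prob_space.not_empty[OF \<nu>(1)])

lemma dual_semigroup_prob:
  assumes t: "0 \<le> t" and \<nu>: "prob_space \<nu>" "sets \<nu> = sets borel"
  shows "prob_space (dual_semigroup Q t \<nu>)" "sets (dual_semigroup Q t \<nu>) = sets borel"
  unfolding dual_semigroup_def using law_from_prob[OF \<nu>] measurable_path_eval[OF t]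
  by (auto intro!: prob_space.prob_space_distr cong: measurable_cong_sets)

text \<open>The strong Markov property at a constant stopping time.\<close>

lemma simple_markov:
  assumes t: "0 \<le> t"
  shows "distr (Q x) path_space (shift t) = transition Q t x \<bind> Q"
proof (rule measure_eqI)
  interpret F: filtration "space path_space" "path_filtration :: ennreal \<Rightarrow> (real \<Rightarrow> 'a) measure"
    by (rule filtration_path_filtration)
  interpret Qx: prob_space "Q x" by (rule Q_prob)
  note [measurable] = measurable_prob_algebraD[OF Q_kernel]
  have ev: "(\<lambda>\<omega>. \<omega> t) \<in> Q x \<rightarrow>\<^sub>M borel"
    using measurable_path_eval[OF t] by (simp cong: measurable_cong_sets add: sets_Q)
  have sh: "shift t \<in> Q x \<rightarrow>\<^sub>M path_space"
    using measurable_shift[OF t] by (simp cong: measurable_cong_sets add: sets_Q)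
  have tr: "sets (transition Q t x) = sets borel" "space (transition Q t x) \<noteq> {}"
    by (auto simp: transition_def)
  have QT: "Q \<in> transition Q t x \<rightarrow>\<^sub>M subprob_algebra path_space"
    using measurable_prob_algebraD[OF Q_kernel] by (simp cong: measurable_cong_sets add: tr)
  show sets_eq: "sets (distr (Q x) path_space (shift t)) = sets (transition Q t x \<bind> Q)"
    using sets_bind[of "transition Q t x" Q path_space] tr(2) by (simp add: sets_Q)
  fix G assume "G \<in> sets (distr (Q x) path_space (shift t))"
  then have G[measurable]: "G \<in> sets path_space" by simp
  have "space path_space \<in> sets (F.pre_sigma (\<lambda>_. ennreal t))"
    using sets.top[of "F.pre_sigma (\<lambda>_. ennreal t)"] by (simp add: F.space_pre_sigma)
  moreover have "stopping_time path_filtration (\<lambda>_ :: real \<Rightarrow> 'a. ennreal t)"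
    by (rule stopping_time_const)
  ultimately have "emeasure (Q x) {\<omega>\<in>space path_space. ennreal t < \<infinity> \<and> shift (enn2real (ennreal t)) \<omega> \<in> G} =
        (\<integral>\<^sup>+\<omega>\<in>{\<omega>\<in>space path_space. ennreal t < \<infinity>}. emeasure (Q (\<omega> (enn2real (ennreal t)))) G \<partial>Q x)"
    using Q_strong_markov G unfolding strong_markov_def by blast
  then have *: "emeasure (Q x) {\<omega>\<in>space path_space. shift t \<omega> \<in> G} =
        (\<integral>\<^sup>+\<omega>\<in>space path_space. emeasure (Q (\<omega> t)) G \<partial>Q x)"
    using t by simp
  have "emeasure (distr (Q x) path_space (shift t)) G = emeasure (Q x) {\<omega>\<in>space path_space. shift t \<omega> \<in> G}"
    by (subst emeasure_distr[OF sh G]) (auto intro!: arg_cong[where f="emeasure (Q x)"] simp: space_Q)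
  also have "\<dots> = (\<integral>\<^sup>+\<omega>. emeasure (Q (\<omega> t)) G \<partial>Q x)"
    unfolding * by (intro nn_integral_cong) (simp add: space_Q)
  also have "\<dots> = (\<integral>\<^sup>+y. emeasure (Q y) G \<partial>transition Q t x)"
    unfolding transition_def by (rule nn_integral_distr[OF ev, symmetric]) measurable
  also have "\<dots> = emeasure (transition Q t x \<bind> Q) G"
    by (rule emeasure_bind[OF tr(2) QT G, symmetric])
  finally show "emeasure (distr (Q x) path_space (shift t)) G = emeasure (transition Q t x \<bind> Q) G" .
qed

lemma kernel_op_Q:
  assumes m: "H \<in> borel_measurable path_space" and b: "\<And>\<omega>. \<omega> \<in> space path_space \<Longrightarrow> \<bar>H \<omega>\<bar> \<le> C"
  shows "integrable (Q x) H" "kernel_op Q H \<in> borel_measurable borel" "\<bar>kernel_op Q H x\<bar> \<le> C"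
proof -
  interpret Qx: prob_space "Q x" by (rule Q_prob)
  have m': "H \<in> borel_measurable (Q x)" using m by (simp cong: measurable_cong_sets add: sets_Q)
  show i: "integrable (Q x) H"
    by (rule Qx.integrable_const_bound[of _ C]) (use m' b in \<open>auto simp: space_Q\<close>)
  show "kernel_op Q H \<in> borel_measurable borel"
    unfolding kernel_op_def
    by (rule measurable_compose[OF measurable_prob_algebraD[OF Q_kernel] integral_measurable_subprob_algebra[OF m]])
  have "\<bar>kernel_op Q H x\<bar> \<le> (\<integral>\<omega>. \<bar>H \<omega>\<bar> \<partial>Q x)"
    unfolding kernel_op_def by (rule integral_abs_bound)
  also have "\<dots> \<le> (\<integral>\<omega>. C \<partial>Q x)" by (intro integral_mono) (use i b in \<open>auto simp: space_Q\<close>)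
  finally show "\<bar>kernel_op Q H x\<bar> \<le> C" by (simp add: Qx.prob_space)
qed

lemma integral_law_from:
  assumes m: "H \<in> borel_measurable path_space" and b: "\<And>\<omega>. \<omega> \<in> space path_space \<Longrightarrow> \<bar>H \<omega>\<bar> \<le> C"
    and \<nu>: "prob_space \<nu>" "sets \<nu> = sets borel"
  shows "(LINT \<omega>|law_from Q \<nu>. H \<omega>) = (LINT x|\<nu>. kernel_op Q H x)"
  unfolding law_from_def kernel_op_def
proof (rule integral_bind[where K=path_space and B=C and B'=1])
  show "Q \<in> \<nu> \<rightarrow>\<^sub>M subprob_algebra path_space"
    by (rule measurable_prob_algebraD[OF Q_kernel_law[OF \<nu>(2)]])
  show "finite_measure \<nu>" using \<nu>(1) by (rule prob_space.finite_measure)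
qed (use m b Q_prob in \<open>auto simp: prob_space.emeasure_space_1\<close>)

text \<open>The expectation of a shifted functional, as a function of the starting point, is the transition
operator applied to the expectation of the functional.\<close>

lemma kernel_op_Q_shift:
  assumes m: "H \<in> borel_measurable path_space" and b: "\<And>\<omega>. \<omega> \<in> space path_space \<Longrightarrow> \<bar>H \<omega>\<bar> \<le> C" and t: "0 \<le> t"
  shows "kernel_op Q (\<lambda>\<omega>. H (shift t \<omega>)) x = kernel_op (transition Q t) (kernel_op Q H) x"
proof -
  have sh: "shift t \<in> Q x \<rightarrow>\<^sub>M path_space"
    using measurable_shift[OF t] by (simp cong: measurable_cong_sets add: sets_Q)
  have "kernel_op Q (\<lambda>\<omega>. H (shift t \<omega>)) x = (LINT \<omega>|distr (Q x) path_space (shift t). H \<omega>)"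
    unfolding kernel_op_def by (rule integral_distr[OF sh m, symmetric])
  also have "\<dots> = (LINT \<omega>|law_from Q (transition Q t x). H \<omega>)"
    unfolding simple_markov[OF t] law_from_def ..
  also have "\<dots> = (LINT y|transition Q t x. kernel_op Q H y)"
    using measurable_space[OF transition_kernel[OF t], of x]
    by (intro integral_law_from[OF m b]) (auto simp: space_prob_algebra)
  finally show ?thesis by (simp add: kernel_op_def[of "transition Q t"])
qed

lemma integral_law_from_shift:
  fixes H :: "_ \<Rightarrow> real"
  assumes m: "H \<in> borel_measurable path_space" and b: "\<And>\<omega>. \<omega> \<in> space path_space \<Longrightarrow> \<bar>H \<omega>\<bar> \<le> C" and t: "0 \<le> t"
    and \<nu>: "prob_space \<nu>" "sets \<nu> = sets borel"
  shows "(LINT \<omega>|law_from Q \<nu>. H (shift t \<omega>)) = (LINT \<omega>|law_from Q (dual_semigroup Q t \<nu>). H \<omega>)"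
proof -
  have m': "(\<lambda>\<omega>. H (shift t \<omega>)) \<in> borel_measurable path_space"
    by (rule measurable_compose[OF measurable_shift[OF t] m])
  have b': "\<bar>H (shift t \<omega>)\<bar> \<le> C" if "\<omega> \<in> space path_space" for \<omega>
    by (rule b[OF shift_in_path_space[OF that t]])
  have "(LINT \<omega>|law_from Q \<nu>. H (shift t \<omega>)) = (LINT x|\<nu>. kernel_op (transition Q t) (kernel_op Q H) x)"
    using integral_law_from[OF m' b' \<nu>] kernel_op_Q_shift[OF m b t] by simp
  also have "\<dots> = integral\<^sup>L (\<nu> \<bind> transition Q t) (kernel_op Q H)"
    unfolding kernel_op_def[of "transition Q t"]
  proof (rule integral_bind[symmetric, where K=borel and B=C and B'=1])
    show "transition Q t \<in> \<nu> \<rightarrow>\<^sub>M subprob_algebra borel"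
      using measurable_prob_algebraD[OF transition_kernel[OF t]] by (simp cong: measurable_cong_sets add: \<nu>)
    show "finite_measure \<nu>" using \<nu>(1) by (rule prob_space.finite_measure)
    show "AE x in \<nu>. emeasure (transition Q t x) (space (transition Q t x)) \<le> ennreal 1"
      using measurable_space[OF transition_kernel[OF t]]
      by (auto simp: space_prob_algebra prob_space.emeasure_space_1)
  qed (use kernel_op_Q[OF m b] in auto)
  also have "\<dots> = (LINT \<omega>|law_from Q (dual_semigroup Q t \<nu>). H \<omega>)"
    unfolding dual_semigroup_eq_bind[OF t \<nu>, symmetric]
    by (rule integral_law_from[OF m b dual_semigroup_prob[OF t \<nu>], symmetric])
  finally show ?thesis .
qed

end

section \<open>Forgetting an absolutely continuous initial law\<close>

locale ergodic_markov_paths = markov_paths Q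
  for Q :: "'a::topological_space \<Rightarrow> (real \<Rightarrow> 'a) measure" +
  fixes \<mu> :: "'a measure"
  assumes \<mu>_invariant: "invariant_prob Q \<mu>"
    and \<mu>_unique: "invariant_prob Q \<eta> \<Longrightarrow> \<eta> = \<mu>"
begin

lemma \<mu>_prob: "prob_space \<mu>" "sets \<mu> = sets borel"
  using \<mu>_invariant by (auto simp: invariant_prob_def)

lemma dual_semigroup_\<mu>: "0 \<le> t \<Longrightarrow> dual_semigroup Q t \<mu> = \<mu>"
  using \<mu>_invariant by (auto simp: invariant_prob_def)

sublocale kernels: ergodic_kernels \<mu> "transition Q ` {0..}"
proof (rule ergodic_kernels.intro[OF \<mu>_prob(1)], rule ergodic_kernels_axioms.intro)
  fix k assume "k \<in> transition Q ` {0..}"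
  then obtain t where t: "0 \<le> t" "k = transition Q t" by auto
  have "prob_algebra \<mu> = prob_algebra borel"
    unfolding prob_algebra_def using subprob_algebra_cong[OF \<mu>_prob(2)] by simp
  then show "k \<in> \<mu> \<rightarrow>\<^sub>M prob_algebra \<mu>"
    using transition_kernel[OF t(1)] t(2) by (simp cong: measurable_cong_sets add: \<mu>_prob(2))
  show "\<mu> \<bind> k = \<mu>"
    using dual_semigroup_eq_bind[OF t(1) \<mu>_prob] dual_semigroup_\<mu>[OF t(1)] t(2) by simp
next
  fix \<eta> assume \<eta>: "prob_space \<eta>" "sets \<eta> = sets \<mu>" "\<And>k. k \<in> transition Q ` {0..} \<Longrightarrow> \<eta> \<bind> k = \<eta>"
  have s\<eta>: "sets \<eta> = sets borel" using \<eta>(2) \<mu>_prob(2) by simp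
  have "invariant_prob Q \<eta>"
    unfolding invariant_prob_def
  proof (intro conjI allI impI)
    fix t :: real assume t: "0 \<le> t"
    show "dual_semigroup Q t \<eta> = \<eta>"
      unfolding dual_semigroup_eq_bind[OF t \<eta>(1) s\<eta>] by (rule \<eta>(3)) (use t in simp)
  qed (use \<eta> s\<eta> in auto)
  then show "\<eta> = \<mu>" by (rule \<mu>_unique)
qed

lemma integrable_law:
  fixes H :: "_ \<Rightarrow> real"
  assumes \<nu>: "prob_space \<nu>" "sets \<nu> = sets borel"
    and m: "H \<in> borel_measurable path_space" and b: "\<And>\<omega>. \<omega> \<in> space path_space \<Longrightarrow> \<bar>H \<omega>\<bar> \<le> C"
  shows "integrable (law_from Q \<nu>) H"
proof -
  note l = law_from_prob[OF \<nu>]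
  show ?thesis
    by (rule finite_measure.integrable_const_bound[OF prob_space.finite_measure[OF l(1)], of _ C])
       (use m b sets_eq_imp_space_eq[OF l(2)] l(2) in \<open>auto cong: measurable_cong_sets\<close>)
qed

lemma space_law: "prob_space \<nu> \<Longrightarrow> sets \<nu> = sets borel \<Longrightarrow> space (law_from Q \<nu>) = space path_space"
  by (rule sets_eq_imp_space_eq[OF law_from_prob(2)])

lemma stationary:
  fixes H :: "_ \<Rightarrow> real"
  assumes "H \<in> borel_measurable path_space" "\<And>\<omega>. \<omega> \<in> space path_space \<Longrightarrow> \<bar>H \<omega>\<bar> \<le> C" "0 \<le> t"
  shows "(LINT \<omega>|law_from Q \<mu>. H (shift t \<omega>)) = (LINT \<omega>|law_from Q \<mu>. H \<omega>)"
  using integral_law_from_shift[OF assms \<mu>_prob] dual_semigroup_\<mu>[OF assms(3)] by simp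

text \<open>Averaging over paths turns asymptotic invariance of \<open>H\<close> under time shifts into asymptotic
invariance of \<open>x \<mapsto> E\<^sub>x H\<close> under the semigroup, and \<open>asymptotically_invariant_mixing\<close> applies.\<close>

lemma asymptotically_shift_invariant_law:
  fixes H :: "'e \<Rightarrow> (real \<Rightarrow> 'a) \<Rightarrow> real"
  assumes m: "\<And>e. H e \<in> borel_measurable path_space" and b: "\<And>e \<omega>. \<omega> \<in> space path_space \<Longrightarrow> \<bar>H e \<omega>\<bar> \<le> C"
    and lim: "\<And>r. 0 \<le> r \<Longrightarrow> ((\<lambda>e. LINT \<omega>|law_from Q \<mu>. \<bar>H e (shift r \<omega>) - H e \<omega>\<bar>) \<longlongrightarrow> 0) F"
    and \<eta>: "prob_space \<eta>" "sets \<eta> = sets borel" "absolutely_continuous \<mu> \<eta>"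
  shows "((\<lambda>e. (LINT \<omega>|law_from Q \<eta>. H e \<omega>) - (LINT \<omega>|law_from Q \<mu>. H e \<omega>)) \<longlongrightarrow> 0) F"
proof -
  have "kernels.asymptotically_invariant (\<lambda>e. kernel_op Q (H e)) F"
    unfolding kernels.asymptotically_invariant_def
  proof (intro conjI allI ballI exI)
    show "kernel_op Q (H e) \<in> borel_measurable \<mu>" for e
      using kernel_op_Q(2)[OF m b, of e] by (simp cong: measurable_cong_sets add: \<mu>_prob(2))
    show "\<bar>kernel_op Q (H e) x\<bar> \<le> C" for e x
      by (rule kernel_op_Q(3)[OF m b])
    fix k assume "k \<in> transition Q ` {0..}"
    then obtain r where r: "0 \<le> r" "k = transition Q r" by auto
    show "((\<lambda>e. LINT x|\<mu>. \<bar>kernel_op k (kernel_op Q (H e)) x - kernel_op Q (H e) x\<bar>) \<longlongrightarrow> 0) F"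
    proof (rule Lim_null_comparison[OF always_eventually lim[OF r(1)]], rule allI)
      fix e
      have m1: "(\<lambda>\<omega>. H e (shift r \<omega>)) \<in> borel_measurable path_space"
        by (rule measurable_compose[OF measurable_shift[OF r(1)] m])
      have b1: "\<bar>H e (shift r \<omega>)\<bar> \<le> C" if "\<omega> \<in> space path_space" for \<omega>
        by (rule b[OF shift_in_path_space[OF that r(1)]])
      have m2: "(\<lambda>\<omega>. \<bar>H e (shift r \<omega>) - H e \<omega>\<bar>) \<in> borel_measurable path_space"
        using m1 m by measurable
      have b2: "\<bar>\<bar>H e (shift r \<omega>) - H e \<omega>\<bar>\<bar> \<le> 2 * C" if "\<omega> \<in> space path_space" for \<omega>
        using b1[OF that] b[OF that, of e] by linarith
      have le: "\<bar>kernel_op k (kernel_op Q (H e)) x - kernel_op Q (H e) x\<bar> \<le> kernel_op Q (\<lambda>\<omega>. \<bar>H e (shift r \<omega>) - H e \<omega>\<bar>) x" for x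
      proof -
        have "kernel_op k (kernel_op Q (H e)) x - kernel_op Q (H e) x = (LINT \<omega>|Q x. H e (shift r \<omega>) - H e \<omega>)"
          using kernel_op_Q(1)[OF m1 b1] kernel_op_Q(1)[OF m b] kernel_op_Q_shift[OF m b r(1)]
          unfolding r(2) by (simp add: kernel_op_def[of Q])
        also have "\<bar>\<dots>\<bar> \<le> (LINT \<omega>|Q x. \<bar>H e (shift r \<omega>) - H e \<omega>\<bar>)" by (rule integral_abs_bound)
        finally show ?thesis by (simp add: kernel_op_def[of Q])
      qed
      have "(LINT x|\<mu>. \<bar>kernel_op k (kernel_op Q (H e)) x - kernel_op Q (H e) x\<bar>) \<le> (LINT x|\<mu>. kernel_op Q (\<lambda>\<omega>. \<bar>H e (shift r \<omega>) - H e \<omega>\<bar>) x)"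
      proof (rule integral_mono)
        have kb: "kernel_op Q (H e) \<in> borel_measurable \<mu>" "bounded (kernel_op Q (H e) ` space \<mu>)"
          using kernel_op_Q(2,3)[OF m b] by (auto intro!: bounded_imageI cong: measurable_cong_sets simp: \<mu>_prob(2))
        have kk: "k \<in> transition Q ` {0..}" using r by simp
        show "integrable \<mu> (\<lambda>x. \<bar>kernel_op k (kernel_op Q (H e)) x - kernel_op Q (H e) x\<bar>)"
          using kernels.integrable_bounded[OF kb]
            kernels.integrable_bounded[OF kernels.kernel_op_measurable[OF kk kb(1)] kernels.kernel_op_bounded[OF kk kb]]
          by auto
        show "integrable \<mu> (kernel_op Q (\<lambda>\<omega>. \<bar>H e (shift r \<omega>) - H e \<omega>\<bar>))"
          using kernel_op_Q(2,3)[OF m2 b2]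
          by (intro kernels.integrable_bounded bounded_imageI[where c="2*C"]) (auto cong: measurable_cong_sets simp: \<mu>_prob(2))
      qed (rule le)
      also have "\<dots> = (LINT \<omega>|law_from Q \<mu>. \<bar>H e (shift r \<omega>) - H e \<omega>\<bar>)"
        by (rule integral_law_from[OF m2 b2 \<mu>_prob, symmetric])
      finally show "norm (LINT x|\<mu>. \<bar>kernel_op k (kernel_op Q (H e)) x - kernel_op Q (H e) x\<bar>)
          \<le> (LINT \<omega>|law_from Q \<mu>. \<bar>H e (shift r \<omega>) - H e \<omega>\<bar>)" by simp
    qed
  qed
  from kernels.asymptotically_invariant_mixing[OF this \<eta>(1) _ \<eta>(3)] \<eta>(2) \<mu>_prob(2)
  show ?thesis by (simp add: integral_law_from[OF m b \<eta>(1,2)] integral_law_from[OF m b \<mu>_prob])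
qed

text \<open>A nonnegative functional with vanishing stationary mean is asymptotically shift invariant, since its
shifts have the same mean.\<close>

lemma null_law_transfer:
  fixes H :: "'e \<Rightarrow> (real \<Rightarrow> 'a) \<Rightarrow> real"
  assumes m: "\<And>e. H e \<in> borel_measurable path_space" and b: "\<And>e \<omega>. 0 \<le> H e \<omega>" "\<And>e \<omega>. H e \<omega> \<le> C"
    and lim: "((\<lambda>e. LINT \<omega>|law_from Q \<mu>. H e \<omega>) \<longlongrightarrow> 0) F"
    and \<eta>: "prob_space \<eta>" "sets \<eta> = sets borel" "absolutely_continuous \<mu> \<eta>"
  shows "((\<lambda>e. LINT \<omega>|law_from Q \<eta>. H e \<omega>) \<longlongrightarrow> 0) F"
proof -
  have b': "\<bar>H e \<omega>\<bar> \<le> C" for e \<omega> using b(1)[of e \<omega>] b(2)[of e \<omega>] by simp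
  have "((\<lambda>e. (LINT \<omega>|law_from Q \<eta>. H e \<omega>) - (LINT \<omega>|law_from Q \<mu>. H e \<omega>)) \<longlongrightarrow> 0) F"
  proof (rule asymptotically_shift_invariant_law[OF m b' _ \<eta>])
    fix r :: real assume r: "0 \<le> r"
    show "((\<lambda>e. LINT \<omega>|law_from Q \<mu>. \<bar>H e (shift r \<omega>) - H e \<omega>\<bar>) \<longlongrightarrow> 0) F"
    proof (rule Lim_null_comparison[OF always_eventually], rule allI)
      fix e
      have m1: "(\<lambda>\<omega>. H e (shift r \<omega>)) \<in> borel_measurable path_space"
        by (rule measurable_compose[OF measurable_shift[OF r] m])
      have i: "integrable (law_from Q \<mu>) (H e)" "integrable (law_from Q \<mu>) (\<lambda>\<omega>. H e (shift r \<omega>))"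
        using integrable_law[OF \<mu>_prob m b'] integrable_law[OF \<mu>_prob m1 b'] by auto
      have "(LINT \<omega>|law_from Q \<mu>. \<bar>H e (shift r \<omega>) - H e \<omega>\<bar>) \<le> (LINT \<omega>|law_from Q \<mu>. H e (shift r \<omega>) + H e \<omega>)"
      proof (rule integral_mono)
        show "\<bar>H e (shift r \<omega>) - H e \<omega>\<bar> \<le> H e (shift r \<omega>) + H e \<omega>" for \<omega>
          using b(1)[of e \<omega>] b(1)[of e "shift r \<omega>"] by linarith
      qed (use i in auto)
      also have "\<dots> = 2 * (LINT \<omega>|law_from Q \<mu>. H e \<omega>)"
        using i stationary[OF m b' r] by simp
      finally show "norm (LINT \<omega>|law_from Q \<mu>. \<bar>H e (shift r \<omega>) - H e \<omega>\<bar>) \<le> 2 * (LINT \<omega>|law_from Q \<mu>. H e \<omega>)" by simp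
    next
      show "((\<lambda>e. 2 * (LINT \<omega>|law_from Q \<mu>. H e \<omega>)) \<longlongrightarrow> 0) F"
        using tendsto_mult[OF tendsto_const lim, of 2] by simp
    qed
  qed
  from tendsto_add[OF this lim] show ?thesis by simp
qed

section \<open>Negligible windows\<close>

context
  fixes f :: "'a \<Rightarrow> real" and s :: "real \<Rightarrow> real"
  assumes f: "continuous_on UNIV f"
begin

lemma trunc_additive_measurable:
  "(\<lambda>\<omega>. trunc_abs (additive_functional f t \<omega> / c)) \<in> borel_measurable path_space"
  using measurable_additive_functional[OF f, of t] by measurable

lemma trunc_additive_shift_measurable:
  "0 \<le> r \<Longrightarrow> (\<lambda>\<omega>. trunc_abs (additive_functional f t (shift r \<omega>) / c)) \<in> borel_measurable path_space"
  by (rule measurable_compose[OF measurable_shift trunc_additive_measurable])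

text \<open>The window \<open>S(u)\<close> is \<open>S(w + u)\<close> minus the shift of \<open>S(w)\<close>, and the shift does not change the
stationary law; this gives the subadditivity in \<open>scaled_subadditive_tendsto_0\<close>.\<close>

lemma normalized_window_null:
  assumes lim: "\<And>v. v > 0 \<Longrightarrow> ((\<lambda>T. LINT \<omega>|law_from Q \<mu>. trunc_abs (additive_functional f (v * T) \<omega> / s T)) \<longlongrightarrow> \<phi> v) at_top"
    and \<phi>: "(\<phi> \<longlongrightarrow> 0) (at_right 0)" and u: "0 \<le> u"
  shows "((\<lambda>T. LINT \<omega>|law_from Q \<mu>. trunc_abs (additive_functional f u \<omega> / s T)) \<longlongrightarrow> 0) at_top"
proof (rule scaled_subadditive_tendsto_0[OF _ _ _ _ lim \<phi> u])
  interpret P: prob_space "law_from Q \<mu>" by (rule law_from_prob[OF \<mu>_prob])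
  have sP: "sets (law_from Q \<mu>) = sets path_space" by (rule law_from_prob[OF \<mu>_prob])
  let ?\<psi> = "\<lambda>T w. LINT \<omega>|law_from Q \<mu>. trunc_abs (additive_functional f w \<omega> / s T)"
  note tb = trunc_abs_bounds
  note tm = trunc_additive_measurable trunc_additive_shift_measurable
  show "?\<psi> T \<in> borel_measurable borel" for T
  proof (rule P.borel_measurable_lebesgue_integral)
    have [measurable]: "(\<lambda>x. additive_functional f (fst x) (snd x)) \<in> borel \<Otimes>\<^sub>M law_from Q \<mu> \<rightarrow>\<^sub>M borel"
      using measurable_additive_functional_joint[OF f]
      by (simp add: case_prod_beta cong: measurable_cong_sets sets_pair_measure_cong add: sP)
    show "(\<lambda>(w, \<omega>). trunc_abs (additive_functional f w \<omega> / s T)) \<in> borel \<Otimes>\<^sub>M law_from Q \<mu> \<rightarrow>\<^sub>M borel"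
      unfolding case_prod_beta by measurable
  qed
  show "0 \<le> ?\<psi> T w" for T w by (intro Bochner_Integration.integral_nonneg tb)
  show "?\<psi> T w \<le> 1" for T w
  proof -
    have "?\<psi> T w \<le> (LINT \<omega>|law_from Q \<mu>. 1)"
      by (intro integral_mono integrable_law[OF \<mu>_prob tm(1) tb(3)] tb) simp
    then show ?thesis by (simp add: P.prob_space)
  qed
  fix T w u :: real assume wu: "0 \<le> w" "0 \<le> u"
  have i: "integrable (law_from Q \<mu>) (\<lambda>\<omega>. trunc_abs (additive_functional f v \<omega> / s T))" for v
    by (rule integrable_law[OF \<mu>_prob tm(1) tb(3)])
  have i2: "integrable (law_from Q \<mu>) (\<lambda>\<omega>. trunc_abs (additive_functional f w (shift u \<omega>) / s T))"
    by (rule integrable_law[OF \<mu>_prob tm(2)[OF wu(2)] tb(3)])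
  have "?\<psi> T u \<le> (LINT \<omega>|law_from Q \<mu>. trunc_abs (additive_functional f (w + u) \<omega> / s T) + trunc_abs (additive_functional f w (shift u \<omega>) / s T))"
  proof (rule integral_mono[OF i])
    fix \<omega> assume "\<omega> \<in> space (law_from Q \<mu>)"
    then have \<omega>: "\<omega> \<in> space path_space" using space_law[OF \<mu>_prob] by simp
    have "additive_functional f u \<omega> / s T = additive_functional f (w + u) \<omega> / s T - additive_functional f w (shift u \<omega>) / s T"
      using additive_functional_add[OF f \<omega> wu(2,1)] by (simp add: add.commute diff_divide_distrib[symmetric])
    then show "trunc_abs (additive_functional f u \<omega> / s T) \<le>
        trunc_abs (additive_functional f (w + u) \<omega> / s T) + trunc_abs (additive_functional f w (shift u \<omega>) / s T)"
      using trunc_abs_diff_le by metis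
  qed (use i i2 in auto)
  also have "\<dots> = ?\<psi> T (w + u) + ?\<psi> T w"
    using i i2 stationary[OF tm(1) tb(3) wu(2)] by simp
  finally show "?\<psi> T u \<le> ?\<psi> T (w + u) + ?\<psi> T w" .
qed

text \<open>If \<open>s(T) \<le> c\<close>, the truncated mean of \<open>S(T0) / s(T)\<close> is at least that of \<open>S(T0) / c\<close>, a positive
number; so \<open>s(T) \<le> c\<close> is excluded for large \<open>T\<close>.\<close>

lemma normalization_tendsto_infinity:
  assumes s: "\<And>t. t > 0 \<Longrightarrow> s t > 0"
    and null: "\<And>u. 0 \<le> u \<Longrightarrow> ((\<lambda>T. LINT \<omega>|law_from Q \<mu>. trunc_abs (additive_functional f u \<omega> / s T)) \<longlongrightarrow> 0) at_top"
    and pos: "0 < T0" "(LINT \<omega>|law_from Q \<mu>. trunc_abs (additive_functional f T0 \<omega> / s T0)) > 0"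
  shows "filterlim s at_top at_top"
  unfolding filterlim_at_top_gt[where c=0]
proof (intro allI impI)
  fix c :: real assume c: "0 < c"
  let ?E = "\<lambda>a. LINT \<omega>|law_from Q \<mu>. trunc_abs (additive_functional f T0 \<omega> / a)"
  have i: "integrable (law_from Q \<mu>) (\<lambda>\<omega>. trunc_abs (additive_functional f T0 \<omega> / a))" for a
    by (rule integrable_law[OF \<mu>_prob trunc_additive_measurable trunc_abs_bounds(3)])
  have "0 < min 1 (s T0 / c) * ?E (s T0)"
    using s[OF pos(1)] c pos(2) by simp
  also have "\<dots> = (LINT \<omega>|law_from Q \<mu>. min 1 (s T0 / c) * trunc_abs (additive_functional f T0 \<omega> / s T0))"
    by simp
  also have "\<dots> \<le> ?E c"
    using s[OF pos(1)] c by (intro integral_mono trunc_abs_divide_lower) (use i in auto)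
  finally have "\<forall>\<^sub>F T in at_top. ?E (s T) < ?E c"
    using order_tendstoD(2)[OF null[of T0]] pos(1) by simp
  then show "\<forall>\<^sub>F T in at_top. c \<le> s T"
    using eventually_gt_at_top[of 0]
  proof eventually_elim
    case (elim T)
    show ?case
    proof (rule ccontr)
      assume "\<not> c \<le> s T"
      then have "?E c \<le> ?E (s T)"
        using s[OF elim(2)] by (intro integral_mono i trunc_abs_divide_mono) auto
      with elim show False by simp
    qed
  qed
qed

text \<open>Shifting the path by \<open>r\<close> changes the \<open>i\<close>-th coordinate by the window of length \<open>r\<close> at time \<open>t i * T\<close>
minus the window at time \<open>0\<close>, both divided by \<open>s T\<close> and so negligible.  The \<open>max 0\<close> keeps the shift meaningful
for all real \<open>T\<close>.\<close>

lemma shifted_vector_close: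
  assumes \<nu>: "prob_space \<nu>" "sets \<nu> = sets borel"
    and g: "continuous_on UNIV g" "\<And>x. \<bar>g x\<bar> \<le> C" "uniformly_continuous_first n g"
    and t: "\<And>i. i < n \<Longrightarrow> 0 \<le> t i" and r: "0 \<le> r"
    and null: "((\<lambda>T. LINT \<omega>|law_from Q \<nu>. trunc_abs (additive_functional f r \<omega> / s T)) \<longlongrightarrow> 0) at_top"
    and null_shift: "\<And>i. i < n \<Longrightarrow>
      ((\<lambda>T. LINT \<omega>|law_from Q \<nu>. trunc_abs (additive_functional f r (shift (max 0 (t i * T)) \<omega>) / s T)) \<longlongrightarrow> 0) at_top"
  shows "((\<lambda>T. LINT \<omega>|law_from Q \<nu>. \<bar>g (\<lambda>i. additive_functional f (t i * T) (shift r \<omega>) / s T) -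
            g (\<lambda>i. additive_functional f (t i * T) \<omega> / s T)\<bar>) \<longlongrightarrow> 0) at_top"
proof (rule tendstoI)
  fix \<epsilon> :: real assume \<epsilon>: "\<epsilon> > 0"
  interpret P: prob_space "law_from Q \<nu>" by (rule law_from_prob[OF \<nu>])
  obtain K where K: "\<And>x y. \<bar>g x - g y\<bar> \<le> \<epsilon> / 2 + K * (\<Sum>i<n. trunc_abs (x i - y i))"
    using uniformly_continuous_first_bound[OF g(3,2), of "\<epsilon> / 2"] \<epsilon> by auto
  let ?a = "\<lambda>T i. LINT \<omega>|law_from Q \<nu>. trunc_abs (additive_functional f r (shift (max 0 (t i * T)) \<omega>) / s T)"
  let ?b = "\<lambda>T. LINT \<omega>|law_from Q \<nu>. trunc_abs (additive_functional f r \<omega> / s T)"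
  have "((\<lambda>T. \<epsilon> / 2 + \<bar>K\<bar> * (\<Sum>i<n. ?a T i + ?b T)) \<longlongrightarrow> \<epsilon> / 2 + \<bar>K\<bar> * (\<Sum>i<n. 0 + 0)) at_top"
    by (intro tendsto_intros null null_shift) auto
  then have "\<forall>\<^sub>F T in at_top. \<epsilon> / 2 + \<bar>K\<bar> * (\<Sum>i<n. ?a T i + ?b T) < \<epsilon>"
    by (rule order_tendstoD(2)) (use \<epsilon> in simp)
  then show "\<forall>\<^sub>F T in at_top. dist (LINT \<omega>|law_from Q \<nu>. \<bar>g (\<lambda>i. additive_functional f (t i * T) (shift r \<omega>) / s T) -
            g (\<lambda>i. additive_functional f (t i * T) \<omega> / s T)\<bar>) 0 < \<epsilon>"
    using eventually_gt_at_top[of 0]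
  proof eventually_elim
    case (elim T)
    let ?Y = "\<lambda>\<omega> i. additive_functional f (t i * T) \<omega> / s T"
    have mY: "(\<lambda>\<omega>. ?Y \<omega> i) \<in> borel_measurable path_space" for i
      using measurable_additive_functional[OF f] by measurable
    have m: "(\<lambda>\<omega>. g (?Y \<omega>)) \<in> borel_measurable path_space"
      by (rule measurable_test[OF g(1) mY])
    have m': "(\<lambda>\<omega>. g (?Y (shift r \<omega>))) \<in> borel_measurable path_space"
      by (rule measurable_compose[OF measurable_shift[OF r] m])
    have i: "integrable (law_from Q \<nu>) (\<lambda>\<omega>. trunc_abs (additive_functional f r (shift (max 0 (t i * T)) \<omega>) / s T))"
       "integrable (law_from Q \<nu>) (\<lambda>\<omega>. trunc_abs (additive_functional f r \<omega> / s T))" for i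
      by (auto intro!: integrable_law[OF \<nu> _ trunc_abs_bounds(3)] trunc_additive_measurable trunc_additive_shift_measurable)
    have "(LINT \<omega>|law_from Q \<nu>. \<bar>g (?Y (shift r \<omega>)) - g (?Y \<omega>)\<bar>) \<le>
      (LINT \<omega>|law_from Q \<nu>. \<epsilon> / 2 + \<bar>K\<bar> * (\<Sum>i<n. trunc_abs (additive_functional f r (shift (max 0 (t i * T)) \<omega>) / s T) + trunc_abs (additive_functional f r \<omega> / s T)))"
    proof (rule integral_mono)
      show "integrable (law_from Q \<nu>) (\<lambda>\<omega>. \<bar>g (?Y (shift r \<omega>)) - g (?Y \<omega>)\<bar>)"
        using integrable_law[OF \<nu> m g(2)] integrable_law[OF \<nu> m' g(2)] by auto
      fix \<omega> assume "\<omega> \<in> space (law_from Q \<nu>)"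
      then have \<omega>: "\<omega> \<in> space path_space" using space_law[OF \<nu>] by simp
      have "trunc_abs (?Y (shift r \<omega>) i - ?Y \<omega> i) \<le> trunc_abs (additive_functional f r (shift (max 0 (t i * T)) \<omega>) / s T) + trunc_abs (additive_functional f r \<omega> / s T)"
        if "i < n" for i
      proof -
        have "0 \<le> t i * T" using t[OF that] elim by simp
        then have "?Y (shift r \<omega>) i - ?Y \<omega> i = additive_functional f r (shift (max 0 (t i * T)) \<omega>) / s T - additive_functional f r \<omega> / s T"
          using additive_functional_shift_diff[OF f \<omega> r, of "t i * T"] by (simp add: diff_divide_distrib[symmetric])
        then show ?thesis using trunc_abs_diff_le by metis
      qed
      then have "(\<Sum>i<n. trunc_abs (?Y (shift r \<omega>) i - ?Y \<omega> i)) \<le>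
         (\<Sum>i<n. trunc_abs (additive_functional f r (shift (max 0 (t i * T)) \<omega>) / s T) + trunc_abs (additive_functional f r \<omega> / s T))"
        by (intro sum_mono) auto
      then have "K * (\<Sum>i<n. trunc_abs (?Y (shift r \<omega>) i - ?Y \<omega> i)) \<le>
         \<bar>K\<bar> * (\<Sum>i<n. trunc_abs (additive_functional f r (shift (max 0 (t i * T)) \<omega>) / s T) + trunc_abs (additive_functional f r \<omega> / s T))"
        by (intro mult_mono) (auto intro!: sum_nonneg trunc_abs_bounds)
      with K[of "?Y (shift r \<omega>)" "?Y \<omega>"]
      show "\<bar>g (?Y (shift r \<omega>)) - g (?Y \<omega>)\<bar> \<le> \<epsilon> / 2 + \<bar>K\<bar> * (\<Sum>i<n. trunc_abs (additive_functional f r (shift (max 0 (t i * T)) \<omega>) / s T) + trunc_abs (additive_functional f r \<omega> / s T))"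
        by linarith
    qed (use i in auto)
    also have "\<dots> = \<epsilon> / 2 + \<bar>K\<bar> * (\<Sum>i<n. ?a T i + ?b T)"
      using i by (simp add: P.prob_space)
    finally show ?case using elim by (simp add: dist_real_def)
  qed
qed

text \<open>From \<open>\<mu>\<close> to the law \<open>\<eta>\<close> at time \<open>t0\<close> the limit passes by mixing; from \<open>\<eta>\<close> to \<open>\<nu>\<close> by deleting the
initial stretch of length \<open>t0\<close>.  Under \<open>\<nu>\<close> the window at time \<open>0\<close> is negligible because \<open>s\<close> tends
to infinity, the window at a late time because it is a window of the process started
from \<open>\<eta>\<close>.\<close>

lemma vector_limit_transfer:
  assumes null: "\<And>u. 0 \<le> u \<Longrightarrow> ((\<lambda>T. LINT \<omega>|law_from Q \<mu>. trunc_abs (additive_functional f u \<omega> / s T)) \<longlongrightarrow> 0) at_top"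
    and s_inf: "filterlim s at_top at_top"
    and \<nu>: "prob_space \<nu>" "sets \<nu> = sets borel"
    and t0: "0 \<le> t0" and ac: "absolutely_continuous \<mu> (dual_semigroup Q t0 \<nu>)"
    and g: "continuous_on UNIV g" "\<And>x. \<bar>g x\<bar> \<le> C" "uniformly_continuous_first n g"
    and t: "\<And>i. i < n \<Longrightarrow> 0 < t i"
    and lim: "((\<lambda>T. LINT \<omega>|law_from Q \<mu>. g (\<lambda>i. additive_functional f (t i * T) \<omega> / s T)) \<longlongrightarrow> L) at_top"
  shows "((\<lambda>T. LINT \<omega>|law_from Q \<nu>. g (\<lambda>i. additive_functional f (t i * T) \<omega> / s T)) \<longlongrightarrow> L) at_top"
proof -
  define \<eta> where "\<eta> = dual_semigroup Q t0 \<nu>"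
  have \<eta>: "prob_space \<eta>" "sets \<eta> = sets borel" "absolutely_continuous \<mu> \<eta>"
    using dual_semigroup_prob[OF t0 \<nu>] ac by (auto simp: \<eta>_def)
  have t': "0 \<le> t i" if "i < n" for i using t[OF that] by simp
  let ?H = "\<lambda>T \<omega>. g (\<lambda>i. additive_functional f (t i * T) \<omega> / s T)"
  have mH: "?H T \<in> borel_measurable path_space" for T
  proof (rule measurable_test[OF g(1)])
    show "(\<lambda>\<omega>. additive_functional f (t i * T) \<omega> / s T) \<in> borel_measurable path_space" for i
      using measurable_additive_functional[OF f] by measurable
  qed
  have mH': "(\<lambda>\<omega>. ?H T (shift r \<omega>)) \<in> borel_measurable path_space" if "0 \<le> r" for r T
    by (rule measurable_compose[OF measurable_shift[OF that] mH])
  note tm = trunc_additive_measurable and tms = trunc_additive_shift_measurable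
  have \<mu>_null_shift: "((\<lambda>T. LINT \<omega>|law_from Q \<mu>. trunc_abs (additive_functional f u (shift (max 0 (a T)) \<omega>) / s T)) \<longlongrightarrow> 0) at_top"
    if "0 \<le> u" for u and a :: "real \<Rightarrow> real"
    using null[OF that] stationary[OF tm trunc_abs_bounds(3)] by simp
  have "((\<lambda>T. (LINT \<omega>|law_from Q \<eta>. ?H T \<omega>) - (LINT \<omega>|law_from Q \<mu>. ?H T \<omega>)) \<longlongrightarrow> 0) at_top"
  proof (rule asymptotically_shift_invariant_law[OF mH g(2) _ \<eta>])
    fix r :: real assume r: "0 \<le> r"
    show "((\<lambda>T. LINT \<omega>|law_from Q \<mu>. \<bar>?H T (shift r \<omega>) - ?H T \<omega>\<bar>) \<longlongrightarrow> 0) at_top"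
      by (rule shifted_vector_close[OF \<mu>_prob g t' r null[OF r] \<mu>_null_shift[OF r]])
  qed
  from tendsto_add[OF this lim]
  have \<eta>_lim: "((\<lambda>T. LINT \<omega>|law_from Q \<eta>. ?H T \<omega>) \<longlongrightarrow> L) at_top" by simp
  interpret P\<nu>: prob_space "law_from Q \<nu>" by (rule law_from_prob[OF \<nu>])
  have s\<nu>: "sets (law_from Q \<nu>) = sets path_space" by (rule law_from_prob[OF \<nu>])
  have "((\<lambda>T. LINT \<omega>|law_from Q \<nu>. \<bar>?H T (shift t0 \<omega>) - ?H T \<omega>\<bar>) \<longlongrightarrow> 0) at_top"
  proof (rule shifted_vector_close[OF \<nu> g t' t0])
    have "((\<lambda>T. LINT \<omega>|law_from Q \<nu>. trunc_abs (additive_functional f t0 \<omega> / s T)) \<longlongrightarrow> (LINT \<omega>|law_from Q \<nu>. 0)) at_top"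
    proof (rule integral_dominated_convergence_at_top[where w="\<lambda>_. 1"])
      show "(\<lambda>\<omega>. trunc_abs (additive_functional f t0 \<omega> / s T)) \<in> borel_measurable (law_from Q \<nu>)" for T
        using tm by (simp cong: measurable_cong_sets add: s\<nu>)
      show "AE \<omega> in law_from Q \<nu>. ((\<lambda>T. trunc_abs (additive_functional f t0 \<omega> / s T)) \<longlongrightarrow> 0) at_top"
        by (intro AE_I2 tendsto_trunc_abs_zero tendsto_divide_0[OF tendsto_const]
            filterlim_at_top_imp_at_infinity[OF s_inf])
    qed (auto simp: trunc_abs_bounds)
    then show "((\<lambda>T. LINT \<omega>|law_from Q \<nu>. trunc_abs (additive_functional f t0 \<omega> / s T)) \<longlongrightarrow> 0) at_top" by simp
    fix i assume i: "i < n"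
    let ?G = "\<lambda>T \<omega>. trunc_abs (additive_functional f t0 (shift (max 0 (t i * T - t0)) \<omega>) / s T)"
    have "((\<lambda>T. LINT \<omega>|law_from Q \<eta>. ?G T \<omega>) \<longlongrightarrow> 0) at_top"
      by (rule null_law_transfer[OF tms _ _ \<mu>_null_shift[OF t0] \<eta>, where C=1]) (auto simp: trunc_abs_bounds)
    moreover have "\<forall>\<^sub>F T in at_top. (LINT \<omega>|law_from Q \<nu>. trunc_abs (additive_functional f t0 (shift (max 0 (t i * T)) \<omega>) / s T)) = (LINT \<omega>|law_from Q \<eta>. ?G T \<omega>)"
      using eventually_ge_at_top[of "t0 / t i"]
    proof eventually_elim
      case (elim T)
      then have T: "t0 \<le> t i * T" using t[OF i] by (simp add: field_simps)
      then have "shift (max 0 (t i * T)) \<omega> = shift (max 0 (t i * T - t0)) (shift t0 \<omega>)" for \<omega> :: "real \<Rightarrow> 'a"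
        using t0 by (simp add: shift_shift)
      then have "(LINT \<omega>|law_from Q \<nu>. trunc_abs (additive_functional f t0 (shift (max 0 (t i * T)) \<omega>) / s T)) = (LINT \<omega>|law_from Q \<nu>. ?G T (shift t0 \<omega>))"
        by simp
      also have "\<dots> = (LINT \<omega>|law_from Q \<eta>. ?G T \<omega>)"
        unfolding \<eta>_def by (rule integral_law_from_shift[OF tms trunc_abs_bounds(3) t0 \<nu>]) simp
      finally show ?case .
    qed
    ultimately show "((\<lambda>T. LINT \<omega>|law_from Q \<nu>. trunc_abs (additive_functional f t0 (shift (max 0 (t i * T)) \<omega>) / s T)) \<longlongrightarrow> 0) at_top"
      by (simp add: filterlim_cong[OF refl refl])
  qed
  then have "((\<lambda>T. (LINT \<omega>|law_from Q \<nu>. ?H T (shift t0 \<omega>)) - (LINT \<omega>|law_from Q \<nu>. ?H T \<omega>)) \<longlongrightarrow> 0) at_top"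
  proof (rule Lim_null_comparison[OF always_eventually, rotated], intro allI)
    fix T
    have "(LINT \<omega>|law_from Q \<nu>. ?H T (shift t0 \<omega>)) - (LINT \<omega>|law_from Q \<nu>. ?H T \<omega>) = (LINT \<omega>|law_from Q \<nu>. ?H T (shift t0 \<omega>) - ?H T \<omega>)"
      using integrable_law[OF \<nu> mH g(2)] integrable_law[OF \<nu> mH'[OF t0] g(2)] by simp
    then show "norm ((LINT \<omega>|law_from Q \<nu>. ?H T (shift t0 \<omega>)) - (LINT \<omega>|law_from Q \<nu>. ?H T \<omega>)) \<le> (LINT \<omega>|law_from Q \<nu>. \<bar>?H T (shift t0 \<omega>) - ?H T \<omega>\<bar>)"
      using integral_abs_bound by simp
  qed
  moreover have "(LINT \<omega>|law_from Q \<nu>. ?H T (shift t0 \<omega>)) = (LINT \<omega>|law_from Q \<eta>. ?H T \<omega>)" for T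
    unfolding \<eta>_def by (rule integral_law_from_shift[OF mH g(2) t0 \<nu>])
  ultimately have "((\<lambda>T. (LINT \<omega>|law_from Q \<eta>. ?H T \<omega>) - (LINT \<omega>|law_from Q \<nu>. ?H T \<omega>)) \<longlongrightarrow> 0) at_top" by simp
  from tendsto_diff[OF \<eta>_lim this] show ?thesis by simp
qed

end

end

section \<open>Brownian marginals and the transfer\<close>

lemma brownian_trunc_tendsto_0:
  assumes "standard_brownian_motion N BM"
  shows "((\<lambda>v. LINT \<omega>|N. trunc_abs (BM v \<omega>)) \<longlongrightarrow> 0) (at_right 0)"
proof -
  have N: "prob_space N" and m: "\<And>t. 0 \<le> t \<Longrightarrow> BM t \<in> borel_measurable N"
    and z: "AE \<omega> in N. BM 0 \<omega> = 0" and c: "AE \<omega> in N. continuous_on {0..} (\<lambda>t. BM t \<omega>)"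
    using assms by (auto simp: standard_brownian_motion_def)
  interpret prob_space N by (rule N)
  have "((\<lambda>T. LINT \<omega>|N. trunc_abs (BM (max 0 (inverse T)) \<omega>)) \<longlongrightarrow> (LINT \<omega>|N. 0)) at_top"
  proof (rule integral_dominated_convergence_at_top[where w="\<lambda>_. 1"])
    show "(\<lambda>\<omega>. trunc_abs (BM (max 0 (inverse T)) \<omega>)) \<in> borel_measurable N" for T
      by (rule measurable_compose[OF m borel_measurable_trunc_abs]) simp
    \<comment> \<open>The path is continuous only on the nonnegative half-line; hence the \<open>max 0\<close>.\<close>
    have "((\<lambda>T. max 0 (inverse T)) \<longlongrightarrow> max 0 0) (at_top :: real filter)"
      by (intro tendsto_max tendsto_const tendsto_inverse_0_at_top filterlim_ident)
    then have t: "((\<lambda>T. max 0 (inverse T)) \<longlongrightarrow> (0::real)) at_top" by simp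
    show "AE \<omega> in N. ((\<lambda>T. trunc_abs (BM (max 0 (inverse T)) \<omega>)) \<longlongrightarrow> 0) at_top"
      using z c
    proof eventually_elim
      case (elim \<omega>)
      have "((\<lambda>T. BM (max 0 (inverse T)) \<omega>) \<longlongrightarrow> BM 0 \<omega>) at_top"
        by (rule continuous_on_tendsto_compose[OF elim(2) t]) auto
      then show ?case using elim(1) by (intro tendsto_trunc_abs_zero) simp
    qed
  qed (auto simp: trunc_abs_bounds)
  moreover have "\<forall>\<^sub>F T in at_top. (LINT \<omega>|N. trunc_abs (BM (max 0 (inverse T)) \<omega>)) = (LINT \<omega>|N. trunc_abs (BM (inverse T) \<omega>))"
    using eventually_gt_at_top[of 0] by eventually_elim (simp add: max_def)
  ultimately show ?thesis
    unfolding filterlim_at_right_to_top by (simp add: filterlim_cong[OF refl refl])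
qed

lemma brownian_trunc_pos:
  assumes "standard_brownian_motion N BM"
  shows "0 < (LINT \<omega>|N. trunc_abs (BM 1 \<omega>))"
proof -
  have N: "prob_space N" and m: "BM 1 \<in> borel_measurable N"
    and z: "AE \<omega> in N. BM 0 \<omega> = 0"
    and "\<forall>s t. 0 \<le> s \<and> s < t \<longrightarrow> distributed N lborel (\<lambda>\<omega>. BM t \<omega> - BM s \<omega>) (normal_density 0 (sqrt (t - s)))"
    using assms by (auto simp: standard_brownian_motion_def)
  from this(4)[rule_format, of 0 1]
  have d: "distributed N lborel (\<lambda>\<omega>. BM 1 \<omega> - BM 0 \<omega>) (normal_density 0 1)" by simp
  interpret prob_space N by (rule N)
  have "{0::real} \<in> sets lborel" by simp
  from distributed_emeasure[OF d this]
  have "emeasure N ((\<lambda>\<omega>. BM 1 \<omega> - BM 0 \<omega>) -` {0} \<inter> space N) = 0"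
    by (simp add: nn_integral_0_iff_AE)
  then have ne: "AE \<omega> in N. BM 1 \<omega> - BM 0 \<omega> \<noteq> 0"
    using distributed_measurable[OF d]
    by (intro AE_I[of _ _ "(\<lambda>\<omega>. BM 1 \<omega> - BM 0 \<omega>) -` {0} \<inter> space N"]) (auto intro: measurable_sets)
  have mt: "(\<lambda>\<omega>. trunc_abs (BM 1 \<omega>)) \<in> borel_measurable N"
    by (rule measurable_compose[OF m borel_measurable_trunc_abs])
  have i: "integrable N (\<lambda>\<omega>. trunc_abs (BM 1 \<omega>))"
    by (rule integrable_const_bound[of _ 1]) (use mt in \<open>auto simp: trunc_abs_bounds\<close>)
  have "(LINT \<omega>|N. trunc_abs (BM 1 \<omega>)) \<noteq> 0"
  proof
    assume "(LINT \<omega>|N. trunc_abs (BM 1 \<omega>)) = 0"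
    then have "AE \<omega> in N. trunc_abs (BM 1 \<omega>) = 0"
      using integral_nonneg_eq_0_iff_AE[OF i] trunc_abs_bounds by simp
    with ne z have "AE \<omega> in N. False"
      by eventually_elim (simp add: trunc_abs_eq_0_iff)
    then show False by simp
  qed
  moreover have "0 \<le> (LINT \<omega>|N. trunc_abs (BM 1 \<omega>))"
    by (intro Bochner_Integration.integral_nonneg trunc_abs_bounds)
  ultimately show ?thesis by simp
qed

lemma ergodic_diffusion_imp_ergodic_markov_paths:
  assumes "ergodic_diffusion A B Q \<mu>"
  shows "ergodic_markov_paths Q \<mu>"
proof -
  interpret ergodic_diffusion A B Q \<mu> by fact
  show ?thesis
    by unfold_locales (fact Q_kernel Q_strong_markov \<mu>_invariant \<mu>_unique)+
qed

text \<open>The limit theorem under \<open>\<mu>\<close> is used twice: its marginals at single times give the negligible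
windows and the growth of \<open>s\<close>, and its joint laws are what is transferred.  Limits are taken in
\<open>T = 1 / \<epsilon>\<close>, at infinity.\<close>

theorem (in ergodic_markov_paths) FCLT_transfer:
  fixes f :: "'a \<Rightarrow> real" and s :: "real \<Rightarrow> real"
  assumes f: "continuous_on UNIV f"
    and s: "\<And>t. t > 0 \<Longrightarrow> s t > 0"
    and \<nu>: "prob_space \<nu>" "sets \<nu> = sets borel"
    and ac: "\<exists>t>0. absolutely_continuous \<mu> (dual_semigroup Q t \<nu>)"
    and BM: "standard_brownian_motion N BM"
    and FCLT_\<mu>: "FCLT (law_from Q \<mu>) f s N BM"
  shows "FCLT (law_from Q \<nu>) f s N BM"
proof -
  obtain t0 where t0: "0 < t0" "absolutely_continuous \<mu> (dual_semigroup Q t0 \<nu>)" using ac by auto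
  have N: "prob_space N" and mBM: "\<And>t. 0 \<le> t \<Longrightarrow> BM t \<in> borel_measurable N"
    using BM by (auto simp: standard_brownian_motion_def)
  have law_\<mu>: "((\<lambda>T. LINT \<omega>|law_from Q \<mu>. g (\<lambda>i. additive_functional f (t i * T) \<omega> / s T)) \<longlongrightarrow>
        (LINT \<omega>|N. g (\<lambda>i. BM (t i) \<omega>))) at_top"
    if g: "continuous_on UNIV g" "\<And>x. \<bar>g x\<bar> \<le> C" "depends_on_first n g"
      and t: "\<forall>i<n. 0 < t i" "\<forall>i j. i \<le> j \<and> j < n \<longrightarrow> t i \<le> t j" for g C n t
  proof -
    have "converges_in_law n (law_from Q \<mu>) (\<lambda>\<epsilon> \<omega> i. additive_functional f (t i / \<epsilon>) \<omega> / s (1 / \<epsilon>))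
        (at_right 0) N (\<lambda>\<omega> i. BM (t i) \<omega>)"
      using FCLT_\<mu> t unfolding FCLT_def by blast
    from converges_in_law_test[OF this g] show ?thesis
      by (simp add: filterlim_at_right_to_top divide_inverse)
  qed
  have marginal: "((\<lambda>T. LINT \<omega>|law_from Q \<mu>. trunc_abs (additive_functional f (v * T) \<omega> / s T)) \<longlongrightarrow>
        (LINT \<omega>|N. trunc_abs (BM v \<omega>))) at_top" if "v > 0" for v
  proof -
    have "continuous_on UNIV (\<lambda>x :: nat \<Rightarrow> real. trunc_abs (x 0))"
      by (intro continuous_intros continuous_on_product_coordinates)
    moreover have "depends_on_first 1 (\<lambda>x. trunc_abs (x 0))" by (simp add: depends_on_first_def tuple_def)
    ultimately show ?thesis
      using law_\<mu>[of "\<lambda>x. trunc_abs (x 0)" 1 1 "\<lambda>_. v"] that trunc_abs_bounds(3) by simp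
  qed
  have null: "((\<lambda>T. LINT \<omega>|law_from Q \<mu>. trunc_abs (additive_functional f u \<omega> / s T)) \<longlongrightarrow> 0) at_top" if "0 \<le> u" for u
    by (rule normalized_window_null[OF f marginal brownian_trunc_tendsto_0[OF BM] that])
  have s_inf: "filterlim s at_top at_top"
  proof -
    have "\<forall>\<^sub>F T in at_top. 0 < (LINT \<omega>|law_from Q \<mu>. trunc_abs (additive_functional f (1 * T) \<omega> / s T))"
      using order_tendstoD(1)[OF marginal[of 1] brownian_trunc_pos[OF BM]] by simp
    from eventually_conj[OF this eventually_gt_at_top[of 0]]
    obtain T0 where "0 < T0" "0 < (LINT \<omega>|law_from Q \<mu>. trunc_abs (additive_functional f T0 \<omega> / s T0))"
      by (auto dest!: eventually_happens'[OF trivial_limit_at_top_linorder])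
    with normalization_tendsto_infinity[OF f s null] show ?thesis by blast
  qed
  show ?thesis unfolding FCLT_def
  proof (intro allI impI, elim conjE)
    fix n and t :: "nat \<Rightarrow> real"
    assume t: "\<forall>i<n. 0 < t i" "\<forall>i j. i \<le> j \<and> j < n \<longrightarrow> t i \<le> t j"
    show "converges_in_law n (law_from Q \<nu>) (\<lambda>\<epsilon> \<omega> i. additive_functional f (t i / \<epsilon>) \<omega> / s (1 / \<epsilon>))
        (at_right 0) N (\<lambda>\<omega> i. BM (t i) \<omega>)"
    proof (rule converges_in_lawI[OF law_from_prob(1)[OF \<nu>] N])
      show "(\<lambda>\<omega>. additive_functional f (t i / \<epsilon>) \<omega> / s (1 / \<epsilon>)) \<in> borel_measurable (law_from Q \<nu>)" for \<epsilon> i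
        using measurable_additive_functional[OF f, of "t i / \<epsilon>"] law_from_prob(2)[OF \<nu>]
        by (simp cong: measurable_cong_sets)
      show "(\<lambda>\<omega>. BM (t i) \<omega>) \<in> borel_measurable N" if "i < n" for i
        using mBM[of "t i"] t(1) that by (simp add: less_imp_le)
      fix g C assume g: "continuous_on UNIV g" "\<And>x. \<bar>g x\<bar> \<le> C" "depends_on_first n g" "uniformly_continuous_first n g"
      have "((\<lambda>T. LINT \<omega>|law_from Q \<nu>. g (\<lambda>i. additive_functional f (t i * T) \<omega> / s T)) \<longlongrightarrow>
          (LINT \<omega>|N. g (\<lambda>i. BM (t i) \<omega>))) at_top"
        by (rule vector_limit_transfer[OF f null s_inf \<nu> less_imp_le[OF t0(1)] t0(2) g(1,2,4) _ law_\<mu>[OF g(1-3) t]])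
           (use t in auto)
      then show "((\<lambda>\<epsilon>. LINT \<omega>|law_from Q \<nu>. g (\<lambda>i. additive_functional f (t i / \<epsilon>) \<omega> / s (1 / \<epsilon>))) \<longlongrightarrow>
          (LINT \<omega>|N. g (\<lambda>i. BM (t i) \<omega>))) (at_right 0)"
        by (simp add: filterlim_at_right_to_top divide_inverse)
    qed
  qed
qed

theorem theorem8p7:
  fixes A :: "real^'d \<Rightarrow> real^'d^'d"
    and B :: "real^'d \<Rightarrow> real^'d"
    and Q :: "real^'d \<Rightarrow> (real \<Rightarrow> real^'d) measure"
    and \<mu> \<nu> :: "(real^'d) measure"
    and f :: "real^'d \<Rightarrow> real"
    and s :: "real \<Rightarrow> real"
    and N :: "'b measure"
    and BM :: "real \<Rightarrow> 'b \<Rightarrow> real"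
  assumes diffusion: "ergodic_diffusion A B Q \<mu>"
    and f_L2: "integrable \<mu> (\<lambda>x. (f x)^2)"
    and f_nonzero: "\<not> (AE x in \<mu>. f x = 0)"
    and f_centered: "(LINT x|\<mu>. f x) = 0"
    and f_continuous: "continuous_on UNIV f"
    and s_positive: "\<And>t. t > 0 \<Longrightarrow> s t > 0"
    and \<nu>_prob: "prob_space \<nu>" "sets \<nu> = sets borel"
    and \<nu>_ac: "\<exists>t>0. absolutely_continuous \<mu> (dual_semigroup Q t \<nu>)"
    and A_or_B: "lyapunov_assumption Q \<mu> \<nu> \<or> reversible_assumption A B Q \<mu> \<nu>"
    and brownian: "standard_brownian_motion N BM"
    and FCLT_\<mu>: "FCLT (law_from Q \<mu>) f s N BM"
  shows "FCLT (law_from Q \<nu>) f s N BM"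
  using ergodic_markov_paths.FCLT_transfer[OF ergodic_diffusion_imp_ergodic_markov_paths[OF diffusion]
      f_continuous s_positive \<nu>_prob \<nu>_ac brownian FCLT_\<mu>] .

end
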